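(* Let $\mathbb{G}$ be a Carnot group of homogeneous dimension $Q\ge 3$ and let $\Omega\subset\mathbb{G}$ be an open set. Let $u\in C(\Omega)$ be such that $|\nabla_{\mathbb{G}}u|^2\in L^1_{\mathrm{loc}}(\Omega)$. For every $x_0\in\partial\{u>0\}\cap\Omega$, if both functions $$r\mapsto \mathcal{M}_r\left(\left(\frac{|\nabla_{\mathbb{G}}u^{+}(x_0\circ\cdot)|}{|\nabla_{\mathbb{G}}|\cdot||}\right)^2\right)(0)\qquad\text{and}\qquad r\mapsto \mathcal{M}_r\left(\left(\frac{|\nabla_{\mathbb{G}}u^{-}(x_0\circ\cdot)|}{|\nabla_{\mathbb{G}}|\cdot||}\right)^2\right)(0)$$ are monotone increasing almost everywhere in a right neighborhood of $0$, then the function $r\mapsto J^{\mathbb{G}}_{u,x_0}(r)$, where $$J^{\mathbb{G}}_{u,x_0}(r):=\frac1{r^4}\int_{D(x_0,r)}|\nabla_{\mathbb{G}}u^+(\xi)|^2\,\Gamma(x_0,\xi)\,d\xi\;\int_{D(x_0,r)}|\nabla_{\mathbb{G}}u^-(\xi)|^2\,\Gamma(x_0,\xi)\,d\xi,$$ is monotone increasing in a right neighborhood of $0$.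
   Context: Carnot group: $(\mathbb{G},\circ)$ is a simply connected nilpotent Lie group whose Lie algebra $\mathfrak{g}$ is stratified, $\mathfrak{g}=V_1\oplus\dots\oplus V_\kappa$, $[V_1,V_i]=V_{i+1}$, $V_\kappa\ne\{0\}$, $V_i=\{0\}$ for $i>\kappa$. Via exponential coordinates $\mathbb{G}$ is identified with $\mathbb{R}^N$, $N=\dim\mathfrak{g}$, with unit element $0$, using a basis adapted to the stratification; the dilations are $\delta_\lambda(x_1,\dots,x_N)=(\lambda^{d_1}x_1,\dots,\lambda^{d_N}x_N)$, $\lambda>0$, with $d_j=i$ if the $j$-th basis vector lies in $V_i$. The homogeneous dimension is $Q=\sum_{i=1}^\kappa i\dim V_i$. Haar measure is Lebesgue measure $d\xi$ on $\mathbb{R}^N$. Horizontal gradient and sub-Laplacian: $X_1,\dots,X_m$ ($m=\dim V_1$) is the basis of left-invariant vector fields of $V_1$ with $X_i(0)=e_i$; $\nabla_{\mathbb{G}}f=(X_1f,\dots,X_mf)$ (understood in the weak sense when $f$ is not smooth), $|\nabla_{\mathbb{G}}f|^2=\sum_{j=1}^m(X_jf)^2$, and $\Delta_{\mathbb{G}}=\sum_{j=1}^mX_j^2$. The symbol $\nabla$ denotes the Euclidean gradient in $\mathbb{R}^N$. Fundamental solution and norm: $\Gamma$ is the fundamental solution of $\Delta_{\mathbb{G}}$, i.e. $\int_{\mathbb{R}^N}\Gamma(x,y)\,\Delta_{\mathbb{G}}\varphi(x)\,dx=-\varphi(y)$ for all $\varphi\in C_0^\infty(\mathbb{R}^N)$.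 For $Q\ge 3$ there are a homogeneous norm $|\cdot|$ on $\mathbb{G}$ (homogeneous of degree $1$ with respect to $\delta_\lambda$, smooth away from $0$) and a constant $c_Q>0$ such that $\Gamma(x,y)=c_Q|x^{-1}\circ y|^{2-Q}$; this $|\cdot|$ is the norm used throughout. Write $\Gamma(\xi)=\Gamma(0,\xi)$ and $D(x_0,r)=\{y\in\mathbb{G}:|x_0^{-1}\circ y|<r\}$. Mean value: $$\mathcal{M}_r(w)(x_0):=\int_{\partial D(x_0,r)}w(y)\,\mathcal{K}(x_0^{-1}\circ y)\,d\sigma(y),\qquad \mathcal{K}:=\frac{|\nabla_{\mathbb{G}}\Gamma|^2}{|\nabla\Gamma|},$$ where $\sigma$ is the Euclidean $(N-1)$-dimensional Hausdorff measure. For functions $w$ that are not continuous the same formula is used, and it is understood for almost every $r$. Other notation: $u^+=\max\{u,0\}$, $u^-=\max\{-u,0\}$, $\{u>0\}=\{x\in\Omega:u(x)>0\}$. A right neighborhood of $0$ is an interval $(0,\delta)$ with $\delta>0$. "Monotone increasing" means nondecreasing; "monotone increasing almost everywhere" in $(0,\delta)$ means that the inequality $F(r_1)\le F(r_2)$ holds for $r_1\le r_2$ outside a null set of $(0,\delta)$. $J^{\mathbb{G}}_{u,x_0}(r)$ is considered for $r$ small enough that $\overline{D(x_0,r)}\subset\Omega$. *)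

theory Defs
  imports "HOL-Analysis.Analysis"
begin

section \<open>Smooth functions\<close>

primrec Ck_on :: "nat \<Rightarrow> 'a::real_normed_vector set \<Rightarrow> ('a \<Rightarrow> 'b::real_normed_vector) \<Rightarrow> bool" where
  "Ck_on 0 S f \<longleftrightarrow> continuous_on S f"
| "Ck_on (Suc k) S f \<longleftrightarrow>
     (\<forall>x\<in>S. f differentiable (at x)) \<and> (\<forall>v. Ck_on k S (\<lambda>x. frechet_derivative f (at x) v))"

text \<open>Used for open \<open>S\<close> only; the derivatives are taken in the ambient space.\<close>

definition smooth_on :: "'a::real_normed_vector set \<Rightarrow> ('a \<Rightarrow> 'b::real_normed_vector) \<Rightarrow> bool" where
  "smooth_on S f \<longleftrightarrow> (\<forall>k. Ck_on k S f)"

definition test_function :: "'a::real_normed_vector set \<Rightarrow> ('a \<Rightarrow> real) \<Rightarrow> bool" where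
  "test_function \<Omega> \<phi> \<longleftrightarrow>
     smooth_on UNIV \<phi> \<and> (\<exists>K. compact K \<and> K \<subseteq> \<Omega> \<and> (\<forall>x. x \<notin> K \<longrightarrow> \<phi> x = 0))"

definition locally_integrable_on :: "'a::euclidean_space set \<Rightarrow> ('a \<Rightarrow> real) \<Rightarrow> bool" where
  "locally_integrable_on \<Omega> f \<longleftrightarrow>
     (\<forall>K. compact K \<and> K \<subseteq> \<Omega> \<longrightarrow> f absolutely_integrable_on K)"


section \<open>Carnot groups in exponential coordinates\<close>

text \<open>
  \<open>left_field m v\<close> is the left-invariant vector field with value \<open>v\<close> at the unit \<open>0\<close> of the
  group law \<open>m\<close>. The Lie algebra is identified with the tangent space at \<open>0\<close>, and
  \<open>lie_bracket m v w\<close> is the value at \<open>0\<close> of the commutator of the two left-invariant fields.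
\<close>

definition left_field :: "('a \<Rightarrow> 'a \<Rightarrow> 'a::real_normed_vector) \<Rightarrow> 'a \<Rightarrow> 'a \<Rightarrow> 'a" where
  "left_field m v x = frechet_derivative (m x) (at 0) v"

definition lie_bracket :: "('a \<Rightarrow> 'a \<Rightarrow> 'a::real_normed_vector) \<Rightarrow> 'a \<Rightarrow> 'a \<Rightarrow> 'a" where
  "lie_bracket m v w =
     frechet_derivative (left_field m w) (at 0) v - frechet_derivative (left_field m v) (at 0) w"

text \<open>The weight \<open>d j\<close> is the index of the layer that contains the \<open>j\<close>-th basis vector.\<close>

definition layer :: "('n \<Rightarrow> nat) \<Rightarrow> nat \<Rightarrow> (real ^ 'n) set" where
  "layer d i = span {axis j 1 | j. d j = i}"

definition dilation :: "('n \<Rightarrow> nat) \<Rightarrow> real \<Rightarrow> real ^ 'n \<Rightarrow> real ^ 'n" where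
  "dilation d s x = (\<chi> j. s ^ d j * x $ j)"

definition step :: "('n::finite \<Rightarrow> nat) \<Rightarrow> nat" where
  "step d = Max (range d)"

definition homogeneous_dim :: "('n::finite \<Rightarrow> nat) \<Rightarrow> nat" where
  "homogeneous_dim d = (\<Sum>i=1..step d. i * dim (layer d i))"

text \<open>
  A Lie group structure on \<open>\<real>\<^sup>N\<close> (hence simply connected) whose Lie algebra is stratified by the
  layers spanned by the basis vectors of equal weight. Since the layers beyond \<open>step d\<close> vanish by
  definition, nilpotency is a consequence of \<open>stratified\<close>. The assumption \<open>exp_coords\<close> says that
  \<open>t \<mapsto> t v\<close> is the one-parameter subgroup with velocity \<open>v\<close>, i.e. that the exponential map is the
  identity. The assumption \<open>haar\<close> records that Lebesgue measure is the Haar measure, as always in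
  exponential coordinates.
\<close>

locale carnot_group = group m 0 \<iota>
  for m :: "real ^ 'n \<Rightarrow> real ^ 'n \<Rightarrow> real ^ 'n" and \<iota> :: "real ^ 'n \<Rightarrow> real ^ 'n" +
  fixes d :: "'n \<Rightarrow> nat"
  assumes smooth_mult: "smooth_on UNIV (\<lambda>p. m (fst p) (snd p))"
    and smooth_inv: "smooth_on UNIV \<iota>"
    and exp_coords: "m (s *\<^sub>R v) (t *\<^sub>R v) = (s + t) *\<^sub>R v"
    and weight_pos: "1 \<le> d j"
    and stratified: "1 \<le> i \<Longrightarrow>
      span {lie_bracket m v w | v w. v \<in> layer d 1 \<and> w \<in> layer d i} = layer d (Suc i)"
    and haar: "distr lborel borel (m a) = lborel"

definition homogeneous_norm :: "('n::finite \<Rightarrow> nat) \<Rightarrow> (real ^ 'n \<Rightarrow> real) \<Rightarrow> bool" where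
  "homogeneous_norm d \<rho> \<longleftrightarrow>
     continuous_on UNIV \<rho> \<and> smooth_on (- {0}) \<rho> \<and> (\<forall>x. 0 \<le> \<rho> x) \<and> (\<forall>x. \<rho> x = 0 \<longleftrightarrow> x = 0) \<and>
     (\<forall>s x. 0 < s \<longrightarrow> \<rho> (dilation d s x) = s * \<rho> x)"

definition gauge_ball ::
  "('a \<Rightarrow> 'a \<Rightarrow> 'a) \<Rightarrow> ('a \<Rightarrow> 'a) \<Rightarrow> ('a \<Rightarrow> real) \<Rightarrow> 'a \<Rightarrow> real \<Rightarrow> 'a set" where
  "gauge_ball m \<iota> \<rho> x\<^sub>0 r = {y. \<rho> (m (\<iota> x\<^sub>0) y) < r}"


section \<open>Gradients and the sub-Laplacian\<close>

definition grad :: "(real ^ 'n \<Rightarrow> real) \<Rightarrow> real ^ 'n \<Rightarrow> real ^ 'n" where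
  "grad f x = (\<chi> j. frechet_derivative f (at x) (axis j 1))"

definition left_deriv ::
  "(real ^ 'n \<Rightarrow> real ^ 'n \<Rightarrow> real ^ 'n) \<Rightarrow> 'n \<Rightarrow> (real ^ 'n \<Rightarrow> real) \<Rightarrow> real ^ 'n \<Rightarrow> real" where
  "left_deriv m j f x = frechet_derivative f (at x) (left_field m (axis j 1) x)"

text \<open>
  Horizontal gradients take values in \<open>\<real>\<^sup>N\<close>; the components outside the first layer are \<open>0\<close>, so that
  the Euclidean norm of such a vector involves the horizontal components only.
\<close>

definition hgrad ::
  "(real ^ 'n \<Rightarrow> real ^ 'n \<Rightarrow> real ^ 'n) \<Rightarrow> ('n \<Rightarrow> nat) \<Rightarrow> (real ^ 'n \<Rightarrow> real) \<Rightarrow> real ^ 'n \<Rightarrow> real ^ 'n"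
  where
  "hgrad m d f x = (\<chi> j. if d j = 1 then left_deriv m j f x else 0)"

definition sub_laplacian ::
  "(real ^ 'n \<Rightarrow> real ^ 'n \<Rightarrow> real ^ 'n) \<Rightarrow> ('n \<Rightarrow> nat) \<Rightarrow> (real ^ 'n \<Rightarrow> real) \<Rightarrow> real ^ 'n \<Rightarrow> real"
  where
  "sub_laplacian m d f x = (\<Sum>j | d j = 1. left_deriv m j (left_deriv m j f) x)"

text \<open>
  The vector fields are divergence free, hence formally skew-adjoint for Lebesgue measure.
\<close>

definition has_weak_hgrad ::
  "(real ^ 'n \<Rightarrow> real ^ 'n \<Rightarrow> real ^ 'n) \<Rightarrow> ('n \<Rightarrow> nat) \<Rightarrow> (real ^ 'n) set \<Rightarrow>
    (real ^ 'n \<Rightarrow> real) \<Rightarrow> (real ^ 'n \<Rightarrow> real ^ 'n) \<Rightarrow> bool" where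
  "has_weak_hgrad m d \<Omega> f g \<longleftrightarrow>
     locally_integrable_on \<Omega> f \<and>
     (\<forall>j. d j = 1 \<longrightarrow>
        locally_integrable_on \<Omega> (\<lambda>x. g x $ j) \<and>
        (\<forall>\<phi>. test_function \<Omega> \<phi> \<longrightarrow>
           (LINT x:\<Omega>|lebesgue. f x * left_deriv m j \<phi> x) =
           - (LINT x:\<Omega>|lebesgue. g x $ j * \<phi> x))) \<and>
     (\<forall>j x. d j \<noteq> 1 \<longrightarrow> g x $ j = 0)"

text \<open>A representative, unique up to a null subset of \<open>\<Omega>\<close>; by convention \<open>0\<close> if there is none.\<close>

definition weak_hgrad ::
  "(real ^ 'n \<Rightarrow> real ^ 'n \<Rightarrow> real ^ 'n) \<Rightarrow> ('n \<Rightarrow> nat) \<Rightarrow> (real ^ 'n) set \<Rightarrow>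
    (real ^ 'n \<Rightarrow> real) \<Rightarrow> real ^ 'n \<Rightarrow> real ^ 'n" where
  "weak_hgrad m d \<Omega> f =
     (if \<exists>g. has_weak_hgrad m d \<Omega> f g then SOME g. has_weak_hgrad m d \<Omega> f g else (\<lambda>x. 0))"

definition fundamental_solution ::
  "(real ^ 'n \<Rightarrow> real ^ 'n \<Rightarrow> real ^ 'n) \<Rightarrow> ('n \<Rightarrow> nat) \<Rightarrow>
    (real ^ 'n \<Rightarrow> real ^ 'n \<Rightarrow> real) \<Rightarrow> bool" where
  "fundamental_solution m d \<Gamma> \<longleftrightarrow>
     (\<forall>\<phi> y. test_function UNIV \<phi> \<longrightarrow>
        has_bochner_integral lebesgue (\<lambda>x. \<Gamma> x y * sub_laplacian m d \<phi> x) (- \<phi> y))"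


section \<open>Hausdorff measure\<close>

definition hausdorff_pre :: "nat \<Rightarrow> real \<Rightarrow> 'a::metric_space set \<Rightarrow> ennreal" where
  "hausdorff_pre k \<delta> A =
     (INF U \<in> {U :: nat \<Rightarrow> 'a set. A \<subseteq> (\<Union>i. U i) \<and> (\<forall>i. bounded (U i) \<and> diameter (U i) \<le> \<delta>)}.
        \<Sum>i. if U i = {} then 0 else ennreal (unit_ball_vol (real k) * (diameter (U i) / 2) ^ k))"

definition hausdorff_outer :: "nat \<Rightarrow> 'a::metric_space set \<Rightarrow> ennreal" where
  "hausdorff_outer k A = (SUP \<delta> \<in> {0<..}. hausdorff_pre k \<delta> A)"

definition hausdorff_measure :: "nat \<Rightarrow> 'a::metric_space measure" where
  "hausdorff_measure k = measure_of UNIV (sets borel) (hausdorff_outer k)"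


section \<open>Mean values and the monotonicity functional\<close>

definition kernel ::
  "(real ^ 'n \<Rightarrow> real ^ 'n \<Rightarrow> real ^ 'n) \<Rightarrow> ('n \<Rightarrow> nat) \<Rightarrow> (real ^ 'n \<Rightarrow> real ^ 'n \<Rightarrow> real) \<Rightarrow>
    real ^ 'n \<Rightarrow> real" where
  "kernel m d \<Gamma> \<xi> = (norm (hgrad m d (\<Gamma> 0) \<xi>))\<^sup>2 / norm (grad (\<Gamma> 0) \<xi>)"

text \<open>
  Mean values and \<open>J\<close> are formed for nonnegative integrands, with values in \<open>[0,\<infinity>]\<close>.
\<close>

definition mean_value ::
  "(real ^ 'n \<Rightarrow> real ^ 'n \<Rightarrow> real ^ 'n) \<Rightarrow> (real ^ 'n \<Rightarrow> real ^ 'n) \<Rightarrow> ('n \<Rightarrow> nat) \<Rightarrow>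
    (real ^ 'n \<Rightarrow> real) \<Rightarrow> (real ^ 'n \<Rightarrow> real ^ 'n \<Rightarrow> real) \<Rightarrow>
    real \<Rightarrow> (real ^ 'n \<Rightarrow> ennreal) \<Rightarrow> real ^ 'n \<Rightarrow> ennreal" where
  "mean_value m \<iota> d \<rho> \<Gamma> r w x\<^sub>0 =
     (\<integral>\<^sup>+ y \<in> frontier (gauge_ball m \<iota> \<rho> x\<^sub>0 r). w y * ennreal (kernel m d \<Gamma> (m (\<iota> x\<^sub>0) y))
        \<partial>hausdorff_measure (CARD('n) - 1))"

definition J ::
  "(real ^ 'n \<Rightarrow> real ^ 'n \<Rightarrow> real ^ 'n) \<Rightarrow> (real ^ 'n \<Rightarrow> real ^ 'n) \<Rightarrow> ('n \<Rightarrow> nat) \<Rightarrow>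
    (real ^ 'n \<Rightarrow> real) \<Rightarrow> (real ^ 'n \<Rightarrow> real ^ 'n \<Rightarrow> real) \<Rightarrow> (real ^ 'n) set \<Rightarrow>
    (real ^ 'n \<Rightarrow> real) \<Rightarrow> real ^ 'n \<Rightarrow> real \<Rightarrow> ennreal" where
  "J m \<iota> d \<rho> \<Gamma> \<Omega> u x\<^sub>0 r =
     ennreal (1 / r ^ 4) *
     (\<integral>\<^sup>+ \<xi> \<in> gauge_ball m \<iota> \<rho> x\<^sub>0 r.
        ennreal ((norm (weak_hgrad m d \<Omega> (\<lambda>x. max (u x) 0) \<xi>))\<^sup>2 * \<Gamma> x\<^sub>0 \<xi>) \<partial>lebesgue) *
     (\<integral>\<^sup>+ \<xi> \<in> gauge_ball m \<iota> \<rho> x\<^sub>0 r.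
        ennreal ((norm (weak_hgrad m d \<Omega> (\<lambda>x. max (- u x) 0) \<xi>))\<^sup>2 * \<Gamma> x\<^sub>0 \<xi>) \<partial>lebesgue)"

definition mono_ae_near_0 :: "(real \<Rightarrow> ennreal) \<Rightarrow> bool" where
  "mono_ae_near_0 F \<longleftrightarrow>
     (\<exists>\<delta>>0. \<exists>N \<in> null_sets lebesgue. mono_on ({0<..<\<delta>} - N) F)"

end

theory Submission
  imports Defs
begin

text \<open>Let \<open>I v r\<close> denote the integral of \<open>|\<nabla>v|\<^sup>2
\<Gamma>\<close> over the gauge ball of radius \<open>r\<close> about \<open>x\<^sub>0\<close>,
where \<open>\<nabla>v\<close> is the horizontal gradient of \<open>v\<close>, and let \<open>M v
s\<close> be the corresponding mean value over the sphere \<open>\<rho> = s\<close>. After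
translating the ball to the unit, the coarea formula for \<open>\<rho>\<close> disintegrates
\<open>I v r\<close> over the spheres. Since \<open>\<Gamma> = c \<rho>\<^bsup>2-Q\<^esup>\<close>,
the kernel of the mean values on \<open>\<rho> = s\<close> is \<open>c (Q - 2)
s\<^bsup>1-Q\<^esup>\<close> times the squared norm of the horizontal gradient of
\<open>\<rho>\<close> divided by the norm of its Euclidean gradient. The horizontal factor cancels
against the denominator of the averaged function, which leaves, with a constant \<open>C\<close>,
\<open>I v r = C \<integral>\<^sub>0\<^sup>r s M v s ds\<close>, hence \<open>I v r / r\<^sup>2 = C
\<integral>\<^sub>0\<^sup>1 t M v (r t) dt\<close>. If \<open>M v\<close> is nondecreasing almost
everywhere, so is the last integrand for almost every \<open>t\<close>, and therefore \<open>I v r /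
r\<^sup>2\<close> is nondecreasing. The functional \<open>J\<close> is the product of two such
quotients, for the positive and the negative part of \<open>u\<close>. See
\<open>energy_eq_integral_of_mean_values\<close> and \<open>weighted_average_mono\<close>.

Two facts carry the disintegration. The first is the coarea formula (\<open>coarea\<close>) for
functions of class \<open>C\<^sup>1\<close> without critical points and the Hausdorff measure of
dimension \<open>N - 1\<close>. It is proved with an unevaluated constant factor in \<open>(0,
\<infinity>)\<close>; monotonicity is invariant under positive multiples. Hausdorff measures on
coordinate planes are positive multiples of Lebesgue measure by translation invariance, which gives
the formula for hyperplanes. Near a given point a chart with bi-Lipschitz constant arbitrarily close
to \<open>1\<close> maps the level sets to parallel hyperplanes, Hausdorff measures distort by at
most a power of this constant, and the general case follows by summing over countably many small
pieces and letting the constant tend to \<open>1\<close>.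

The second fact is that the horizontal gradient of \<open>\<rho>\<close> vanishes only on a null set
(\<open>hgrad_homogeneous_norm_nonzero_AE\<close>), so that the cancellation above is legitimate. A
\<open>C\<^sup>1\<close> function has zero gradient at almost every one of its zeros, again by the
coarea formula. Applied to the horizontal derivatives of \<open>\<rho>\<close>, this shows that the
derivatives of \<open>\<rho>\<close> along commutators of horizontal fields vanish almost everywhere
on the set in question. By stratification iterated commutators span all directions, whereas the
Euclidean gradient of a homogeneous norm has no zero outside the origin.\<close>

section \<open>Hausdorff measures\<close>

definition cover_weight :: "nat \<Rightarrow> 'a::metric_space set \<Rightarrow> ennreal" where
  "cover_weight k V =
     (if V = {} then 0 else ennreal (unit_ball_vol (real k) * (diameter V / 2) ^ k))"

text \<open>The covers admitted in \<open>hausdorff_pre\<close>, whose infimum runs over the sums of the \<open>cover_weight\<close>s.\<close>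

definition fine_cover :: "real \<Rightarrow> 'a::metric_space set \<Rightarrow> (nat \<Rightarrow> 'a set) \<Rightarrow> bool" where
  "fine_cover \<delta> A U \<longleftrightarrow> A \<subseteq> (\<Union>i. U i) \<and> (\<forall>i. bounded (U i) \<and> diameter (U i) \<le> \<delta>)"

lemma hausdorff_pre_alt:
  "hausdorff_pre k \<delta> A = (INF U \<in> Collect (fine_cover \<delta> A). \<Sum>i. cover_weight k (U i))"
  by (simp add: hausdorff_pre_def cover_weight_def fine_cover_def[abs_def])

lemma hausdorff_pre_le: "fine_cover \<delta> A U \<Longrightarrow> hausdorff_pre k \<delta> A \<le> (\<Sum>i. cover_weight k (U i))"
  unfolding hausdorff_pre_alt by (rule INF_lower) simp

lemma hausdorff_pre_greatest:
  "(\<And>U. fine_cover \<delta> A U \<Longrightarrow> b \<le> (\<Sum>i. cover_weight k (U i))) \<Longrightarrow> b \<le> hausdorff_pre k \<delta> A"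
  unfolding hausdorff_pre_alt by (rule INF_greatest) simp

lemma hausdorff_pre_close:
  "hausdorff_pre k \<delta> A < b \<Longrightarrow> \<exists>U. fine_cover \<delta> A U \<and> (\<Sum>i. cover_weight k (U i)) < b"
  unfolding hausdorff_pre_alt INF_less_iff by auto

lemma hausdorff_pre_mono: "A \<subseteq> B \<Longrightarrow> hausdorff_pre k \<delta> A \<le> hausdorff_pre k \<delta> B"
  by (intro hausdorff_pre_greatest hausdorff_pre_le) (auto simp: fine_cover_def)

lemma hausdorff_pre_antimono: "\<delta> \<le> \<delta>' \<Longrightarrow> hausdorff_pre k \<delta>' A \<le> hausdorff_pre k \<delta> A"
  by (intro hausdorff_pre_greatest hausdorff_pre_le) (auto simp: fine_cover_def intro: order_trans)

lemma hausdorff_pre_empty: "0 \<le> \<delta> \<Longrightarrow> hausdorff_pre k \<delta> {} = 0"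
  using hausdorff_pre_le[of \<delta> "{}" "\<lambda>i. {}" k] by (simp add: fine_cover_def cover_weight_def)

lemma hausdorff_pre_single:
  "bounded V \<Longrightarrow> diameter V \<le> \<delta> \<Longrightarrow> 0 \<le> \<delta> \<Longrightarrow> hausdorff_pre k \<delta> V \<le> cover_weight k V"
proof -
  assume V: "bounded V" "diameter V \<le> \<delta>" "0 \<le> \<delta>"
  define U where "U = (\<lambda>i::nat. if i = 0 then V else {})"
  have "fine_cover \<delta> V U" using V by (auto simp: fine_cover_def U_def)
  then have "hausdorff_pre k \<delta> V \<le> (\<Sum>i. cover_weight k (U i))" by (rule hausdorff_pre_le)
  also have "\<dots> = (\<Sum>i\<in>{0}. cover_weight k (U i))"
    by (rule suminf_finite) (auto simp: U_def cover_weight_def)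
  finally show ?thesis by (simp add: U_def)
qed

lemma hausdorff_pre_UN: "hausdorff_pre k \<delta> (\<Union>i::nat. A i) \<le> (\<Sum>i. hausdorff_pre k \<delta> (A i))"
proof (rule ennreal_le_epsilon)
  fix e :: real assume e: "0 < e" and fin: "(\<Sum>n. hausdorff_pre k \<delta> (A n)) < top"
  have "\<And>n. hausdorff_pre k \<delta> (A n) < hausdorff_pre k \<delta> (A n) + e * (1/2)^Suc n"
    using fin e by (auto simp add: less_top dest!: ennreal_suminf_lessD)
  from hausdorff_pre_close[OF this] obtain B
    where B: "\<And>n. fine_cover \<delta> (A n) (B n)"
      and B_less: "\<And>n. (\<Sum>i. cover_weight k (B n i)) < hausdorff_pre k \<delta> (A n) + e * (1/2)^Suc n"
    by metis
  define C where "C = case_prod B o prod_decode"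
  have "fine_cover \<delta> (\<Union>i. A i) C"
    unfolding fine_cover_def
  proof (intro conjI allI)
    show "(\<Union>i. A i) \<subseteq> (\<Union>i. C i)"
    proof
      fix x assume "x \<in> (\<Union>i. A i)"
      then obtain n i where "x \<in> B n i" using B by (fastforce simp: fine_cover_def)
      then have "x \<in> C (prod_encode (n, i))" by (simp add: C_def)
      then show "x \<in> (\<Union>i. C i)" by blast
    qed
  qed (use B in \<open>auto simp: C_def fine_cover_def split_def\<close>)
  then have "hausdorff_pre k \<delta> (\<Union>i. A i) \<le> (\<Sum>i. cover_weight k (C i))"
    by (rule hausdorff_pre_le)
  also have "\<dots> = (\<Sum>i. (\<lambda>p. cover_weight k (B (fst p) (snd p))) (prod_decode i))"
    by (simp add: C_def split_def)
  also have "\<dots> = (\<Sum>n. \<Sum>i. cover_weight k (B n i))"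
    by (rule suminf_ennreal_2dimen) simp
  also have "\<dots> \<le> (\<Sum>n. hausdorff_pre k \<delta> (A n) + e * (1/2) ^ Suc n)"
    by (intro suminf_le allI less_imp_le B_less) auto
  also have "\<dots> = (\<Sum>n. hausdorff_pre k \<delta> (A n)) + (\<Sum>n. ennreal e * ennreal ((1/2) ^ Suc n))"
    using e by (subst suminf_add[symmetric])
      (auto simp del: ennreal_suminf_cmult simp add: ennreal_mult[symmetric])
  also have "\<dots> = (\<Sum>n. hausdorff_pre k \<delta> (A n)) + e"
    unfolding ennreal_suminf_cmult
    by (subst suminf_ennreal_eq[OF zero_le_power power_half_series]) auto
  finally show "hausdorff_pre k \<delta> (\<Union>i. A i) \<le> (\<Sum>n. hausdorff_pre k \<delta> (A n)) + e" .
qed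

lemma hausdorff_pre_Un:
  assumes "0 \<le> \<delta>"
  shows "hausdorff_pre k \<delta> (A \<union> B) \<le> hausdorff_pre k \<delta> A + hausdorff_pre k \<delta> B"
proof -
  define C where "C = (\<lambda>i::nat. if i = 0 then A else if i = 1 then B else {})"
  have "(\<Union>i. C i) = A \<union> B"
    by (auto simp: C_def split: if_splits intro: exI[of _ "0::nat"] exI[of _ "Suc 0"])
  moreover have "(\<Sum>i. hausdorff_pre k \<delta> (C i)) = (\<Sum>i\<in>{0,1}. hausdorff_pre k \<delta> (C i))"
    by (rule suminf_finite) (auto simp: C_def hausdorff_pre_empty assms)
  ultimately show ?thesis
    using hausdorff_pre_UN[of k \<delta> C] by (simp add: C_def)
qed

lemma hausdorff_pre_finite_UN:
  assumes "0 \<le> \<delta>" "finite I" "\<And>i. i \<in> I \<Longrightarrow> bounded (V i) \<and> diameter (V i) \<le> \<delta>"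
  shows "hausdorff_pre k \<delta> (\<Union>i\<in>I. V i) \<le> (\<Sum>i\<in>I. cover_weight k (V i))"
  using assms(2,3)
proof (induction I)
  case (insert i I)
  have "hausdorff_pre k \<delta> (V i \<union> (\<Union>i\<in>I. V i)) \<le> hausdorff_pre k \<delta> (V i) + hausdorff_pre k \<delta> (\<Union>i\<in>I. V i)"
    by (rule hausdorff_pre_Un[OF assms(1)])
  also have "\<dots> \<le> cover_weight k (V i) + (\<Sum>i\<in>I. cover_weight k (V i))"
    using insert assms(1) by (intro add_mono hausdorff_pre_single insert.IH) auto
  finally show ?case using insert by simp
qed (simp add: hausdorff_pre_empty assms(1))

lemma hausdorff_pre_le_outer: "0 < \<delta> \<Longrightarrow> hausdorff_pre k \<delta> A \<le> hausdorff_outer k A"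
  unfolding hausdorff_outer_def by (rule SUP_upper) simp

lemma hausdorff_outer_least:
  "(\<And>\<delta>. 0 < \<delta> \<Longrightarrow> hausdorff_pre k \<delta> A \<le> b) \<Longrightarrow> hausdorff_outer k A \<le> b"
  unfolding hausdorff_outer_def by (rule SUP_least) simp

lemma hausdorff_outer_empty [simp]: "hausdorff_outer k {} = 0"
  using hausdorff_outer_least[of k "{}" 0] by (simp add: hausdorff_pre_empty)

lemma hausdorff_outer_mono: "A \<subseteq> B \<Longrightarrow> hausdorff_outer k A \<le> hausdorff_outer k B"
  by (intro hausdorff_outer_least order_trans[OF hausdorff_pre_mono hausdorff_pre_le_outer])

lemma hausdorff_outer_UN: "hausdorff_outer k (\<Union>i::nat. A i) \<le> (\<Sum>i. hausdorff_outer k (A i))"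
  by (intro hausdorff_outer_least order_trans[OF hausdorff_pre_UN] suminf_le hausdorff_pre_le_outer)
    auto

lemma hausdorff_outer_Un: "hausdorff_outer k (A \<union> B) \<le> hausdorff_outer k A + hausdorff_outer k B"
  by (intro hausdorff_outer_least order_trans[OF hausdorff_pre_Un] add_mono hausdorff_pre_le_outer)
    auto

text \<open>A set of small diameter cannot meet both of two sets at positive distance, so an efficient
  cover of the union splits into covers of the two sets.\<close>

lemma hausdorff_outer_separated:
  assumes "0 < e" and sep: "\<And>x y. x \<in> A \<Longrightarrow> y \<in> B \<Longrightarrow> e \<le> dist x y"
  shows "hausdorff_outer k (A \<union> B) = hausdorff_outer k A + hausdorff_outer k B"
proof (rule antisym[OF hausdorff_outer_Un])
  have pre: "hausdorff_pre k \<delta> A + hausdorff_pre k \<delta> B \<le> hausdorff_pre k \<delta> (A \<union> B)"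
    if \<delta>: "0 < \<delta>" "\<delta> < e" for \<delta>
  proof (rule hausdorff_pre_greatest)
    fix U assume U: "fine_cover \<delta> (A \<union> B) U"
    define UA where "UA = (\<lambda>i. if U i \<inter> A = {} then {} else U i)"
    define UB where "UB = (\<lambda>i. if U i \<inter> B = {} then {} else U i)"
    have "fine_cover \<delta> A UA" "fine_cover \<delta> B UB"
      using U \<delta> by (auto simp: fine_cover_def UA_def UB_def subset_iff) blast+
    then have "hausdorff_pre k \<delta> A + hausdorff_pre k \<delta> B \<le>
        (\<Sum>i. cover_weight k (UA i)) + (\<Sum>i. cover_weight k (UB i))"
      by (intro add_mono hausdorff_pre_le)
    also have "\<dots> = (\<Sum>i. cover_weight k (UA i) + cover_weight k (UB i))"
      by (rule suminf_add) auto
    also have "\<dots> \<le> (\<Sum>i. cover_weight k (U i))"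
    proof (intro suminf_le allI)
      fix i
      have "U i \<inter> A = {} \<or> U i \<inter> B = {}"
      proof (rule ccontr)
        assume "\<not> ?thesis"
        then obtain x y where xy: "x \<in> U i" "x \<in> A" "y \<in> U i" "y \<in> B" by blast
        then have "dist x y \<le> diameter (U i)"
          using U by (intro diameter_bounded_bound) (auto simp: fine_cover_def)
        also have "\<dots> \<le> \<delta>" using U by (auto simp: fine_cover_def)
        finally show False using sep[OF xy(2,4)] \<delta> by simp
      qed
      then show "cover_weight k (UA i) + cover_weight k (UB i) \<le> cover_weight k (U i)"
        by (auto simp: UA_def UB_def cover_weight_def)
    qed auto
    finally show "hausdorff_pre k \<delta> A + hausdorff_pre k \<delta> B \<le> (\<Sum>i. cover_weight k (U i))" .
  qed
  have *: "hausdorff_pre k \<delta>1 A + hausdorff_pre k \<delta>2 B \<le> hausdorff_outer k (A \<union> B)"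
    if "0 < \<delta>1" "0 < \<delta>2" for \<delta>1 \<delta>2
  proof -
    define \<delta> where "\<delta> = min (min \<delta>1 \<delta>2) (e / 2)"
    have \<delta>: "0 < \<delta>" "\<delta> < e" "\<delta> \<le> \<delta>1" "\<delta> \<le> \<delta>2" using that assms(1) by (auto simp: \<delta>_def)
    have "hausdorff_pre k \<delta>1 A + hausdorff_pre k \<delta>2 B \<le> hausdorff_pre k \<delta> A + hausdorff_pre k \<delta> B"
      using \<delta> by (intro add_mono hausdorff_pre_antimono)
    also have "\<dots> \<le> hausdorff_outer k (A \<union> B)"
      using pre[OF \<delta>(1,2)] hausdorff_pre_le_outer[OF \<delta>(1)] by (rule order_trans)
    finally show ?thesis .
  qed
  have "hausdorff_outer k A + hausdorff_outer k B =
      (SUP \<delta>1\<in>{0<..}. SUP \<delta>2\<in>{0<..}. hausdorff_pre k \<delta>1 A + hausdorff_pre k \<delta>2 B)"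
    unfolding hausdorff_outer_def
    by (subst ennreal_SUP_add_right[symmetric], simp,
        subst ennreal_SUP_add_left[symmetric]) (auto intro!: SUP_cong)
  also have "\<dots> \<le> hausdorff_outer k (A \<union> B)" by (intro SUP_least *) auto
  finally show "hausdorff_outer k A + hausdorff_outer k B \<le> hausdorff_outer k (A \<union> B)" .
qed

text \<open>Caratheodory's criterion. The part of \<open>T\<close> at distance at least \<open>1 / Suc n\<close> from \<open>F\<close> is
  separated from \<open>T \<inter> F\<close>. The remaining shells around \<open>F\<close> are pairwise separated within each parity
  class, so their measures have a convergent sum and the tail is negligible.\<close>

lemma hausdorff_outer_closed_split:
  fixes F :: "'a::metric_space set"
  assumes F: "closed F"
  shows "hausdorff_outer k (T \<inter> F) + hausdorff_outer k (T - F) \<le> hausdorff_outer k T"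
proof (cases "F = {} \<or> hausdorff_outer k T = \<infinity>")
  case False
  then have ne: "F \<noteq> {}" and fin: "hausdorff_outer k T < \<infinity>" by (auto simp: top.not_eq_extremum)
  define f where "f x = infdist x F" for x
  define T' where "T' n = {x \<in> T. 1 / real (Suc n) \<le> f x}" for n
  define R where "R n = {x \<in> T. 1 / real (Suc (Suc n)) \<le> f x \<and> f x < 1 / real (Suc n)}" for n
  have lip: "f x - f y \<le> dist x y" for x y
    using infdist_triangle[of x F y] by (simp add: f_def)
  have pos: "0 < f x" if "x \<notin> F" for x
    using that F ne infdist_nonneg[of x F] by (auto simp: f_def less_le in_closed_iff_infdist_zero)
  have parity: "(\<Sum>i<n. hausdorff_outer k (R (2 * i + p))) \<le> hausdorff_outer k T" for p n
  proof -
    have "(\<Sum>i<n. hausdorff_outer k (R (2 * i + p))) \<le> hausdorff_outer k (\<Union>i<n. R (2 * i + p))"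
    proof (induction n)
      case (Suc n)
      \<comment> \<open>Points of \<open>R i\<close> and \<open>R l\<close> with \<open>i + 2 \<le> l\<close> differ in their distance to \<open>F\<close> by at least \<open>1 / l - 1 / (l + 1)\<close>; the union over \<open>i < n\<close> is empty for \<open>n = 0\<close>.\<close>
      define e where "e = (if n = 0 then 1 else 1 / real (2 * n + p) - 1 / real (Suc (2 * n + p)))"
      have "1 / real (Suc (2 * n + p)) < 1 / real (2 * n + p)" if "n \<noteq> 0"
        using that by (intro divide_strict_left_mono mult_pos_pos) auto
      then have "0 < e" by (simp add: e_def)
      then have "hausdorff_outer k ((\<Union>i<n. R (2 * i + p)) \<union> R (2 * n + p)) =
          hausdorff_outer k (\<Union>i<n. R (2 * i + p)) + hausdorff_outer k (R (2 * n + p))"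
      proof (rule hausdorff_outer_separated)
        fix x y assume x: "x \<in> (\<Union>i<n. R (2 * i + p))" and y: "y \<in> R (2 * n + p)"
        then obtain i where i: "i < n" "x \<in> R (2 * i + p)" by blast
        have "1 / real (2 * n + p) \<le> 1 / real (Suc (Suc (2 * i + p)))"
          using i by (intro divide_left_mono) auto
        also have "\<dots> \<le> f x" using i by (simp add: R_def)
        finally show "e \<le> dist x y"
          using y lip[of x y] i by (auto simp: R_def e_def)
      qed
      moreover have "(\<Union>i<Suc n. R (2 * i + p)) = (\<Union>i<n. R (2 * i + p)) \<union> R (2 * n + p)"
        by (auto simp: less_Suc_eq)
      ultimately show ?case using Suc by (simp add: add_mono)
    qed simp
    also have "\<dots> \<le> hausdorff_outer k T" by (rule hausdorff_outer_mono) (auto simp: R_def)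
    finally show ?thesis .
  qed
  have partial: "(\<Sum>i<n. hausdorff_outer k (R i)) \<le> 2 * hausdorff_outer k T" for n
  proof -
    have "(\<Sum>i<n. hausdorff_outer k (R i)) \<le> (\<Sum>i<2 * n. hausdorff_outer k (R i))"
      by (rule sum_mono2) auto
    also have "\<dots> = (\<Sum>i<n. hausdorff_outer k (R (2 * i + 0))) + (\<Sum>i<n. hausdorff_outer k (R (2 * i + 1)))"
      by (induction n) (auto simp: algebra_simps)
    also have "\<dots> \<le> hausdorff_outer k T + hausdorff_outer k T" by (intro add_mono parity)
    finally show ?thesis by (simp add: mult_2)
  qed
  define a where "a i = enn2real (hausdorff_outer k (R i))" for i
  have R_fin: "hausdorff_outer k (R i) < \<infinity>" for i
    using hausdorff_outer_mono[of "R i" T k] fin by (auto simp: R_def intro: le_less_trans)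
  have a: "hausdorff_outer k (R i) = ennreal (a i)" for i
    using R_fin[of i] by (simp add: a_def)
  have a_nonneg: "0 \<le> a i" for i by (simp add: a_def)
  have "summable a"
  proof (rule summableI_nonneg_bounded[where x="enn2real (2 * hausdorff_outer k T)"])
    fix n
    have "ennreal (sum a {..<n}) \<le> 2 * hausdorff_outer k T"
      using partial[of n] by (simp add: a a_nonneg sum_ennreal)
    also have "\<dots> = ennreal (enn2real (2 * hausdorff_outer k T))"
      using fin by (simp add: ennreal_mult_less_top)
    finally show "sum a {..<n} \<le> enn2real (2 * hausdorff_outer k T)" by (simp add: ennreal_le_iff)
  qed (rule a_nonneg)
  show ?thesis
  proof (rule ennreal_le_epsilon)
    fix e :: real assume "0 < e"
    from suminf_exist_split[OF this \<open>summable a\<close>] obtain n where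
      n: "norm (\<Sum>i. a (i + n)) < e" by blast
    have sub: "T - F \<subseteq> T' n \<union> (\<Union>i. R (i + n))"
    proof
      fix x assume x: "x \<in> T - F"
      then have fx: "0 < f x" by (simp add: pos)
      show "x \<in> T' n \<union> (\<Union>i. R (i + n))"
      proof (cases "1 / real (Suc n) \<le> f x")
        case far: False
        define j where "j = (LEAST j. 1 / real (Suc j) \<le> f x)"
        obtain i where i: "1 / real (Suc i) \<le> f x"
          using reals_Archimedean[OF fx] by (auto simp: inverse_eq_divide intro: less_imp_le)
        have j: "1 / real (Suc j) \<le> f x" unfolding j_def using i by (rule LeastI)
        have "n < j"
        proof (rule ccontr)
          assume "\<not> n < j"
          then have "1 / real (Suc n) \<le> 1 / real (Suc j)" by (intro divide_left_mono) auto
          with j far show False by simp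
        qed
        then obtain i' where i': "j = Suc i'" "n \<le> i'" by (cases j) auto
        have "\<not> 1 / real (Suc i') \<le> f x" 
          using i'(1) by (intro not_less_Least[where P="\<lambda>j. 1 / real (Suc j) \<le> f x"]) (simp only: j_def[symmetric] lessI)
        then have "x \<in> R (i' - n + n)" using j i' x by (simp add: R_def)
        then show ?thesis by blast
      qed (use x in \<open>auto simp: T'_def\<close>)
    qed
    have "hausdorff_outer k (T - F) \<le> hausdorff_outer k (T' n) + (\<Sum>i. hausdorff_outer k (R (i + n)))"
      by (rule order_trans[OF hausdorff_outer_mono[OF sub]
            order_trans[OF hausdorff_outer_Un add_left_mono[OF hausdorff_outer_UN]]])
    also have "(\<Sum>i. hausdorff_outer k (R (i + n))) = ennreal (\<Sum>i. a (i + n))"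
      unfolding a by (rule suminf_ennreal2) (use \<open>summable a\<close> a_nonneg in \<open>auto simp: summable_iff_shift\<close>)
    also have "\<dots> \<le> ennreal e" using n by (intro ennreal_leI) auto
    finally have tail: "hausdorff_outer k (T - F) \<le> hausdorff_outer k (T' n) + ennreal e"
      by (simp add: add_left_mono)
    have "hausdorff_outer k (T \<inter> F) + hausdorff_outer k (T' n) = hausdorff_outer k ((T \<inter> F) \<union> T' n)"
    proof (rule hausdorff_outer_separated[symmetric, of "1 / real (Suc n)"])
      fix x y assume "x \<in> T \<inter> F" "y \<in> T' n"
      then show "1 / real (Suc n) \<le> dist x y"
        using infdist_le[of x F y] by (auto simp: T'_def f_def dist_commute)
    qed simp
    also have "\<dots> \<le> hausdorff_outer k T" by (rule hausdorff_outer_mono) (auto simp: T'_def)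
    finally have near: "hausdorff_outer k (T \<inter> F) + hausdorff_outer k (T' n) \<le> hausdorff_outer k T" .
    have "hausdorff_outer k (T \<inter> F) + hausdorff_outer k (T - F) \<le>
        (hausdorff_outer k (T \<inter> F) + hausdorff_outer k (T' n)) + ennreal e"
      unfolding add.assoc by (rule add_left_mono[OF tail])
    also have "\<dots> \<le> hausdorff_outer k T + ennreal e" by (rule add_right_mono[OF near])
    finally show "hausdorff_outer k (T \<inter> F) + hausdorff_outer k (T - F) \<le> hausdorff_outer k T + ennreal e" .
  qed
qed auto

lemma sigma_algebra_borel: "sigma_algebra UNIV (sets borel)"
  by (metis sets.sigma_algebra_axioms space_borel)

lemma measure_space_hausdorff: "measure_space (UNIV :: 'a::metric_space set) (sets borel) (hausdorff_outer k)"
proof -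
  let ?L = "lambda_system (UNIV :: 'a set) (Pow UNIV) (hausdorff_outer k)"
  have "outer_measure_space (Pow UNIV) (hausdorff_outer k :: 'a set \<Rightarrow> _)"
    by (auto simp: outer_measure_space_def positive_def increasing_def countably_subadditive_def
        hausdorff_outer_mono hausdorff_outer_UN)
  from sigma_algebra.caratheodory_lemma[OF sigma_algebra_Pow this]
  have ms: "measure_space UNIV ?L (hausdorff_outer k)" .
  then have L: "sigma_algebra UNIV ?L" by (simp add: measure_space_def)
  have "closed F \<Longrightarrow> F \<in> ?L" for F :: "'a set"
  proof -
    assume F: "closed F"
    have "hausdorff_outer k (T \<inter> F) + hausdorff_outer k (T - F) = hausdorff_outer k T" for T
      using hausdorff_outer_closed_split[OF F, of k T]
        hausdorff_outer_Un[of k "T \<inter> F" "T - F"] by (simp add: Int_Diff_Un)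
    then show "F \<in> ?L" by (subst algebra.lambda_system_eq[OF algebra_Pow]) auto
  qed
  then have "sigma_sets UNIV (Collect closed) \<subseteq> ?L"
    by (intro sigma_algebra.sigma_sets_subset[OF L]) auto
  then have "sets borel \<subseteq> ?L" by (simp add: borel_eq_closed)
  from measure_down[OF ms sigma_algebra_borel this] show ?thesis .
qed

lemma space_hausdorff_measure [simp]: "space (hausdorff_measure k) = UNIV"
  by (simp add: hausdorff_measure_def space_measure_of_conv)

lemma sets_hausdorff_measure [simp, measurable_cong]: "sets (hausdorff_measure k) = sets borel"
  unfolding hausdorff_measure_def by (rule sigma_algebra.sets_measure_of_eq[OF sigma_algebra_borel])

lemma emeasure_hausdorff_measure:
  fixes A :: "'a::metric_space set"
  assumes "A \<in> sets borel"
  shows "emeasure (hausdorff_measure k) A = hausdorff_outer k A"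
  unfolding hausdorff_measure_def
  by (rule emeasure_measure_of_sigma[OF sigma_algebra_borel _ _ assms])
    (use measure_space_hausdorff[where 'a='a, of k] in \<open>simp_all add: measure_space_def\<close>)

text \<open>Translation invariance and the effect of the charts that straighten level sets both come from this
bound. The images of a cover form a cover; intersecting its members with \<open>A\<close> first makes it enough
that \<open>f\<close> is Lipschitz on \<open>A\<close>.\<close>

lemma hausdorff_outer_lipschitz_image:
  fixes f :: "'a::metric_space \<Rightarrow> 'b::metric_space"
  assumes L: "0 < L" and lip: "\<And>x y. x \<in> A \<Longrightarrow> y \<in> A \<Longrightarrow> dist (f x) (f y) \<le> L * dist x y"
  shows "hausdorff_outer k (f ` A) \<le> ennreal (L ^ k) * hausdorff_outer k A"
proof (rule hausdorff_outer_least)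
  fix \<delta> :: real assume \<delta>: "0 < \<delta>"
  have "hausdorff_pre k \<delta> (f ` A) \<le> ennreal (L ^ k) * hausdorff_pre k (\<delta> / L) A"
  proof -
    have *: "hausdorff_pre k \<delta> (f ` A) \<le> ennreal (L ^ k) * (\<Sum>i. cover_weight k (U i))"
      if U: "fine_cover (\<delta> / L) A U" for U
    proof -
      have bd: "bounded (f ` (A \<inter> U i)) \<and> diameter (f ` (A \<inter> U i)) \<le> L * diameter (U i)" for i
      proof -
        have d: "dist x y \<le> L * diameter (U i)" if "x \<in> f ` (A \<inter> U i)" "y \<in> f ` (A \<inter> U i)" for x y
        proof -
          from that obtain x' y' where "x = f x'" "y = f y'" "x' \<in> A" "y' \<in> A" "x' \<in> U i" "y' \<in> U i" by blast
          then show ?thesis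
            using lip[of x' y'] diameter_bounded_bound[of "U i" x' y'] U L
            by (fastforce simp: fine_cover_def intro: order_trans mult_left_mono)
        qed
        then have "bounded (f ` (A \<inter> U i))" unfolding bounded_two_points by blast
        moreover have "diameter (f ` (A \<inter> U i)) \<le> L * diameter (U i)"
        proof (cases "f ` (A \<inter> U i) = {}")
          case True
          then show ?thesis using L U diameter_ge_0[of "U i"] by (simp add: fine_cover_def)
        next
          case False
          then have "diameter (f ` (A \<inter> U i)) =
              (SUP (x, y) \<in> f ` (A \<inter> U i) \<times> f ` (A \<inter> U i). dist x y)"
            by (simp add: diameter_def)
          also have "\<dots> \<le> L * diameter (U i)" using False d by (intro cSUP_least) auto
          finally show ?thesis .
        qed
        ultimately show ?thesis by simp
      qed
      have "fine_cover \<delta> (f ` A) (\<lambda>i. f ` (A \<inter> U i))"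
        unfolding fine_cover_def
      proof (intro conjI allI)
        fix i
        have "L * diameter (U i) \<le> \<delta>" using U L by (auto simp: fine_cover_def field_simps)
        then show "diameter (f ` (A \<inter> U i)) \<le> \<delta>" using bd[of i] by simp
        show "f ` A \<subseteq> (\<Union>i. f ` (A \<inter> U i))" using U unfolding fine_cover_def by blast
      qed (use bd in auto)
      then have "hausdorff_pre k \<delta> (f ` A) \<le> (\<Sum>i. cover_weight k (f ` (A \<inter> U i)))"
        by (rule hausdorff_pre_le)
      also have "\<dots> \<le> (\<Sum>i. ennreal (L ^ k) * cover_weight k (U i))"
      proof (intro suminf_le allI)
        fix i
        show "cover_weight k (f ` (A \<inter> U i)) \<le> ennreal (L ^ k) * cover_weight k (U i)"
        proof (cases "A \<inter> U i = {}")
          case False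
          have "0 \<le> diameter (f ` (A \<inter> U i))" using bd[of i] by (intro diameter_ge_0) simp
          then have "(diameter (f ` (A \<inter> U i)) / 2) ^ k \<le> (L * diameter (U i) / 2) ^ k"
            using bd[of i] by (intro power_mono) auto
          then have "unit_ball_vol (real k) * (diameter (f ` (A \<inter> U i)) / 2) ^ k
              \<le> unit_ball_vol (real k) * (L * diameter (U i) / 2) ^ k"
            by (intro mult_left_mono) auto
          also have "\<dots> = L ^ k * (unit_ball_vol (real k) * (diameter (U i) / 2) ^ k)"
            by (simp add: power_mult_distrib power_divide)
          finally show ?thesis using False L
            by (auto simp: cover_weight_def ennreal_mult'[symmetric] intro!: ennreal_leI)
        qed (simp add: cover_weight_def)
      qed auto
      finally show ?thesis by simp
    qed
    have inv: "ennreal (1 / L ^ k) * (ennreal (L ^ k) * x) = x"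
      "ennreal (L ^ k) * (ennreal (1 / L ^ k) * x) = x" for x
      using L by (simp_all add: mult.assoc[symmetric] ennreal_mult[symmetric])
    have "ennreal (1 / L ^ k) * hausdorff_pre k \<delta> (f ` A) \<le> hausdorff_pre k (\<delta> / L) A"
      using mult_left_mono[OF *, of _ "ennreal (1 / L ^ k)"] by (intro hausdorff_pre_greatest) (simp add: inv)
    from mult_left_mono[OF this, of "ennreal (L ^ k)"] show ?thesis by (simp add: inv)
  qed
  also have "\<dots> \<le> ennreal (L ^ k) * hausdorff_outer k A"
    using \<delta> L by (intro mult_left_mono hausdorff_pre_le_outer) auto
  finally show "hausdorff_pre k \<delta> (f ` A) \<le> ennreal (L ^ k) * hausdorff_outer k A" .
qed

lemma hausdorff_outer_isometry_image:
  assumes "\<And>x y. x \<in> A \<Longrightarrow> y \<in> A \<Longrightarrow> dist (f x) (f y) = dist x y"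
  shows "hausdorff_outer k (f ` A) = hausdorff_outer k A"
proof (rule antisym)
  show "hausdorff_outer k (f ` A) \<le> hausdorff_outer k A"
    using hausdorff_outer_lipschitz_image[of 1 A f k] assms by simp
  have inj: "inj_on f A" using assms by (metis dist_eq_0_iff inj_onI)
  have "dist (inv_into A f x) (inv_into A f y) \<le> 1 * dist x y" if "x \<in> f ` A" "y \<in> f ` A" for x y
    using assms[OF inv_into_into[OF that(1)] inv_into_into[OF that(2)]] that
    by (simp add: f_inv_into_f)
  then have "hausdorff_outer k (inv_into A f ` f ` A) \<le> ennreal (1 ^ k) * hausdorff_outer k (f ` A)"
    by (intro hausdorff_outer_lipschitz_image) auto
  then show "hausdorff_outer k A \<le> hausdorff_outer k (f ` A)"
    using inj by (simp add: inv_into_image_cancel)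
qed

section \<open>Hausdorff measure on coordinate planes\<close>

definition face :: "'n set \<Rightarrow> (real ^ 'n) set" where
  "face S = {z \<in> cbox 0 1. \<forall>i. i \<notin> S \<longrightarrow> z $ i = 0}"

lemma cover_weight_le:
  assumes "bounded V" "diameter V \<le> D"
  shows "cover_weight k V \<le> ennreal (unit_ball_vol (real k) * (D / 2) ^ k)"
proof (cases "V = {}")
  case False
  have "(diameter V / 2) ^ k \<le> (D / 2) ^ k"
    using diameter_ge_0[OF assms(1)] assms(2) by (intro power_mono) auto
  then show ?thesis
    by (simp add: cover_weight_def False) (intro ennreal_leI mult_left_mono, auto)
qed (simp add: cover_weight_def)

text \<open>The face of dimension \<open>k\<close> is covered by at most \<open>(n + 1)\<^sup>k\<close> cubes of side \<open>1 / n\<close>, each of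
weight at most a constant times \<open>n\<^bsup>-k\<^esup>\<close>.\<close>

lemma hausdorff_face_finite: "hausdorff_outer (card S) (face S :: (real ^ 'n) set) < \<infinity>"
proof -
  define N where "N = real CARD('n)"
  define k where "k = card S"
  have "hausdorff_outer k (face S) \<le> ennreal (unit_ball_vol (real k) * N ^ k)"
  proof (rule hausdorff_outer_least)
    fix \<delta> :: real assume \<delta>: "0 < \<delta>"
    obtain n :: nat where n: "N / \<delta> < real n" using reals_Archimedean2 by blast
    have N: "0 < N" by (simp add: N_def)
    then have n0: "0 < n" using n \<delta> by (metis divide_pos_pos of_nat_0_less_iff order.strict_trans)
    define V where "V f = {z \<in> face S. \<forall>i\<in>S. real (f i) / n \<le> z $ i \<and> z $ i \<le> (real (f i) + 1) / n}"
      for f :: "'n \<Rightarrow> nat"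
    define I where "I = PiE S (\<lambda>_. {..n})"
    have dist: "dist x y \<le> N / n" if "x \<in> V f" "y \<in> V f" for x y f
    proof -
      have "\<bar>(x - y) $ i\<bar> \<le> 1 / n" for i
      proof (cases "i \<in> S")
        case True
        then have "real (f i) / n \<le> x $ i" "x $ i \<le> real (f i) / n + 1 / n"
          "real (f i) / n \<le> y $ i" "y $ i \<le> real (f i) / n + 1 / n"
          using that by (auto simp: V_def add_divide_distrib)
        then show ?thesis unfolding vector_minus_component by linarith
      next
        case False
        then show ?thesis using that by (simp add: V_def face_def)
      qed
      then have "(\<Sum>i\<in>UNIV. \<bar>(x - y) $ i\<bar>) \<le> (\<Sum>i\<in>(UNIV::'n set). 1 / n)"
        by (intro sum_mono)
      then show ?thesis
        using norm_le_l1_cart[of "x - y"] by (simp add: dist_norm N_def)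
    qed
    have bd: "bounded (V f)" for f
      unfolding bounded_two_points using dist by blast
    have diam: "diameter (V f) \<le> N / n" for f
      by (rule diameter_le) (use dist N in \<open>auto simp: dist_norm\<close>)
    have "N / n \<le> \<delta>" using n n0 \<delta> by (simp add: field_simps)
    have cover: "face S \<subseteq> (\<Union>f\<in>I. V f)"
    proof
      fix z :: "real ^ 'n" assume z: "z \<in> face S"
      define f where "f = restrict (\<lambda>i. nat \<lfloor>n * z $ i\<rfloor>) S"
      have z01: "0 \<le> z $ i" "z $ i \<le> 1" for i using z by (auto simp: face_def mem_box_cart)
      have "f i \<le> n" if "i \<in> S" for i
      proof -
        have "real n * z $ i \<le> real n * 1" by (intro mult_left_mono z01) simp
        then have "\<lfloor>n * z $ i\<rfloor> \<le> int n" by linarith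
        then show ?thesis using that by (simp add: f_def)
      qed
      then have "f \<in> I" by (auto simp: I_def f_def)
      moreover have "real (f i) / n \<le> z $ i \<and> z $ i \<le> (real (f i) + 1) / n" if "i \<in> S" for i
      proof -
        have "real (f i) \<le> n * z $ i" "n * z $ i \<le> real (f i) + 1"
          using that z01(1)[of i] by (auto simp: f_def)
        then show ?thesis using n0 by (simp add: field_simps)
      qed
      ultimately show "z \<in> (\<Union>f\<in>I. V f)" using z by (auto simp: V_def)
    qed
    have "hausdorff_pre k \<delta> (face S) \<le> hausdorff_pre k \<delta> (\<Union>f\<in>I. V f)"
      by (rule hausdorff_pre_mono[OF cover])
    also have "\<dots> \<le> (\<Sum>f\<in>I. cover_weight k (V f))"
      using \<delta> bd diam \<open>N / n \<le> \<delta>\<close>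
      by (intro hausdorff_pre_finite_UN) (auto simp: I_def intro: finite_PiE order_trans)
    also have "\<dots> \<le> (\<Sum>f\<in>I. ennreal (unit_ball_vol (real k) * (N / n / 2) ^ k))"
      by (intro sum_mono cover_weight_le bd diam)
    also have "\<dots> = ennreal (real ((n + 1) ^ k) * (unit_ball_vol (real k) * (N / n / 2) ^ k))"
      using N by (simp add: I_def card_PiE k_def ennreal_mult ennreal_of_nat_eq_real_of_nat)
    also have "\<dots> \<le> ennreal (real ((2 * n) ^ k) * (unit_ball_vol (real k) * (N / n / 2) ^ k))"
      using n0 N by (intro ennreal_leI mult_right_mono of_nat_mono power_mono) auto
    also have "\<dots> = ennreal (unit_ball_vol (real k) * N ^ k)"
      using n0 by (simp add: power_divide power_mult_distrib)
    finally show "hausdorff_pre k \<delta> (face S) \<le> ennreal (unit_ball_vol (real k) * N ^ k)" .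
  qed
  also have "\<dots> < \<infinity>" by simp
  finally show ?thesis by (simp add: k_def)
qed

lemma emeasure_lborel_cbox_cart:
  fixes a b :: "real ^ 'n"
  assumes "\<And>i. a $ i \<le> b $ i"
  shows "emeasure lborel (cbox a b) = ennreal (\<Prod>i\<in>UNIV. b $ i - a $ i)"
proof -
  have "cbox a b \<noteq> {}" using assms by (auto simp: interval_eq_empty_cart not_less)
  then show ?thesis
    using content_cbox_cart[of a b] emeasure_eq_ennreal_measure[of lborel "cbox a b"]
    by (simp add: emeasure_lborel_cbox_eq)
qed

text \<open>A set of diameter \<open>D\<close> in the plane lies in a box with \<open>k\<close> sides of length \<open>2 D\<close> and, in the
remaining directions, sides of length \<open>1\<close>. The boxes belonging to a cover of the face cover the
unit cube, so the sum of \<open>(2 D)\<^sup>k\<close> is at least \<open>1\<close>.\<close>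

lemma hausdorff_face_pos: "0 < hausdorff_outer (card S) (face S :: (real ^ 'n) set)"
proof -
  define k where "k = card S"
  have vol: "0 < unit_ball_vol (real k)" by simp
  then have vol': "unit_ball_vol (real k) \<noteq> 0" by linarith
  have "ennreal (unit_ball_vol (real k) / 4 ^ k) \<le> hausdorff_pre k 1 (face S)"
  proof (rule hausdorff_pre_greatest)
    fix U :: "nat \<Rightarrow> (real ^ 'n) set" assume U: "fine_cover 1 (face S) U"
    define D where "D i = diameter (U i)" for i
    define p where "p i = (SOME x. x \<in> U i)" for i
    have D: "0 \<le> D i" for i using U by (auto simp: D_def fine_cover_def diameter_ge_0)
    define V :: "nat \<Rightarrow> (real ^ 'n) set" where "V i = (if U i = {} then {} else
      cbox (\<chi> j. if j \<in> S then p i $ j - D i else 0) (\<chi> j. if j \<in> S then p i $ j + D i else 1))" for i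
    have V: "emeasure lborel (V i) \<le> ennreal (4 ^ k / unit_ball_vol (real k)) * cover_weight k (U i)" for i
    proof (cases "U i = {}")
      case False
      have "emeasure lborel (V i) = ennreal (\<Prod>j\<in>(UNIV::'n set). if j \<in> S then 2 * D i else 1)"
        unfolding V_def if_not_P[OF False] using D[of i]
        by (subst emeasure_lborel_cbox_cart) (auto intro!: arg_cong[where f=ennreal] prod.cong)
      also have "(\<Prod>j\<in>(UNIV::'n set). if j \<in> S then 2 * D i else 1) = (2 * D i) ^ k"
        by (simp add: prod.If_cases k_def)
      also have "\<dots> = 4 ^ k / unit_ball_vol (real k) * (unit_ball_vol (real k) * (D i / 2) ^ k)"
      proof -
        have "(2 * D i) ^ k = (4 * (D i / 2)) ^ k" by simp
        also have "\<dots> = 4 ^ k * (D i / 2) ^ k" by (rule power_mult_distrib)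
        finally show ?thesis using vol' by simp
      qed
      also have "ennreal \<dots> = ennreal (4 ^ k / unit_ball_vol (real k)) * ennreal (unit_ball_vol (real k) * (D i / 2) ^ k)"
        using D[of i] by (intro ennreal_mult) auto
      finally show ?thesis using False by (simp only: cover_weight_def D_def if_False order_refl)
    qed (simp add: V_def)
    have "1 = emeasure lborel (cbox 0 (1 :: real ^ 'n))"
      by (subst emeasure_lborel_cbox_cart) auto
    also have "\<dots> \<le> emeasure lborel (\<Union>i. V i)"
    proof (rule emeasure_mono)
      show "cbox 0 1 \<subseteq> (\<Union>i. V i)"
      proof
        fix z :: "real ^ 'n" assume z: "z \<in> cbox 0 1"
        define z' :: "real ^ 'n" where "z' = (\<chi> j. if j \<in> S then z $ j else 0)"
        have "z' \<in> face S" using z by (auto simp: face_def z'_def mem_box_cart)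
        then obtain i where i: "z' \<in> U i" using U by (auto simp: fine_cover_def)
        then have "p i \<in> U i" by (auto simp: p_def intro: someI)
        then have "dist z' (p i) \<le> D i"
          unfolding D_def using U i by (intro diameter_bounded_bound) (auto simp: fine_cover_def)
        then have near: "\<bar>z $ j - p i $ j\<bar> \<le> D i" if "j \<in> S" for j
          using component_le_norm_cart[of "z' - p i" j] that by (simp add: dist_norm z'_def)
        have "p i $ j - D i \<le> z $ j" "z $ j \<le> p i $ j + D i" if "j \<in> S" for j
          using near[OF that] by linarith+
        moreover have "U i \<noteq> {}" using i by blast
        ultimately have "z \<in> V i" using z by (simp add: V_def mem_box_cart)
        then show "z \<in> (\<Union>i. V i)" by blast
      qed
    qed (auto simp: V_def)
    also have "\<dots> \<le> (\<Sum>i. emeasure lborel (V i))"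
      by (rule emeasure_subadditive_countably) (auto simp: V_def)
    also have "\<dots> \<le> (\<Sum>i. ennreal (4 ^ k / unit_ball_vol (real k)) * cover_weight k (U i))"
      by (intro suminf_le V) auto
    finally have "1 \<le> ennreal (4 ^ k / unit_ball_vol (real k)) * (\<Sum>i. cover_weight k (U i))" by simp
    from mult_left_mono[OF this, of "ennreal (unit_ball_vol (real k) / 4 ^ k)"] vol
    show "ennreal (unit_ball_vol (real k) / 4 ^ k) \<le> (\<Sum>i. cover_weight k (U i))"
      by (simp add: mult.assoc[symmetric] ennreal_mult[symmetric])
  qed
  also have "\<dots> \<le> hausdorff_outer k (face S)" by (rule hausdorff_pre_le_outer) simp
  finally have "ennreal (unit_ball_vol (real k) / 4 ^ k) \<le> hausdorff_outer k (face S)" .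
  moreover have "0 < ennreal (unit_ball_vol (real k) / 4 ^ k)" using vol by simp
  ultimately show ?thesis unfolding k_def by (rule less_le_trans[rotated])
qed

lemma vimage_plus_borel: "B \<in> sets borel \<Longrightarrow> (+) v -` B \<in> sets borel"
  for v :: "'a::{second_countable_topology, real_normed_vector}"
  using measurable_sets_borel[of "(+) v" borel B] by simp

lemma face_borel [measurable]: "face S \<in> sets borel"
proof -
  have "face S = cbox 0 1 \<inter> (\<Inter>i\<in>- S. {z. z $ i = 0})" by (auto simp: face_def)
  also have "closed \<dots>" by (intro closed_Int closed_INT ballI closed_Collect_eq closed_cbox continuous_intros)
  finally show ?thesis by (rule borel_closed)
qed

lemma nn_integral_translation:
  fixes \<mu> :: "(real ^ 'n) measure"
  assumes [measurable_cong]: "sets \<mu> = sets borel"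
    and inv: "\<And>A v. A \<in> sets borel \<Longrightarrow> emeasure \<mu> ((+) v -` A) = emeasure \<mu> A"
    and f[measurable]: "f \<in> borel_measurable borel"
  shows "(\<integral>\<^sup>+x. f (v + x) \<partial>\<mu>) = (\<integral>\<^sup>+x. f x \<partial>\<mu>)"
proof -
  have "space \<mu> = UNIV" using sets_eq_imp_space_eq[OF assms(1)] by simp
  then have eq: "distr \<mu> borel ((+) v) = \<mu>"
    by (intro measure_eqI) (auto simp: emeasure_distr assms(1) inv)
  have "(\<integral>\<^sup>+x. f x \<partial>distr \<mu> borel ((+) v)) = (\<integral>\<^sup>+x. f (v + x) \<partial>\<mu>)"
    by (rule nn_integral_distr) simp_all
  then show ?thesis by (simp add: eq)
qed

text \<open>Uniqueness of Haar measure: both sides arise by integrating \<open>1\<^sub>A(x + y) 1\<^sub>B(y)\<close>, for the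
  unit cube \<open>B\<close>, against the product of \<open>\<mu>\<close> and Lebesgue measure, in the two possible orders.\<close>

lemma emeasure_translation_invariant:
  fixes \<mu> :: "(real ^ 'n) measure"
  assumes [measurable_cong]: "sets \<mu> = sets borel"
    and inv: "\<And>A v. A \<in> sets borel \<Longrightarrow> emeasure \<mu> ((+) v -` A) = emeasure \<mu> A"
    and fin: "emeasure \<mu> (cbox 0 1) < \<infinity>"
    and A[measurable]: "A \<in> sets borel"
  shows "emeasure \<mu> A = emeasure \<mu> (cbox 0 1) * emeasure lborel A"
proof -
  have space: "space \<mu> = UNIV" using sets_eq_imp_space_eq[OF assms(1)] by simp
  have cube: "emeasure \<mu> (cbox v (v + 1)) = emeasure \<mu> (cbox 0 1)" for v
  proof -
    have "(+) v -` cbox v (v + 1) = cbox 0 1" by (auto simp: mem_box_cart)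
    with inv[of "cbox v (v + 1)" v] show ?thesis by simp
  qed
  interpret \<mu>: sigma_finite_measure \<mu>
  proof
    define C :: "('n \<Rightarrow> int) \<Rightarrow> (real ^ 'n) set" where
      "C f = cbox (\<chi> i. real_of_int (f i)) ((\<chi> i. real_of_int (f i)) + 1)" for f
    have "x \<in> C (\<lambda>i. \<lfloor>x $ i\<rfloor>)" for x by (auto simp: mem_box_cart C_def)
    then have "\<Union> (range C) = UNIV" by blast
    then show "\<exists>A. countable A \<and> A \<subseteq> sets \<mu> \<and> \<Union> A = space \<mu> \<and> (\<forall>a\<in>A. emeasure \<mu> a \<noteq> \<infinity>)"
      using fin by (intro exI[of _ "range C"]) (auto simp: space cube assms(1) C_def)
  qed
  interpret pair_sigma_finite lborel \<mu> ..
  define B :: "(real ^ 'n) set" where "B = cbox 0 1"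
  have [measurable]: "B \<in> sets borel" by (simp add: B_def)
  have B1: "emeasure lborel B = 1" unfolding B_def by (subst emeasure_lborel_cbox_cart) auto
  have "emeasure \<mu> A = (\<integral>\<^sup>+y. emeasure \<mu> A * indicator B y \<partial>lborel)"
    by (simp add: nn_integral_cmult B1)
  also have "\<dots> = (\<integral>\<^sup>+y. (\<integral>\<^sup>+x. indicator A x \<partial>\<mu>) * indicator B y \<partial>lborel)"
    by (simp add: assms(1))
  also have "\<dots> = (\<integral>\<^sup>+y. (\<integral>\<^sup>+x. indicator A (y + x) \<partial>\<mu>) * indicator B y \<partial>lborel)"
    by (simp add: nn_integral_translation[OF assms(1) inv])
  also have "\<dots> = (\<integral>\<^sup>+y. (\<integral>\<^sup>+x. indicator A (y + x) * indicator B y \<partial>\<mu>) \<partial>lborel)"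
    by (intro nn_integral_cong nn_integral_multc[symmetric]) simp
  also have "\<dots> = (\<integral>\<^sup>+x. (\<integral>\<^sup>+y. indicator A (y + x) * indicator B y \<partial>lborel) \<partial>\<mu>)"
    by (rule Fubini'[symmetric]) simp
  also have "\<dots> = (\<integral>\<^sup>+x. (\<integral>\<^sup>+y. indicator A y * indicator B (y - x) \<partial>lborel) \<partial>\<mu>)"
  proof (rule nn_integral_cong)
    fix x
    have "(\<integral>\<^sup>+y. indicator A y * indicator B (y - x) \<partial>lborel) =
        (\<integral>\<^sup>+y. indicator A y * indicator B (y - x) \<partial>distr lborel borel ((+) x) :: ennreal)"
      by (simp add: lborel_distr_plus)
    also have "\<dots> = (\<integral>\<^sup>+y. indicator A (x + y) * indicator B y \<partial>lborel)"
      by (subst nn_integral_distr) auto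
    finally show "(\<integral>\<^sup>+y. indicator A (y + x) * indicator B y \<partial>lborel) =
        (\<integral>\<^sup>+y. indicator A y * indicator B (y - x) \<partial>lborel :: ennreal)" by (simp add: add.commute)
  qed
  also have "\<dots> = (\<integral>\<^sup>+y. (\<integral>\<^sup>+x. indicator A y * indicator B (y - x) \<partial>\<mu>) \<partial>lborel)"
    by (rule Fubini') simp
  also have "\<dots> = (\<integral>\<^sup>+y. indicator A y * emeasure \<mu> B \<partial>lborel)"
  proof (rule nn_integral_cong)
    fix y :: "real ^ 'n"
    have "(\<integral>\<^sup>+x. indicator A y * indicator B (y - x) \<partial>\<mu>) =
        indicator A y * (\<integral>\<^sup>+x. indicator (cbox (y - 1) (y - 1 + 1)) x \<partial>\<mu>)"
      by (subst nn_integral_cmult[symmetric])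
        (auto intro!: nn_integral_cong simp: indicator_def B_def mem_box_cart algebra_simps)
    also have "\<dots> = indicator A y * emeasure \<mu> B"
      using cube[of "y - 1"] by (subst nn_integral_indicator) (auto simp: assms(1) B_def)
    finally show "(\<integral>\<^sup>+x. indicator A y * indicator B (y - x) \<partial>\<mu>) = indicator A y * emeasure \<mu> B" .
  qed
  also have "\<dots> = emeasure \<mu> B * emeasure lborel A" by (simp add: nn_integral_multc mult.commute)
  finally show ?thesis by (simp add: B_def)
qed

lemma hausdorff_outer_translation:
  fixes v :: "'a::real_normed_vector"
  shows "hausdorff_outer k ((+) v -` A) = hausdorff_outer k A"
proof -
  have "(+) v ` ((+) v -` A) = A" by (auto simp: image_iff intro: bexI[of _ "_ - v"])
  then show ?thesis
    using hausdorff_outer_isometry_image[of "(+) v -` A" "(+) v" k] by simp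
qed

lemma hausdorff_eq_lborel:
  fixes A :: "(real ^ 'n) set"
  assumes "A \<in> sets borel"
  shows "hausdorff_outer CARD('n) A = hausdorff_outer CARD('n) (face UNIV :: (real ^ 'n) set) * emeasure lborel A"
proof -
  have face: "face UNIV = (cbox 0 1 :: (real ^ 'n) set)" by (auto simp: face_def)
  have vimage: "(+) v -` B \<in> sets borel" if "B \<in> sets borel" for v and B :: "(real ^ 'n) set"
    using that by (rule vimage_plus_borel)
  show ?thesis
    using emeasure_translation_invariant[of "hausdorff_measure CARD('n)" A] assms
      hausdorff_face_finite[of "UNIV :: 'n set"]
    by (simp add: emeasure_hausdorff_measure hausdorff_outer_translation vimage face)
qed

text \<open>The constant of the coarea formula: it is finite and positive, and thus does not affect
monotonicity.\<close>

definition face_measure :: "'n::finite \<Rightarrow> ennreal" where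
  "face_measure j = hausdorff_outer (CARD('n) - 1) (face (- {j}) :: (real ^ 'n) set)"

lemma face_measure_pos: "0 < face_measure j" and face_measure_finite: "face_measure j < \<infinity>"
  using hausdorff_face_pos[of "- {j}"] hausdorff_face_finite[of "- {j}"]
  by (auto simp: face_measure_def card_Diff_singleton Compl_eq_Diff_UNIV)

text \<open>Slicing by the hyperplanes orthogonal to a coordinate axis gives a translation invariant
  measure, hence a multiple of Lebesgue measure.\<close>

lemma hausdorff_slices:
  fixes A :: "(real ^ 'n) set" and j :: 'n
  assumes A[measurable]: "A \<in> sets borel"
  shows "(\<lambda>t. hausdorff_outer (CARD('n) - 1) (A \<inter> {z. z $ j = t})) \<in> borel_measurable borel"
    and "(\<integral>\<^sup>+t. hausdorff_outer (CARD('n) - 1) (A \<inter> {z. z $ j = t}) \<partial>lborel) =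
      face_measure j * emeasure lborel A"
proof -
  define k where "k = CARD('n) - 1"
  define P where "P = {z :: real ^ 'n. z $ j = 0}"
  have [measurable]: "P \<in> sets borel" by (simp add: P_def)
  define \<nu> where "\<nu> = density (hausdorff_measure k) (indicator P)"
  have sets_\<nu>[measurable_cong, simp]: "sets \<nu> = sets borel" and space_\<nu>[simp]: "space \<nu> = UNIV"
    by (simp_all add: \<nu>_def)
  have \<nu>: "emeasure \<nu> B = hausdorff_outer k (B \<inter> P)" if [measurable]: "B \<in> sets borel" for B
    unfolding \<nu>_def
    by (subst emeasure_restricted) (auto simp: emeasure_hausdorff_measure Int_commute)
  interpret \<nu>: sigma_finite_measure \<nu>
  proof
    define C :: "('n \<Rightarrow> int) \<Rightarrow> (real ^ 'n) set" where
      "C f = (+) (- (\<chi> i. real_of_int (f i))) -` face (- {j})" for f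
    have C[measurable]: "C f \<in> sets borel" for f
      unfolding C_def by (intro vimage_plus_borel face_borel)
    have "x \<in> C (\<lambda>i. \<lfloor>x $ i\<rfloor>)" if "x \<in> P" for x
      using that by (auto simp: mem_box_cart face_def P_def C_def) linarith
    then have "\<Union> (insert (- P) (range C)) = UNIV" by blast
    moreover have "emeasure \<nu> (C f) < \<infinity>" for f
    proof -
      have "hausdorff_outer k (C f \<inter> P) \<le> hausdorff_outer k (C f)" by (rule hausdorff_outer_mono) simp
      also have "\<dots> = face_measure j" by (simp add: C_def hausdorff_outer_translation face_measure_def k_def)
      finally show ?thesis using face_measure_finite[of j] by (simp add: \<nu>)
    qed
    ultimately show "\<exists>A. countable A \<and> A \<subseteq> sets \<nu> \<and> \<Union> A = space \<nu> \<and> (\<forall>a\<in>A. emeasure \<nu> a \<noteq> \<infinity>)"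
      by (intro exI[of _ "insert (- P) (range C)"]) (auto simp: \<nu> less_top)
  qed
  define e :: "real ^ 'n" where "e = axis j 1"
  define T where "T p = fst p *\<^sub>R e + snd p" for p :: "real \<times> (real ^ 'n)"
  have [measurable]: "T \<in> borel_measurable (lborel \<Otimes>\<^sub>M \<nu>)" unfolding T_def[abs_def] by measurable
  define \<mu> where "\<mu> = distr (lborel \<Otimes>\<^sub>M \<nu>) borel T"
  have slice: "emeasure \<nu> {z. T (t, z) \<in> B} = hausdorff_outer k (B \<inter> {z. z $ j = t})"
    if [measurable]: "B \<in> sets borel" for B t
  proof -
    have "{z. T (t, z) \<in> B} \<inter> P = (+) (t *\<^sub>R e) -` (B \<inter> {z. z $ j = t})"
      by (auto simp: T_def P_def e_def)
    moreover have "{z. T (t, z) \<in> B} \<in> sets borel"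
      using vimage_plus_borel[OF that, of "t *\<^sub>R e"] by (simp add: T_def vimage_def)
    ultimately show ?thesis by (simp only: \<nu> hausdorff_outer_translation)
  qed
  have meas: "(\<lambda>t. hausdorff_outer k (B \<inter> {z. z $ j = t})) \<in> borel_measurable borel"
    and \<mu>: "emeasure \<mu> B = (\<integral>\<^sup>+t. hausdorff_outer k (B \<inter> {z. z $ j = t}) \<partial>lborel)"
    if B[measurable]: "B \<in> sets borel" for B
  proof -
    have TB[measurable]: "T -` B \<in> sets (lborel \<Otimes>\<^sub>M \<nu>)"
      using measurable_sets[of T "lborel \<Otimes>\<^sub>M \<nu>" borel B] by (simp add: space_pair_measure)
    have eq: "emeasure \<nu> (Pair t -` (T -` B)) = hausdorff_outer k (B \<inter> {z. z $ j = t})" for t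
      using slice[OF B, of t] by (simp add: vimage_def)
    show "(\<lambda>t. hausdorff_outer k (B \<inter> {z. z $ j = t})) \<in> borel_measurable borel"
      using \<nu>.measurable_emeasure_Pair[OF TB] by (simp add: eq)
    show "emeasure \<mu> B = (\<integral>\<^sup>+t. hausdorff_outer k (B \<inter> {z. z $ j = t}) \<partial>lborel)"
      unfolding \<mu>_def
      by (simp add: emeasure_distr space_pair_measure \<nu>.emeasure_pair_measure_alt[OF TB] eq)
  qed
  show "(\<lambda>t. hausdorff_outer (CARD('n) - 1) (A \<inter> {z. z $ j = t})) \<in> borel_measurable borel"
    using meas[OF A] by (simp add: k_def)
  have inv: "emeasure \<mu> ((+) v -` B) = emeasure \<mu> B" if B[measurable]: "B \<in> sets borel" for B v
  proof -
    have [measurable]: "(+) v -` B \<in> sets borel" using B by (rule vimage_plus_borel)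
    have "((+) v -` B) \<inter> {z. z $ j = t} = (+) v -` (B \<inter> {z. z $ j = v $ j + 1 * t})" for t by auto
    then have eq: "hausdorff_outer k (((+) v -` B) \<inter> {z. z $ j = t}) =
        hausdorff_outer k (B \<inter> {z. z $ j = v $ j + 1 * t})" for t
      by (simp only: hausdorff_outer_translation)
    have "emeasure \<mu> ((+) v -` B) = (\<integral>\<^sup>+t. hausdorff_outer k (B \<inter> {z. z $ j = v $ j + 1 * t}) \<partial>lborel)"
      by (simp only: \<mu>[OF vimage_plus_borel[OF B]] eq)
    also have "\<dots> = emeasure \<mu> B"
      using nn_integral_real_affine[OF meas[OF B], of 1 "v $ j"] by (simp add: \<mu>)
    finally show ?thesis .
  qed
  have "emeasure \<mu> (cbox 0 1) = (\<integral>\<^sup>+t. hausdorff_outer k (cbox 0 1 \<inter> {z :: real ^ 'n. z $ j = t}) \<partial>lborel)"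
    by (rule \<mu>) simp
  also have "\<dots> = (\<integral>\<^sup>+t. face_measure j * indicator {0..1::real} t \<partial>lborel)"
  proof (rule nn_integral_cong)
    fix t
    show "hausdorff_outer k (cbox 0 1 \<inter> {z :: real ^ 'n. z $ j = t}) = face_measure j * indicator {0..1} t"
    proof (cases "t \<in> {0..1}")
      case True
      have e: "e $ i = (if i = j then 1 else 0)" for i by (simp add: e_def axis_def)
      have "cbox 0 1 \<inter> {z :: real ^ 'n. z $ j = t} = (+) (- (t *\<^sub>R e)) -` face (- {j})"
      proof (rule set_eqI)
        fix z :: "real ^ 'n"
        have w: "(- (t *\<^sub>R e) + z) $ i = (if i = j then z $ j - t else z $ i)" for i
          by (simp add: e)
        have "z \<in> cbox 0 1 \<inter> {z. z $ j = t} \<longleftrightarrow> z $ j = t \<and> (\<forall>i. i \<noteq> j \<longrightarrow> 0 \<le> z $ i \<and> z $ i \<le> 1)"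
        proof (intro iffI)
          assume *: "z $ j = t \<and> (\<forall>i. i \<noteq> j \<longrightarrow> 0 \<le> z $ i \<and> z $ i \<le> 1)"
          then have "0 \<le> z $ i \<and> z $ i \<le> 1" for i using True by (cases "i = j") auto
          then show "z \<in> cbox 0 1 \<inter> {z. z $ j = t}" using * by (simp add: mem_box_cart)
        qed (simp add: mem_box_cart)
        also have "\<dots> \<longleftrightarrow> - (t *\<^sub>R e) + z \<in> face (- {j})"
          unfolding face_def mem_box_cart mem_Collect_eq w
        proof (intro iffI)
          assume *: "(\<forall>i. 0 $ i \<le> (if i = j then z $ j - t else z $ i) \<and>
            (if i = j then z $ j - t else z $ i) \<le> 1 $ i) \<and>
            (\<forall>i. i \<notin> - {j} \<longrightarrow> (if i = j then z $ j - t else z $ i) = 0)"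
          then have "z $ j = t" by simp
          moreover from * have "\<forall>i. 0 \<le> (if i = j then z $ j - t else z $ i) \<and>
            (if i = j then z $ j - t else z $ i) \<le> 1" by simp
          then have "0 \<le> z $ i \<and> z $ i \<le> 1" if "i \<noteq> j" for i using that by (auto dest: spec[of _ i])
          ultimately show "z $ j = t \<and> (\<forall>i. i \<noteq> j \<longrightarrow> 0 \<le> z $ i \<and> z $ i \<le> 1)" by simp
        qed simp
        finally show "z \<in> cbox 0 1 \<inter> {z. z $ j = t} \<longleftrightarrow> z \<in> (+) (- (t *\<^sub>R e)) -` face (- {j})"
          by simp
      qed
      then have "hausdorff_outer k (cbox 0 1 \<inter> {z :: real ^ 'n. z $ j = t}) = face_measure j"
        by (simp only: hausdorff_outer_translation face_measure_def k_def)
      then show ?thesis using True by simp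
    next
      case False
      have "z $ j \<in> {0..1}" if "z \<in> cbox 0 1" for z :: "real ^ 'n"
        using that by (simp add: mem_box_cart)
      then have "cbox 0 1 \<inter> {z :: real ^ 'n. z $ j = t} = {}" using False by blast
      then show ?thesis using False by simp
    qed
  qed
  also have "\<dots> = face_measure j" by (simp add: nn_integral_cmult)
  finally have cube: "emeasure \<mu> (cbox 0 1) = face_measure j" .
  have "emeasure \<mu> A = face_measure j * emeasure lborel A"
    unfolding cube[symmetric]
    by (rule emeasure_translation_invariant[OF _ inv _ A]) (simp_all add: \<mu>_def cube[unfolded \<mu>_def] face_measure_finite[unfolded infinity_ennreal_def])
  then show "(\<integral>\<^sup>+t. hausdorff_outer (CARD('n) - 1) (A \<inter> {z. z $ j = t}) \<partial>lborel) =
      face_measure j * emeasure lborel A" by (simp add: \<mu> k_def)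
qed

section \<open>The coarea formula\<close>

lemma has_derivative_grad:
  fixes h :: "real ^ 'n \<Rightarrow> real"
  assumes "h differentiable (at x)"
  shows "(h has_derivative (\<lambda>v. grad h x \<bullet> v)) (at x)"
proof -
  let ?D = "frechet_derivative h (at x)"
  have D: "(h has_derivative ?D) (at x)" using assms frechet_derivative_works by blast
  have "?D v = grad h x \<bullet> v" for v
  proof -
    have "linear ?D" using D by (rule has_derivative_linear)
    then have "?D v = ?D (\<Sum>i\<in>UNIV. v $ i *\<^sub>R axis i 1)"
      by (simp add: basis_expansion scalar_mult_eq_scaleR[symmetric])
    also have "\<dots> = (\<Sum>i\<in>UNIV. v $ i * ?D (axis i 1))"
      using \<open>linear ?D\<close> by (simp add: linear_sum linear_scale)
    also have "\<dots> = grad h x \<bullet> v" by (simp add: grad_def inner_vec_def mult.commute)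
    finally show ?thesis .
  qed
  then have "?D = (\<lambda>v. grad h x \<bullet> v)" by (rule ext)
  then show ?thesis using D by simp
qed

lemma frechet_derivative_eq_grad:
  fixes h :: "real ^ 'n \<Rightarrow> real"
  assumes "h differentiable (at x)"
  shows "frechet_derivative h (at x) v = grad h x \<bullet> v"
  using frechet_derivative_at[OF has_derivative_grad[OF assms]] by metis

text \<open>The Lipschitz bound for the inverse map.\<close>

lemma hausdorff_outer_expanding:
  assumes "0 < \<kappa>" and exp: "\<And>x y. x \<in> A \<Longrightarrow> y \<in> A \<Longrightarrow> dist x y \<le> \<kappa> * dist (f x) (f y)"
  shows "hausdorff_outer k A \<le> ennreal (\<kappa> ^ k) * hausdorff_outer k (f ` A)"
proof -
  have inj: "inj_on f A" by (rule inj_onI) (use exp in fastforce)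
  have "hausdorff_outer k (inv_into A f ` f ` A) \<le> ennreal (\<kappa> ^ k) * hausdorff_outer k (f ` A)"
  proof (rule hausdorff_outer_lipschitz_image[OF assms(1)])
    fix x y assume "x \<in> f ` A" "y \<in> f ` A"
    then show "dist (inv_into A f x) (inv_into A f y) \<le> \<kappa> * dist x y"
      using exp[of "inv_into A f x" "inv_into A f y"] by (simp add: f_inv_into_f inv_into_into)
  qed
  then show ?thesis using inj by (simp add: inv_into_image_cancel)
qed

lemma lborel_le_of_hausdorff_le:
  fixes A B :: "(real ^ 'n) set"
  assumes "A \<in> sets borel" "B \<in> sets borel"
    and "hausdorff_outer CARD('n) A \<le> L * hausdorff_outer CARD('n) B"
  shows "emeasure lborel A \<le> L * emeasure lborel B"
proof -
  let ?c = "hausdorff_outer CARD('n) (face UNIV :: (real ^ 'n) set)"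
  have "?c * emeasure lborel A \<le> ?c * (L * emeasure lborel B)"
    using assms by (simp add: hausdorff_eq_lborel[of A] hausdorff_eq_lborel[of B] mult.left_commute)
  then show ?thesis
    using hausdorff_face_pos[of "UNIV :: 'n set"] hausdorff_face_finite[of "UNIV :: 'n set"]
    by (subst (asm) ennreal_mult_le_mult_iff) auto
qed

text \<open>A continuous injection of a compact set has a continuous inverse, of which \<open>f ` A\<close> is a
preimage.\<close>

lemma borel_image_of_compact:
  fixes f :: "'a::t2_space \<Rightarrow> 'b::t2_space"
  assumes K: "compact K" and f: "continuous_on K f" "inj_on f K" and A: "A \<in> sets borel" "A \<subseteq> K"
  shows "f ` A \<in> sets borel"
proof -
  define g where "g = inv_into K f"
  have "continuous_on (f ` K) g"
    using continuous_on_inv[OF f(1) K, of g] f(2) by (simp add: g_def)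
  then have "g \<in> borel_measurable (restrict_space borel (f ` K))"
    by (rule borel_measurable_continuous_on_restrict)
  from measurable_sets[OF this A(1)] have "g -` A \<inter> f ` K \<in> sets (restrict_space borel (f ` K))"
    by (simp add: space_restrict_space)
  moreover have "f ` K \<in> sets borel"
    using compact_continuous_image[OF f(1) K] by (simp add: compact_imp_closed borel_closed)
  moreover have "g -` A \<inter> f ` K = f ` A"
    using A(2) f(2) by (auto simp: g_def inv_into_f_f subset_iff)
  ultimately show ?thesis by (simp add: sets_restrict_space_iff)
qed

text \<open>A chart that turns the level sets into parallel hyperplanes and is almost an isometry. A
  rotation takes the gradient at \<open>x\<close> to a multiple of the \<open>j\<close>-th axis; the \<open>j\<close>-th coordinate is then
  replaced by the rescaled function itself, which has the same derivative at \<open>x\<close>.\<close>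

lemma almost_isometric_straightening:
  fixes h :: "real ^ 'n \<Rightarrow> real" and j :: 'n
  assumes W: "open W" "x \<in> W" and diff: "\<And>y. y \<in> W \<Longrightarrow> h differentiable (at y)"
    and cont: "continuous_on W (grad h)" and nz: "grad h x \<noteq> 0" and \<kappa>: "1 < \<kappa>"
  obtains \<eta> g \<Psi> where "0 < \<eta>" "0 < g" "cball x \<eta> \<subseteq> W"
    "\<And>y. y \<in> cball x \<eta> \<Longrightarrow> norm (grad h y) \<le> \<kappa> * g"
    "\<And>y. y \<in> cball x \<eta> \<Longrightarrow> g \<le> \<kappa> * norm (grad h y)"
    "\<And>y. \<Psi> y $ j = h y / g"
    "\<And>y z. y \<in> cball x \<eta> \<Longrightarrow> z \<in> cball x \<eta> \<Longrightarrow> dist (\<Psi> y) (\<Psi> z) \<le> \<kappa> * dist y z"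
    "\<And>y z. y \<in> cball x \<eta> \<Longrightarrow> z \<in> cball x \<eta> \<Longrightarrow> dist y z \<le> \<kappa> * dist (\<Psi> y) (\<Psi> z)"
proof -
  define g where "g = norm (grad h x)"
  define n where "n = grad h x /\<^sub>R g"
  define e :: "real ^ 'n" where "e = axis j 1"
  have g: "0 < g" using nz by (simp add: g_def)
  have [simp]: "norm n = 1" "norm e = 1" using g by (simp_all add: n_def g_def e_def)
  obtain R where R: "orthogonal_transformation R" "R n = e"
    using orthogonal_transformation_exists_1[of n e] by auto
  \<comment> \<open>The largest \<open>\<epsilon>\<close> with \<open>1 / (1 - \<epsilon>) \<le> \<kappa>\<close>; then also \<open>1 + \<epsilon> \<le> \<kappa>\<close>.\<close>
  define \<epsilon> where "\<epsilon> = 1 - 1 / \<kappa>"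
  have \<epsilon>: "0 < \<epsilon>" "\<epsilon> < 1" "\<kappa> * (1 - \<epsilon>) = 1" using \<kappa> by (simp_all add: \<epsilon>_def field_simps)
  have \<epsilon>\<kappa>: "1 + \<epsilon> \<le> \<kappa>"
  proof -
    have "0 \<le> (\<kappa> - 1)\<^sup>2 / \<kappa>" using \<kappa> by simp
    also have "\<dots> = \<kappa> - (1 + \<epsilon>)" using \<kappa> by (simp add: \<epsilon>_def field_simps power2_eq_square)
    finally show ?thesis by simp
  qed
  obtain \<eta>1 where \<eta>1: "0 < \<eta>1" "cball x \<eta>1 \<subseteq> W" using W open_contains_cball by blast
  have "isCont (grad h) x" using cont W by (simp add: continuous_on_eq_continuous_at)
  then obtain \<eta>2 where \<eta>2: "0 < \<eta>2" "\<And>y. dist y x < \<eta>2 \<Longrightarrow> dist (grad h y) (grad h x) < \<epsilon> * g"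
    using \<epsilon> g unfolding continuous_at_eps_delta by (metis mult_pos_pos)
  define \<eta> where "\<eta> = min \<eta>1 (\<eta>2 / 2)"
  have \<eta>: "0 < \<eta>" using \<eta>1 \<eta>2 by (simp add: \<eta>_def)
  have sub: "cball x \<eta> \<subseteq> W" using \<eta>1 by (auto simp: \<eta>_def)
  have close: "norm (grad h y - grad h x) \<le> \<epsilon> * g" if "y \<in> cball x \<eta>" for y
    using that \<eta>2(2)[of y] \<eta>2(1) by (auto simp: \<eta>_def dist_commute[of x] dist_norm[of "grad h y", symmetric])
  define E where "E y = h y / g - n \<bullet> y" for y
  define \<Psi> where "\<Psi> y = R y + E y *\<^sub>R e" for y
  have lipE: "\<bar>E y - E z\<bar> \<le> \<epsilon> * dist y z" if y: "y \<in> cball x \<eta>" and z: "z \<in> cball x \<eta>" for y z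
  proof -
    have "norm (E y - E z) \<le> \<epsilon> * norm (y - z)"
    proof (rule differentiable_bound[OF convex_cball _ _ y z])
      fix w assume w: "w \<in> cball x \<eta>"
      have "(E has_derivative (\<lambda>v. (grad h w \<bullet> v) / g - n \<bullet> v)) (at w)"
        unfolding E_def
        using has_derivative_grad[OF diff[of w]] w sub g
        by (auto intro!: derivative_eq_intros)
      then show "(E has_derivative (\<lambda>v. (grad h w \<bullet> v) / g - n \<bullet> v)) (at w within cball x \<eta>)"
        by (rule has_derivative_at_withinI)
      show "onorm (\<lambda>v. (grad h w \<bullet> v) / g - n \<bullet> v) \<le> \<epsilon>"
      proof (rule onorm_le)
        fix v
        have "(grad h w \<bullet> v) / g - n \<bullet> v = ((grad h w - grad h x) \<bullet> v) / g"
          by (simp add: n_def inner_diff_left divide_inverse algebra_simps)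
        moreover have "\<bar>(grad h w - grad h x) \<bullet> v\<bar> \<le> \<epsilon> * g * norm v"
          using Cauchy_Schwarz_ineq2[of "grad h w - grad h x" v] close[OF w]
          by (meson mult_right_mono norm_ge_zero order_trans)
        ultimately show "norm ((grad h w \<bullet> v) / g - n \<bullet> v) \<le> \<epsilon> * norm v"
          using g by (simp add: field_simps)
      qed
    qed
    then show ?thesis by (simp add: dist_norm)
  qed
  have lin: "linear R" and isoR: "norm (R v) = norm v" for v
    using R(1) by (simp_all add: orthogonal_transformation)
  have \<Psi>diff: "\<Psi> y - \<Psi> z = R (y - z) + (E y - E z) *\<^sub>R e" for y z
    using lin by (simp add: \<Psi>_def linear_diff scaleR_diff_left)
  have up: "dist (\<Psi> y) (\<Psi> z) \<le> (1 + \<epsilon>) * dist y z"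
    and low: "(1 - \<epsilon>) * dist y z \<le> dist (\<Psi> y) (\<Psi> z)"
    if "y \<in> cball x \<eta>" "z \<in> cball x \<eta>" for y z
  proof -
    have d: "dist (\<Psi> y) (\<Psi> z) = norm (R (y - z) + (E y - E z) *\<^sub>R e)" by (simp add: dist_norm \<Psi>diff)
    have n: "norm (R (y - z)) = dist y z" "norm ((E y - E z) *\<^sub>R e) = \<bar>E y - E z\<bar>"
      by (simp_all add: isoR dist_norm)
    have "dist (\<Psi> y) (\<Psi> z) \<le> dist y z + \<epsilon> * dist y z"
      using norm_triangle_ineq[of "R (y - z)" "(E y - E z) *\<^sub>R e"] lipE[OF that] unfolding d n
      by linarith
    then show "dist (\<Psi> y) (\<Psi> z) \<le> (1 + \<epsilon>) * dist y z" by (simp add: algebra_simps)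
    have "dist y z - \<epsilon> * dist y z \<le> dist (\<Psi> y) (\<Psi> z)"
      using norm_diff_ineq[of "R (y - z)" "(E y - E z) *\<^sub>R e"] lipE[OF that] unfolding d n
      by linarith
    then show "(1 - \<epsilon>) * dist y z \<le> dist (\<Psi> y) (\<Psi> z)" by (simp add: algebra_simps)
  qed
  show thesis
  proof (rule that[OF \<eta> g sub])
    fix y assume y: "y \<in> cball x \<eta>"
    have "norm (grad h y) \<le> (1 + \<epsilon>) * g"
      using norm_triangle_ineq2[of "grad h y" "grad h x"] close[OF y] by (simp add: g_def algebra_simps)
    also have "\<dots> \<le> \<kappa> * g" using \<epsilon>\<kappa> g by (intro mult_right_mono) auto
    finally show "norm (grad h y) \<le> \<kappa> * g" .
    have "(1 - \<epsilon>) * g \<le> norm (grad h y)"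
      using norm_triangle_ineq3[of "grad h y" "grad h x"] close[OF y] by (simp add: g_def algebra_simps)
    then have "\<kappa> * ((1 - \<epsilon>) * g) \<le> \<kappa> * norm (grad h y)" using \<kappa> by (intro mult_left_mono) auto
    then show "g \<le> \<kappa> * norm (grad h y)" using \<epsilon>(3) by (simp add: mult.assoc[symmetric])
    fix z assume z: "z \<in> cball x \<eta>"
    have "(1 + \<epsilon>) * dist y z \<le> \<kappa> * dist y z" using \<epsilon>\<kappa> by (intro mult_right_mono) auto
    with up[OF y z] show "dist (\<Psi> y) (\<Psi> z) \<le> \<kappa> * dist y z" by simp
    have "\<kappa> * ((1 - \<epsilon>) * dist y z) \<le> \<kappa> * dist (\<Psi> y) (\<Psi> z)"
      using low[OF y z] \<kappa> by (intro mult_left_mono) auto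
    then show "dist y z \<le> \<kappa> * dist (\<Psi> y) (\<Psi> z)" using \<epsilon>(3) by (simp add: mult.assoc[symmetric])
  next
    fix y
    have "R y $ j = R y \<bullet> e" by (simp add: e_def inner_axis)
    also have "\<dots> = R y \<bullet> R n" by (simp add: R)
    also have "\<dots> = y \<bullet> n" using R(1) by (simp add: orthogonal_transformation_def)
    finally show "\<Psi> y $ j = h y / g"
      by (simp add: \<Psi>_def E_def inner_commute e_def)
  qed
qed

text \<open>Up to the factor \<open>face_measure j\<close>, the right-hand side of the coarea formula as a function of the
set.\<close>

definition grad_measure :: "(real ^ 'n) set \<Rightarrow> (real ^ 'n \<Rightarrow> real) \<Rightarrow> (real ^ 'n) measure" where
  "grad_measure W h = density lborel (\<lambda>y. ennreal (indicator W y * norm (grad h y)))"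

lemma grad_density_measurable:
  assumes "open W" "continuous_on W (grad h)"
  shows "(\<lambda>y. indicator W y * norm (grad h y)) \<in> borel_measurable borel"
proof -
  have "(\<lambda>y. indicator W y *\<^sub>R grad h y) \<in> borel_measurable borel"
    using assms by (intro borel_measurable_continuous_on_indicator) auto
  then have "(\<lambda>y. norm (indicator W y *\<^sub>R grad h y)) \<in> borel_measurable borel" by measurable
  then show ?thesis by simp
qed

lemma level_set_borel:
  assumes "open W" and diff: "\<And>y. y \<in> W \<Longrightarrow> h differentiable (at y)"
  shows "{y \<in> W. h y = s} \<in> sets borel"
proof -
  have "continuous_on W h"
    using diff by (meson continuous_at_imp_continuous_on differentiable_imp_continuous_within)
  then have "closedin (top_of_set W) (W \<inter> h -` {s})" by (intro continuous_closedin_preimage) auto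
  then obtain T where "closed T" "W \<inter> h -` {s} = W \<inter> T" by (auto simp: closedin_closed)
  moreover have "W \<inter> h -` {s} = {y \<in> W. h y = s}" by auto
  ultimately show ?thesis using assms(1) by (metis borel_closed borel_open sets.Int)
qed

text \<open>In the chart the slices are hyperplane sections, whose measure \<open>\<phi>\<close> is a Borel function of the level
with known integral. The chart changes Hausdorff measures of dimension \<open>N - 1\<close> by at most
\<open>\<kappa>\<^bsup>N-1\<^esup>\<close>, Lebesgue measure by at most \<open>\<kappa>\<^sup>N\<close>, and the gradient differs from its value at the centre
by a factor of at most \<open>\<kappa>\<close>. All this is absorbed in \<open>L\<close>.\<close>

lemma coarea_local:
  fixes h :: "real ^ 'n \<Rightarrow> real" and j :: 'n
  assumes W: "open W" "x \<in> W" and diff: "\<And>y. y \<in> W \<Longrightarrow> h differentiable (at y)"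
    and cont: "continuous_on W (grad h)" and nz: "grad h x \<noteq> 0" and \<kappa>: "1 < \<kappa>"
  defines "L \<equiv> ennreal (\<kappa> ^ (CARD('n) + 1))"
  shows "\<exists>\<eta>>0. cball x \<eta> \<subseteq> W \<and> (\<forall>A \<in> sets borel. A \<subseteq> cball x \<eta> \<longrightarrow>
    (\<exists>\<phi> \<in> borel_measurable borel.
      (\<forall>s. hausdorff_outer (CARD('n) - 1) (A \<inter> {y. h y = s}) \<le> L * \<phi> s \<and>
           \<phi> s \<le> L * hausdorff_outer (CARD('n) - 1) (A \<inter> {y. h y = s})) \<and>
      (\<integral>\<^sup>+s. \<phi> s \<partial>lborel) \<le> L * (face_measure j * emeasure (grad_measure W h) A) \<and>
      face_measure j * emeasure (grad_measure W h) A \<le> L * (\<integral>\<^sup>+s. \<phi> s \<partial>lborel)))"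
proof -
  from almost_isometric_straightening[OF W diff cont nz \<kappa>, of j] obtain \<eta> g \<Psi> where
    \<eta>: "0 < \<eta>" and g: "0 < g" and sub: "cball x \<eta> \<subseteq> W"
    and grad_le: "\<And>y. y \<in> cball x \<eta> \<Longrightarrow> norm (grad h y) \<le> \<kappa> * g"
    and grad_ge: "\<And>y. y \<in> cball x \<eta> \<Longrightarrow> g \<le> \<kappa> * norm (grad h y)"
    and \<Psi>j: "\<And>y. \<Psi> y $ j = h y / g"
    and lip: "\<And>y z. y \<in> cball x \<eta> \<Longrightarrow> z \<in> cball x \<eta> \<Longrightarrow> dist (\<Psi> y) (\<Psi> z) \<le> \<kappa> * dist y z"
    and expd: "\<And>y z. y \<in> cball x \<eta> \<Longrightarrow> z \<in> cball x \<eta> \<Longrightarrow> dist y z \<le> \<kappa> * dist (\<Psi> y) (\<Psi> z)"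
    by metis
  define N where "N = CARD('n)"
  have \<kappa>0: "0 < \<kappa>" using \<kappa> by simp
  have pow_le: "ennreal (\<kappa> ^ i) \<le> L" if "i \<le> N + 1" for i
    using that \<kappa> unfolding L_def N_def by (intro ennreal_leI power_increasing) auto
  note meas[measurable] = grad_density_measurable[OF W(1) cont]
  show ?thesis
  proof (intro exI[of _ \<eta>] conjI ballI impI \<eta> sub)
    fix A :: "(real ^ 'n) set" assume A[measurable]: "A \<in> sets borel" and Asub: "A \<subseteq> cball x \<eta>"
    have "continuous_on (cball x \<eta>) \<Psi>"
      using lip \<kappa>0 by (intro lipschitz_on_continuous_on[of \<kappa>] lipschitz_onI) auto
    moreover have "inj_on \<Psi> (cball x \<eta>)" by (rule inj_onI) (use expd in fastforce)
    ultimately have \<Psi>A[measurable]: "\<Psi> ` A \<in> sets borel"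
      using A Asub by (intro borel_image_of_compact[of "cball x \<eta>"]) auto
    have lipA: "dist (\<Psi> y) (\<Psi> z) \<le> \<kappa> * dist y z" and expA: "dist y z \<le> \<kappa> * dist (\<Psi> y) (\<Psi> z)"
      if "y \<in> A" "z \<in> A" for y z
      using that Asub lip[of y z] expd[of y z] by blast+
    have slice: "\<Psi> ` A \<inter> {z. z $ j = s / g} = \<Psi> ` (A \<inter> {y. h y = s})" for s
      using g by (auto simp: \<Psi>j)
    define \<phi> where "\<phi> s = hausdorff_outer (N - 1) (\<Psi> ` A \<inter> {z. z $ j = s / g})" for s
    define \<phi>0 where "\<phi>0 t = hausdorff_outer (N - 1) (\<Psi> ` A \<inter> {z. z $ j = t})" for t
    have \<phi>0[measurable]: "\<phi>0 \<in> borel_measurable borel"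
      using hausdorff_slices(1)[OF \<Psi>A, of j] by (simp add: \<phi>0_def[abs_def] N_def)
    have \<phi>_eq: "\<phi> s = \<phi>0 (0 + (1 / g) * s)" for s by (simp add: \<phi>_def \<phi>0_def)
    have int_\<phi>: "(\<integral>\<^sup>+s. \<phi> s \<partial>lborel) = ennreal g * (face_measure j * emeasure lborel (\<Psi> ` A))"
    proof -
      have "(\<integral>\<^sup>+t. \<phi>0 t \<partial>lborel) = ennreal (1 / g) * (\<integral>\<^sup>+s. \<phi> s \<partial>lborel)"
        unfolding \<phi>_eq using nn_integral_real_affine[of \<phi>0 "1 / g" 0] g by simp
      then have "ennreal g * (\<integral>\<^sup>+t. \<phi>0 t \<partial>lborel) = ennreal g * (ennreal (1 / g) * (\<integral>\<^sup>+s. \<phi> s \<partial>lborel))"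
        by simp
      also have "\<dots> = (\<integral>\<^sup>+s. \<phi> s \<partial>lborel)"
        using g by (simp add: mult.assoc[symmetric] ennreal_mult[symmetric])
      finally show ?thesis using hausdorff_slices(2)[OF \<Psi>A, of j] by (simp add: \<phi>0_def N_def)
    qed
    have le1: "emeasure lborel (\<Psi> ` A) \<le> ennreal (\<kappa> ^ N) * emeasure lborel A"
      unfolding N_def
      by (intro lborel_le_of_hausdorff_le hausdorff_outer_lipschitz_image lipA \<kappa>0) auto
    have le2: "emeasure lborel A \<le> ennreal (\<kappa> ^ N) * emeasure lborel (\<Psi> ` A)"
      unfolding N_def
      by (intro lborel_le_of_hausdorff_le hausdorff_outer_expanding expA \<kappa>0) auto
    have gm: "emeasure (grad_measure W h) A = (\<integral>\<^sup>+y. ennreal (indicator W y * norm (grad h y)) * indicator A y \<partial>lborel)"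
      unfolding grad_measure_def by (rule emeasure_density) auto
    have gm_le: "emeasure (grad_measure W h) A \<le> ennreal (\<kappa> * g) * emeasure lborel A"
    proof -
      have "emeasure (grad_measure W h) A \<le> (\<integral>\<^sup>+y. ennreal (\<kappa> * g) * indicator A y \<partial>lborel)"
        unfolding gm using Asub sub grad_le
        by (intro nn_integral_mono) (auto simp: indicator_def intro!: ennreal_leI)
      then show ?thesis by (simp add: nn_integral_cmult)
    qed
    have gm_ge: "ennreal g * emeasure lborel A \<le> ennreal \<kappa> * emeasure (grad_measure W h) A"
    proof -
      have "ennreal g * emeasure lborel A = (\<integral>\<^sup>+y. ennreal g * indicator A y \<partial>lborel)"
        by (simp add: nn_integral_cmult)
      also have "\<dots> \<le> (\<integral>\<^sup>+y. ennreal \<kappa> * (ennreal (indicator W y * norm (grad h y)) * indicator A y) \<partial>lborel)"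
        using Asub sub grad_ge \<kappa>0
        by (intro nn_integral_mono) (auto simp: indicator_def ennreal_mult[symmetric] intro!: ennreal_leI)
      also have "\<dots> = ennreal \<kappa> * emeasure (grad_measure W h) A"
        unfolding gm by (rule nn_integral_cmult) simp
      finally show ?thesis .
    qed
    show "\<exists>\<phi> \<in> borel_measurable borel.
      (\<forall>s. hausdorff_outer (CARD('n) - 1) (A \<inter> {y. h y = s}) \<le> L * \<phi> s \<and>
           \<phi> s \<le> L * hausdorff_outer (CARD('n) - 1) (A \<inter> {y. h y = s})) \<and>
      (\<integral>\<^sup>+s. \<phi> s \<partial>lborel) \<le> L * (face_measure j * emeasure (grad_measure W h) A) \<and>
      face_measure j * emeasure (grad_measure W h) A \<le> L * (\<integral>\<^sup>+s. \<phi> s \<partial>lborel)"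
    proof (intro bexI[of _ \<phi>] conjI allI)
      show "\<phi> \<in> borel_measurable borel" unfolding \<phi>_eq[abs_def] by measurable
      fix s
      have "hausdorff_outer (N - 1) (A \<inter> {y. h y = s}) \<le> ennreal (\<kappa> ^ (N - 1)) * \<phi> s"
        unfolding \<phi>_def slice by (intro hausdorff_outer_expanding expA \<kappa>0) auto
      also have "\<dots> \<le> L * \<phi> s" by (intro mult_right_mono pow_le) auto
      finally show "hausdorff_outer (CARD('n) - 1) (A \<inter> {y. h y = s}) \<le> L * \<phi> s" by (simp add: N_def)
      have "\<phi> s \<le> ennreal (\<kappa> ^ (N - 1)) * hausdorff_outer (N - 1) (A \<inter> {y. h y = s})"
        unfolding \<phi>_def slice by (intro hausdorff_outer_lipschitz_image lipA \<kappa>0) auto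
      also have "\<dots> \<le> L * hausdorff_outer (N - 1) (A \<inter> {y. h y = s})"
        by (intro mult_right_mono pow_le) auto
      finally show "\<phi> s \<le> L * hausdorff_outer (CARD('n) - 1) (A \<inter> {y. h y = s})" by (simp add: N_def)
    next
      have L: "L = ennreal (\<kappa> ^ N) * ennreal \<kappa>"
        using \<kappa>0 by (simp add: L_def N_def ennreal_mult[symmetric] mult.commute)
      have "(\<integral>\<^sup>+s. \<phi> s \<partial>lborel) \<le> ennreal g * (face_measure j * (ennreal (\<kappa> ^ N) * emeasure lborel A))"
        unfolding int_\<phi> by (intro mult_left_mono le1) auto
      also have "\<dots> = face_measure j * ennreal (\<kappa> ^ N) * (ennreal g * emeasure lborel A)"
        by (simp add: ac_simps)
      also have "\<dots> \<le> face_measure j * ennreal (\<kappa> ^ N) * (ennreal \<kappa> * emeasure (grad_measure W h) A)"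
        by (intro mult_left_mono gm_ge) auto
      also have "\<dots> = L * (face_measure j * emeasure (grad_measure W h) A)" by (simp add: L ac_simps)
      finally show "(\<integral>\<^sup>+s. \<phi> s \<partial>lborel) \<le> L * (face_measure j * emeasure (grad_measure W h) A)" .
      have "face_measure j * emeasure (grad_measure W h) A \<le>
          face_measure j * (ennreal (\<kappa> * g) * (ennreal (\<kappa> ^ N) * emeasure lborel (\<Psi> ` A)))"
        by (intro mult_left_mono order_trans[OF gm_le] le2) auto
      also have "\<dots> = L * (\<integral>\<^sup>+s. \<phi> s \<partial>lborel)"
        unfolding int_\<phi> L using \<kappa>0 g by (simp add: ennreal_mult ac_simps)
      finally show "face_measure j * emeasure (grad_measure W h) A \<le> L * (\<integral>\<^sup>+s. \<phi> s \<partial>lborel)" .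
    qed
  qed
qed


text \<open>The comparison is additive in \<open>A\<close>, so it passes from small balls to all of \<open>W\<close> by means of a
countable cover.\<close>

lemma coarea_comparison:
  fixes h :: "real ^ 'n \<Rightarrow> real" and j :: 'n
  assumes W: "open W" and diff: "\<And>y. y \<in> W \<Longrightarrow> h differentiable (at y)"
    and cont: "continuous_on W (grad h)" and nz: "\<And>y. y \<in> W \<Longrightarrow> grad h y \<noteq> 0" and \<kappa>: "1 < \<kappa>"
    and A: "A \<in> sets borel" "A \<subseteq> W"
  defines "L \<equiv> ennreal (\<kappa> ^ (CARD('n) + 1))"
  obtains \<phi> where "\<phi> \<in> borel_measurable borel"
    "\<And>s. hausdorff_outer (CARD('n) - 1) (A \<inter> {y. h y = s}) \<le> L * \<phi> s"
    "\<And>s. \<phi> s \<le> L * hausdorff_outer (CARD('n) - 1) (A \<inter> {y. h y = s})"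
    "(\<integral>\<^sup>+s. \<phi> s \<partial>lborel) \<le> L * (face_measure j * emeasure (grad_measure W h) A)"
    "face_measure j * emeasure (grad_measure W h) A \<le> L * (\<integral>\<^sup>+s. \<phi> s \<partial>lborel)"
proof (cases "A = {}")
  case True
  then show thesis by (intro that[of "\<lambda>_. 0"]) auto
next
  case False
  let ?H = "\<lambda>A s. hausdorff_outer (CARD('n) - 1) (A \<inter> {y. h y = s})"
  let ?P = "\<lambda>A \<phi>. \<phi> \<in> borel_measurable borel \<and> (\<forall>s. ?H A s \<le> L * \<phi> s \<and> \<phi> s \<le> L * ?H A s) \<and>
      (\<integral>\<^sup>+s. \<phi> s \<partial>lborel) \<le> L * (face_measure j * emeasure (grad_measure W h) A) \<and>
      face_measure j * emeasure (grad_measure W h) A \<le> L * (\<integral>\<^sup>+s. \<phi> s \<partial>lborel)"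
  have "\<exists>\<eta>>0. \<forall>A \<in> sets borel. A \<subseteq> cball x \<eta> \<longrightarrow> (\<exists>\<phi>. ?P A \<phi>)" if "x \<in> W" for x
    using coarea_local[OF W that diff cont nz[OF that] \<kappa>, of j] unfolding L_def Bex_def by blast
  then obtain \<eta> where \<eta>: "\<And>x. x \<in> W \<Longrightarrow> 0 < \<eta> x"
    and loc: "\<And>x A. x \<in> W \<Longrightarrow> A \<in> sets borel \<Longrightarrow> A \<subseteq> cball x (\<eta> x) \<Longrightarrow> \<exists>\<phi>. ?P A \<phi>"
    by metis
  have "\<And>S. S \<in> (\<lambda>x. ball x (\<eta> x)) ` W \<Longrightarrow> open S" by blast
  then obtain F where F: "F \<subseteq> (\<lambda>x. ball x (\<eta> x)) ` W" "countable F" "\<Union>F = (\<Union>x\<in>W. ball x (\<eta> x))"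
    by (rule Lindelof)
  from F(1,2) have "\<exists>C. countable C \<and> C \<subseteq> W \<and> F = (\<lambda>x. ball x (\<eta> x)) ` C"
    by (subst countable_subset_image[symmetric]) (rule conjI)
  then obtain C where C: "countable C" "C \<subseteq> W" "F = (\<lambda>x. ball x (\<eta> x)) ` C"
    by (elim exE conjE)
  have cover: "W \<subseteq> (\<Union>x\<in>C. ball x (\<eta> x))" using F(3) \<eta> C(3) by force
  with False A have "C \<noteq> {}" by auto
  define c where "c = from_nat_into C"
  have c: "c i \<in> W" for i using from_nat_into[OF \<open>C \<noteq> {}\<close>] C(2) by (auto simp: c_def)
  have cover': "W \<subseteq> (\<Union>i. ball (c i) (\<eta> (c i)))"
  proof
    fix x assume "x \<in> W"
    then obtain y where "y \<in> C" "x \<in> ball y (\<eta> y)" using cover by blast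
    moreover from \<open>y \<in> C\<close> C(1) obtain i where "c i = y" unfolding c_def by (metis from_nat_into_surj)
    ultimately show "x \<in> (\<Union>i. ball (c i) (\<eta> (c i)))" by blast
  qed
  define A' where "A' i = A \<inter> disjointed (\<lambda>i. ball (c i) (\<eta> (c i))) i" for i
  have disjointed_meas: "disjointed (\<lambda>i. ball (c i) (\<eta> (c i))) i \<in> sets borel" for i
    by (rule range_subsetD[OF sets.range_disjointed_sets]) auto
  have A'_meas[measurable]: "A' i \<in> sets borel" for i
    unfolding A'_def by (intro sets.Int A disjointed_meas)
  have A'_sub: "A' i \<subseteq> cball (c i) (\<eta> (c i))" for i
    using disjointed_subset[of "\<lambda>i. ball (c i) (\<eta> (c i))" i] by (auto simp: A'_def less_imp_le)
  have A'_disj: "disjoint_family A'"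
    using disjoint_family_disjointed[of "\<lambda>i. ball (c i) (\<eta> (c i))"]
    by (fastforce simp: A'_def disjoint_family_on_def)
  have A'_un: "(\<Union>i. A' i) = A"
    using UN_disjointed_eq[of "\<lambda>i. ball (c i) (\<eta> (c i))"] cover' A(2) by (auto simp: A'_def)
  obtain \<phi> where \<phi>: "\<And>i. ?P (A' i) (\<phi> i)" using loc[OF c A'_meas A'_sub] by metis
  then have [measurable]: "\<phi> i \<in> borel_measurable borel" for i by blast
  have slices: "?H A s = (\<Sum>i. ?H (A' i) s)" for s
  proof -
    have m: "A' i \<inter> {y. h y = s} \<in> sets borel" for i
    proof -
      have "A' i \<inter> {y. h y = s} = A' i \<inter> {y \<in> W. h y = s}" using A(2) by (auto simp: A'_def)
      then show ?thesis using level_set_borel[OF W diff] A'_meas by simp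
    qed
    have un: "A \<inter> {y. h y = s} = (\<Union>i. A' i \<inter> {y. h y = s})" using A'_un by auto
    have "?H A s = emeasure (hausdorff_measure (CARD('n) - 1)) (\<Union>i. A' i \<inter> {y. h y = s})"
      unfolding un by (intro emeasure_hausdorff_measure[symmetric] sets.countable_UN image_subsetI m)
    also have "\<dots> = (\<Sum>i. emeasure (hausdorff_measure (CARD('n) - 1)) (A' i \<inter> {y. h y = s}))"
    proof (rule suminf_emeasure[symmetric])
      show "disjoint_family (\<lambda>i. A' i \<inter> {y. h y = s})"
        using A'_disj by (fastforce simp: disjoint_family_on_def)
    qed (use m in auto)
    also have "\<dots> = (\<Sum>i. ?H (A' i) s)" using m by (simp add: emeasure_hausdorff_measure)
    finally show ?thesis .
  qed
  have gm: "emeasure (grad_measure W h) A = (\<Sum>i. emeasure (grad_measure W h) (A' i))"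
    using suminf_emeasure[of A' "grad_measure W h"] A'_disj A'_meas
    by (simp add: A'_un grad_measure_def image_subset_iff)
  have int: "(\<integral>\<^sup>+s. (\<Sum>i. \<phi> i s) \<partial>lborel) = (\<Sum>i. \<integral>\<^sup>+s. \<phi> i s \<partial>lborel)"
    by (rule nn_integral_suminf) simp
  show thesis
  proof (rule that[of "\<lambda>s. \<Sum>i. \<phi> i s"])
    show "(\<lambda>s. \<Sum>i. \<phi> i s) \<in> borel_measurable borel" by measurable
    show "?H A s \<le> L * (\<Sum>i. \<phi> i s)" for s
      unfolding slices ennreal_suminf_cmult[symmetric] using \<phi> by (intro suminf_le) auto
    show "(\<Sum>i. \<phi> i s) \<le> L * ?H A s" for s
      unfolding slices ennreal_suminf_cmult[symmetric] using \<phi> by (intro suminf_le) auto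
    show "(\<integral>\<^sup>+s. (\<Sum>i. \<phi> i s) \<partial>lborel) \<le> L * (face_measure j * emeasure (grad_measure W h) A)"
      unfolding int gm ennreal_suminf_cmult[symmetric] using \<phi> by (intro suminf_le) auto
    show "face_measure j * emeasure (grad_measure W h) A \<le> L * (\<integral>\<^sup>+s. (\<Sum>i. \<phi> i s) \<partial>lborel)"
      unfolding int gm ennreal_suminf_cmult[symmetric] using \<phi> by (intro suminf_le) auto
  qed
qed

lemma le_of_le_factor:
  fixes a b :: ennreal
  assumes "\<And>n. a \<le> ennreal ((1 + inverse (real (Suc n))) ^ p) * b"
  shows "a \<le> b"
proof (cases b)
  case (real r)
  have "(\<lambda>n. ennreal ((1 + inverse (real (Suc n))) ^ p * r)) \<longlonglongrightarrow> ennreal ((1 + 0) ^ p * r)"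
    by (intro tendsto_ennrealI tendsto_intros LIMSEQ_inverse_real_of_nat)
  moreover have "a \<le> ennreal ((1 + inverse (real (Suc n))) ^ p * r)" for n
    using assms[of n] real by (simp add: ennreal_mult)
  ultimately show ?thesis using real by (auto intro: LIMSEQ_le_const)
qed simp

text \<open>As \<open>\<kappa>\<close> tends to \<open>1\<close> the comparison becomes an equality. It also shows that the measure of the
slice is an infimum of countably many Borel functions of the level, hence Borel itself.\<close>

proposition coarea_sets:
  fixes h :: "real ^ 'n \<Rightarrow> real" and j :: 'n
  assumes W: "open W" and diff: "\<And>y. y \<in> W \<Longrightarrow> h differentiable (at y)"
    and cont: "continuous_on W (grad h)" and nz: "\<And>y. y \<in> W \<Longrightarrow> grad h y \<noteq> 0"
    and A: "A \<in> sets borel" "A \<subseteq> W"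
  shows "(\<lambda>s. hausdorff_outer (CARD('n) - 1) (A \<inter> {y. h y = s})) \<in> borel_measurable borel"
    and "(\<integral>\<^sup>+s. hausdorff_outer (CARD('n) - 1) (A \<inter> {y. h y = s}) \<partial>lborel) =
      face_measure j * emeasure (grad_measure W h) A"
proof -
  define \<kappa> where "\<kappa> n = 1 + inverse (real (Suc n))" for n
  define p where "p = CARD('n) + 1"
  define f where "f s = hausdorff_outer (CARD('n) - 1) (A \<inter> {y. h y = s})" for s
  let ?D = "face_measure j * emeasure (grad_measure W h) A"
  have \<kappa>: "1 < \<kappa> n" for n by (simp add: \<kappa>_def)
  have "\<exists>\<phi>. \<phi> \<in> borel_measurable borel \<and>
    (\<forall>s. f s \<le> ennreal (\<kappa> n ^ p) * \<phi> s \<and> \<phi> s \<le> ennreal (\<kappa> n ^ p) * f s) \<and>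
    (\<integral>\<^sup>+s. \<phi> s \<partial>lborel) \<le> ennreal (\<kappa> n ^ p) * ?D \<and> ?D \<le> ennreal (\<kappa> n ^ p) * (\<integral>\<^sup>+s. \<phi> s \<partial>lborel)" for n
    using coarea_comparison[OF W diff cont nz \<kappa>[of n] A, of j] unfolding f_def p_def by metis
  then obtain \<phi> where [measurable]: "\<And>n. \<phi> n \<in> borel_measurable borel"
    and f_le: "\<And>n s. f s \<le> ennreal (\<kappa> n ^ p) * \<phi> n s" and f_ge: "\<And>n s. \<phi> n s \<le> ennreal (\<kappa> n ^ p) * f s"
    and D_ge: "\<And>n. (\<integral>\<^sup>+s. \<phi> n s \<partial>lborel) \<le> ennreal (\<kappa> n ^ p) * ?D"
    and D_le: "\<And>n. ?D \<le> ennreal (\<kappa> n ^ p) * (\<integral>\<^sup>+s. \<phi> n s \<partial>lborel)"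
    by metis
  have sq: "ennreal (\<kappa> n ^ p) * (ennreal (\<kappa> n ^ p) * x) = ennreal ((1 + inverse (real (Suc n))) ^ (p + p)) * x" for n x
    using \<kappa>[of n] by (simp add: mult.assoc[symmetric] ennreal_mult[symmetric] power_add \<kappa>_def)
  have "f s = (INF n. ennreal (\<kappa> n ^ p) * \<phi> n s)" for s
  proof (rule antisym)
    show "f s \<le> (INF n. ennreal (\<kappa> n ^ p) * \<phi> n s)" by (intro INF_greatest f_le)
    show "(INF n. ennreal (\<kappa> n ^ p) * \<phi> n s) \<le> f s"
    proof (rule le_of_le_factor)
      fix n
      have "(INF n. ennreal (\<kappa> n ^ p) * \<phi> n s) \<le> ennreal (\<kappa> n ^ p) * \<phi> n s" by (rule INF_lower) simp
      also have "\<dots> \<le> ennreal (\<kappa> n ^ p) * (ennreal (\<kappa> n ^ p) * f s)" by (intro mult_left_mono f_ge) auto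
      finally show "(INF n. ennreal (\<kappa> n ^ p) * \<phi> n s) \<le> ennreal ((1 + inverse (real (Suc n))) ^ (p + p)) * f s"
        by (simp only: sq)
    qed
  qed
  then have f_meas[measurable]: "f \<in> borel_measurable borel"
    by (subst measurable_cong[where g="\<lambda>s. INF n. ennreal (\<kappa> n ^ p) * \<phi> n s"]) auto
  then show "(\<lambda>s. hausdorff_outer (CARD('n) - 1) (A \<inter> {y. h y = s})) \<in> borel_measurable borel"
    by (simp add: f_def[abs_def])
  have "(\<integral>\<^sup>+s. f s \<partial>lborel) = ?D"
  proof (rule antisym; rule le_of_le_factor)
    fix n
    have "(\<integral>\<^sup>+s. f s \<partial>lborel) \<le> (\<integral>\<^sup>+s. ennreal (\<kappa> n ^ p) * \<phi> n s \<partial>lborel)"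
      by (intro nn_integral_mono f_le)
    also have "\<dots> = ennreal (\<kappa> n ^ p) * (\<integral>\<^sup>+s. \<phi> n s \<partial>lborel)" by (rule nn_integral_cmult) simp
    also have "\<dots> \<le> ennreal (\<kappa> n ^ p) * (ennreal (\<kappa> n ^ p) * ?D)" by (intro mult_left_mono D_ge) auto
    finally show "(\<integral>\<^sup>+s. f s \<partial>lborel) \<le> ennreal ((1 + inverse (real (Suc n))) ^ (p + p)) * ?D"
      by (simp only: sq)
    have "?D \<le> ennreal (\<kappa> n ^ p) * (\<integral>\<^sup>+s. \<phi> n s \<partial>lborel)" by (rule D_le)
    also have "\<dots> \<le> ennreal (\<kappa> n ^ p) * (\<integral>\<^sup>+s. ennreal (\<kappa> n ^ p) * f s \<partial>lborel)"
      by (intro mult_left_mono nn_integral_mono f_ge) auto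
    also have "(\<integral>\<^sup>+s. ennreal (\<kappa> n ^ p) * f s \<partial>lborel) = ennreal (\<kappa> n ^ p) * (\<integral>\<^sup>+s. f s \<partial>lborel)"
      by (rule nn_integral_cmult) simp
    finally show "?D \<le> ennreal ((1 + inverse (real (Suc n))) ^ (p + p)) * (\<integral>\<^sup>+s. f s \<partial>lborel)"
      by (simp only: sq)
  qed
  then show "(\<integral>\<^sup>+s. hausdorff_outer (CARD('n) - 1) (A \<inter> {y. h y = s}) \<partial>lborel) = ?D"
    by (simp add: f_def)
qed

theorem coarea:
  fixes h :: "real ^ 'n \<Rightarrow> real" and j :: 'n
  assumes W: "open W" and diff: "\<And>y. y \<in> W \<Longrightarrow> h differentiable (at y)"
    and cont: "continuous_on W (grad h)" and nz: "\<And>y. y \<in> W \<Longrightarrow> grad h y \<noteq> 0"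
    and f: "f \<in> borel_measurable borel"
  shows "(\<lambda>s. \<integral>\<^sup>+y \<in> {y \<in> W. h y = s}. f y \<partial>hausdorff_measure (CARD('n) - 1)) \<in> borel_measurable borel"
      (is "?M f \<in> _")
    and "(\<integral>\<^sup>+s. (\<integral>\<^sup>+y \<in> {y \<in> W. h y = s}. f y \<partial>hausdorff_measure (CARD('n) - 1)) \<partial>lborel) =
      face_measure j * (\<integral>\<^sup>+y. f y \<partial>grad_measure W h)" (is "?I f")
proof -
  note level_set_borel[OF W diff, measurable]
  have [measurable_cong]: "sets (grad_measure W h) = sets borel" by (simp add: grad_measure_def)
  define k where "k = CARD('n) - 1"
  define M :: "(real ^ 'n \<Rightarrow> ennreal) \<Rightarrow> real \<Rightarrow> ennreal" where
    "M f = (\<lambda>s. \<integral>\<^sup>+y \<in> {y \<in> W. h y = s}. f y \<partial>hausdorff_measure k)" for f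
  from f have "M f \<in> borel_measurable borel \<and>
    (\<integral>\<^sup>+s. M f s \<partial>lborel) = face_measure j * (\<integral>\<^sup>+y. f y \<partial>grad_measure W h)"
  proof (induction f rule: borel_measurable_induct)
    case (cong f g)
    then have "f = g" by (simp add: fun_eq_iff)
    then show ?case using cong by simp
  next
    case (set A)
    then have A[measurable]: "A \<in> sets borel" by simp
    have M: "M (indicator A) = (\<lambda>s. hausdorff_outer k (A \<inter> W \<inter> {y. h y = s}))"
    proof
      fix s
      have "M (indicator A) s = (\<integral>\<^sup>+y. indicator (A \<inter> {y \<in> W. h y = s}) y \<partial>hausdorff_measure k)"
        unfolding M_def by (intro nn_integral_cong) (auto simp: indicator_def)
      also have "\<dots> = emeasure (hausdorff_measure k) (A \<inter> {y \<in> W. h y = s})"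
        by (rule nn_integral_indicator) simp
      also have "\<dots> = hausdorff_outer k (A \<inter> {y \<in> W. h y = s})"
        by (intro emeasure_hausdorff_measure) simp
      also have "A \<inter> {y \<in> W. h y = s} = A \<inter> W \<inter> {y. h y = s}" by auto
      finally show "M (indicator A) s = hausdorff_outer k (A \<inter> W \<inter> {y. h y = s})" .
    qed
    have "A \<inter> W \<in> sets borel" using W by auto
    note co = coarea_sets(1)[OF W diff cont nz this Int_lower2, folded k_def]
      coarea_sets(2)[OF W diff cont nz this Int_lower2, of j, folded k_def]
    have "emeasure (grad_measure W h) (A \<inter> W) = emeasure (grad_measure W h) A"
      using W grad_density_measurable[OF W cont] unfolding grad_measure_def
      by (subst (1 2) emeasure_density) (auto intro!: nn_integral_cong simp: indicator_def)
    then show ?case using co by (simp add: M)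
  next
    case (mult f c)
    then have [measurable]: "f \<in> borel_measurable borel" "M f \<in> borel_measurable borel" by auto
    have "M (\<lambda>y. c * f y) = (\<lambda>s. c * M f s)"
      unfolding M_def by (simp add: mult.assoc nn_integral_cmult)
    then show ?case using mult by (simp add: nn_integral_cmult mult.left_commute)
  next
    case (add f g)
    then have [measurable]: "f \<in> borel_measurable borel" "M f \<in> borel_measurable borel"
      "g \<in> borel_measurable borel" "M g \<in> borel_measurable borel" by auto
    have "M (\<lambda>y. g y + f y) = (\<lambda>s. M g s + M f s)"
      unfolding M_def by (simp add: distrib_right nn_integral_add)
    then show ?case using add by (simp add: nn_integral_add distrib_left)
  next
    case (seq U)
    then have [measurable]: "\<And>i. U i \<in> borel_measurable borel" "\<And>i. M (U i) \<in> borel_measurable borel"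
      by auto
    have "incseq U" using seq by blast
    then have U: "U i y \<le> U i' y" if "i \<le> i'" for i i' y
      using that by (auto simp: incseq_def le_fun_def)
    have IH: "(\<integral>\<^sup>+s. M (U i) s \<partial>lborel) = face_measure j * (\<integral>\<^sup>+y. U i y \<partial>grad_measure W h)" for i
      using seq by blast
    have inc: "incseq (\<lambda>i. M (U i))"
      unfolding M_def incseq_def le_fun_def
      by (intro allI impI nn_integral_mono mult_right_mono U) auto
    have SUP_eq: "(SUP i. U i) = (\<lambda>y. SUP i. U i y)" by (auto simp: fun_eq_iff image_comp)
    have "M (SUP i. U i) s = (SUP i. M (U i) s)" for s
    proof -
      have "M (SUP i. U i) s = (\<integral>\<^sup>+y. (SUP i. U i y * indicator {y \<in> W. h y = s} y) \<partial>hausdorff_measure k)"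
        by (simp add: M_def SUP_eq SUP_mult_right_ennreal)
      also have "\<dots> = (SUP i. M (U i) s)"
        unfolding M_def
        by (intro nn_integral_monotone_convergence_SUP)
          (auto simp: incseq_def le_fun_def intro!: mult_right_mono U)
      finally show ?thesis .
    qed
    then have "M (SUP i. U i) = (\<lambda>s. SUP i. M (U i) s)" by (rule ext)
    then show ?case
      using IH \<open>incseq U\<close> inc
      by (simp add: SUP_eq nn_integral_monotone_convergence_SUP SUP_mult_left_ennreal)
  qed
  then show "?M f \<in> borel_measurable borel" "?I f" unfolding M_def k_def by auto
qed

section \<open>Smooth functions\<close>

lemma Ck_on_cong:
  assumes S: "open S" and eq: "\<And>x. x \<in> S \<Longrightarrow> f x = g x"
  shows "Ck_on k S f \<longleftrightarrow> Ck_on k S g"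
proof -
  have imp: "Ck_on k S f \<Longrightarrow> (\<And>x. x \<in> S \<Longrightarrow> f x = g x) \<Longrightarrow> Ck_on k S g" for f g
  proof (induction k arbitrary: f g)
    case 0
    then show ?case by (metis Ck_on.simps(1) continuous_on_cong)
  next
    case (Suc k)
    have D: "(g has_derivative frechet_derivative f (at x)) (at x)" if "x \<in> S" for x
    proof -
      have "(f has_derivative frechet_derivative f (at x)) (at x)"
        using Suc.prems(1) that frechet_derivative_works by auto
      then show ?thesis
        by (rule has_derivative_transform_within_open[OF _ S that]) (simp add: Suc.prems(2))
    qed
    then have "frechet_derivative f (at x) = frechet_derivative g (at x)" if "x \<in> S" for x
      using that frechet_derivative_at by blast
    moreover have "g differentiable (at x)" if "x \<in> S" for x
      using D[OF that] by (auto simp: differentiable_def)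
    moreover have "Ck_on k S (\<lambda>x. frechet_derivative g (at x) v)" for v
      by (rule Suc.IH[of "\<lambda>x. frechet_derivative f (at x) v"]) (use Suc.prems(1) calculation(1) in auto)
    ultimately show ?case by simp
  qed
  show ?thesis using imp[of f g] imp[of g f] eq by auto
qed

lemma Ck_on_mono: "Ck_on (Suc k) S f \<Longrightarrow> Ck_on k S f"
proof (induction k arbitrary: f)
  case 0
  then show ?case
    by (auto intro!: continuous_at_imp_continuous_on differentiable_imp_continuous_within)
qed auto

lemma Ck_on_add:
  assumes S: "open S"
  shows "Ck_on k S f \<Longrightarrow> Ck_on k S g \<Longrightarrow> Ck_on k S (\<lambda>x. f x + g x)"
proof (induction k arbitrary: f g)
  case (Suc k)
  have "((\<lambda>x. f x + g x) has_derivative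
      (\<lambda>v. frechet_derivative f (at x) v + frechet_derivative g (at x) v)) (at x)" if "x \<in> S" for x
    by (intro has_derivative_add frechet_derivative_works[THEN iffD1]) (use Suc.prems that in auto)
  from frechet_derivative_at[OF this, symmetric]
  have eq: "frechet_derivative (\<lambda>x. f x + g x) (at x) v =
      frechet_derivative f (at x) v + frechet_derivative g (at x) v" if "x \<in> S" for x v
    using that by simp
  have "Ck_on k S (\<lambda>x. frechet_derivative (\<lambda>x. f x + g x) (at x) v)" for v
    by (subst Ck_on_cong[OF S eq], assumption, rule Suc.IH) (use Suc.prems in auto)
  then show ?case using Suc.prems by auto
qed (auto intro: continuous_on_add)

lemma Ck_on_mult:
  fixes f g :: "'a::real_normed_vector \<Rightarrow> real"
  assumes S: "open S"
  shows "Ck_on k S f \<Longrightarrow> Ck_on k S g \<Longrightarrow> Ck_on k S (\<lambda>x. f x * g x)"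
proof (induction k arbitrary: f g)
  case (Suc k)
  have "((\<lambda>x. f x * g x) has_derivative
      (\<lambda>v. f x * frechet_derivative g (at x) v + frechet_derivative f (at x) v * g x)) (at x)" if "x \<in> S" for x
    by (intro has_derivative_mult frechet_derivative_works[THEN iffD1]) (use Suc.prems that in auto)
  from frechet_derivative_at[OF this, symmetric] this
  have eq: "frechet_derivative (\<lambda>x. f x * g x) (at x) v =
      f x * frechet_derivative g (at x) v + frechet_derivative f (at x) v * g x"
    and diff: "(\<lambda>x. f x * g x) differentiable (at x)" if "x \<in> S" for x v
    using that by (auto simp: differentiable_def)
  have "Ck_on k S (\<lambda>x. frechet_derivative (\<lambda>x. f x * g x) (at x) v)" for v
    by (subst Ck_on_cong[OF S eq], assumption, intro Ck_on_add[OF S] Suc.IH)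
      (use Suc.prems in \<open>auto intro: Ck_on_mono\<close>)
  then show ?case using diff by auto
qed (auto intro: continuous_on_mult)

lemma Ck_on_const: "Ck_on k S (\<lambda>x. c)"
  by (induction k arbitrary: c) auto

lemma Ck_on_sum:
  assumes "open S" "finite I" "\<And>i. i \<in> I \<Longrightarrow> Ck_on k S (f i)"
  shows "Ck_on k S (\<lambda>x. \<Sum>i\<in>I. f i x)"
  using assms(2,3) by (induction I) (auto intro: Ck_on_add[OF assms(1)] Ck_on_const)

text \<open>Left translations and left-invariant fields arise from the group law and its derivatives by
composition with affine maps into the product space.\<close>

lemma Ck_on_comp_affine:
  assumes L: "bounded_linear L" and T: "bounded_linear T"
  shows "Ck_on k UNIV f \<Longrightarrow> Ck_on k UNIV (\<lambda>x. L (f (T x + c)))"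
proof (induction k arbitrary: f)
  case 0
  have "continuous_on UNIV (\<lambda>x. T x + c)"
    by (intro continuous_intros bounded_linear.continuous_on[OF T])
  from continuous_on_compose2[OF _ this] 0 have "continuous_on UNIV (\<lambda>x. f (T x + c))" by auto
  then show ?case by (simp add: bounded_linear.continuous_on[OF L])
next
  case (Suc k)
  have D: "((\<lambda>x. L (f (T x + c))) has_derivative
      (\<lambda>v. L (frechet_derivative f (at (T x + c)) (T v)))) (at x)" for x
  proof -
    have "((\<lambda>x. T x + c) has_derivative T) (at x)"
      using bounded_linear.has_derivative[OF T has_derivative_ident] by (auto intro!: derivative_eq_intros)
    moreover have "(f has_derivative frechet_derivative f (at (T x + c))) (at (T x + c))"
      using Suc.prems frechet_derivative_works by auto
    ultimately have "((\<lambda>x. f (T x + c)) has_derivative (\<lambda>v. frechet_derivative f (at (T x + c)) (T v))) (at x)"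
      by (rule has_derivative_compose)
    then show ?thesis by (rule bounded_linear.has_derivative[OF L])
  qed
  have "Ck_on k UNIV (\<lambda>x. L (frechet_derivative f (at (T x + c)) (T v)))" for v
    using Suc.IH[of "\<lambda>p. frechet_derivative f (at p) (T v)"] Suc.prems by simp
  moreover have "frechet_derivative (\<lambda>x. L (f (T x + c))) (at x) v = L (frechet_derivative f (at (T x + c)) (T v))" for x v
    using frechet_derivative_at[OF D] by metis
  moreover have "(\<lambda>x. L (f (T x + c))) differentiable (at x)" for x
    using D by (rule differentiableI)
  ultimately show ?case by simp
qed

lemma Ck_on_subset: "Ck_on k S f \<Longrightarrow> T \<subseteq> S \<Longrightarrow> Ck_on k T f"
  by (induction k arbitrary: f) (auto intro: continuous_on_subset)

lemma smooth_on_differentiable: "smooth_on S f \<Longrightarrow> x \<in> S \<Longrightarrow> f differentiable (at x)"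
  using Ck_on.simps(2)[of 0 S f] unfolding smooth_on_def by blast

lemma smooth_on_derivative: "smooth_on S f \<Longrightarrow> smooth_on S (\<lambda>x. frechet_derivative f (at x) v)"
  using Ck_on.simps(2)[of _ S f] unfolding smooth_on_def by blast

lemma smooth_on_continuous: "smooth_on S f \<Longrightarrow> continuous_on S f"
  using Ck_on.simps(1)[of S f] unfolding smooth_on_def by blast

lemma smooth_on_grad_continuous:
  assumes "smooth_on S f"
  shows "continuous_on S (grad f)"
  unfolding grad_def
  by (intro continuous_on_vec_lambda smooth_on_continuous smooth_on_derivative assms)

lemma smooth_on_grad_differentiable:
  fixes f :: "real ^ 'n \<Rightarrow> real"
  assumes "smooth_on S f" "x \<in> S"
  shows "grad f differentiable (at x)"
proof -
  have "(\<lambda>x. grad f x $ i) differentiable (at x)" for i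
    unfolding grad_def vec_lambda_beta
    by (rule smooth_on_differentiable[OF smooth_on_derivative[OF assms(1)] assms(2)])
  then show ?thesis
    by (subst differentiable_componentwise_within) (auto simp: Basis_vec_def inner_axis)
qed

text \<open>Young's theorem: the second difference
  \<open>f (x + t v + t w) - f (x + t v) - f (x + t w) + f x\<close> is symmetric in \<open>v\<close> and \<open>w\<close>, and divided by
  \<open>t\<^sup>2\<close> it tends to the iterated derivative in either order.\<close>

lemma second_difference_limit:
  fixes f :: "'a::real_normed_vector \<Rightarrow> real"
  assumes S: "open S" "x \<in> S" and diff: "\<And>y. y \<in> S \<Longrightarrow> f differentiable (at y)"
    and A: "((\<lambda>y. frechet_derivative f (at y) v) has_derivative A) (at x)"
  shows "((\<lambda>t. (f (x + t *\<^sub>R v + t *\<^sub>R w) - f (x + t *\<^sub>R v) - f (x + t *\<^sub>R w) + f x) / t\<^sup>2) \<longlongrightarrow> A w) (at_right 0)"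
proof (rule tendstoI)
  fix e :: real assume e: "0 < e"
  define F where "F y = frechet_derivative f (at y) v" for y
  define K where "K = norm v + norm w"
  \<comment> \<open>Each of the two first-order expansions below contributes an error of at most \<open>e' t K\<close>, and \<open>2 e' K < e\<close>.\<close>
  define e' where "e' = e / (2 * (2 * K + 1))"
  have K: "0 \<le> K" by (simp add: K_def)
  have e': "0 < e'" using e K by (simp add: e'_def)
  have lin: "linear A" using A by (rule has_derivative_linear)
  obtain \<delta>1 where \<delta>1: "0 < \<delta>1" "ball x \<delta>1 \<subseteq> S" using S open_contains_ball by blast
  from A e' obtain \<delta>2 where \<delta>2: "0 < \<delta>2"
    "\<And>y. norm (y - x) < \<delta>2 \<Longrightarrow> norm (F y - F x - A (y - x)) \<le> e' * norm (y - x)"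
    unfolding has_derivative_at_alt F_def by blast
  define \<delta> where "\<delta> = min \<delta>1 \<delta>2 / (K + 1)"
  have \<delta>: "0 < \<delta>" using \<delta>1 \<delta>2 K by (simp add: \<delta>_def)
  have main: "dist ((f (x + t *\<^sub>R v + t *\<^sub>R w) - f (x + t *\<^sub>R v) - f (x + t *\<^sub>R w) + f x) / t\<^sup>2) (A w) < e"
    if t: "0 < t" "t < \<delta>" for t
  proof -
    have tK: "t * K < \<delta>1" "t * K < \<delta>2"
    proof -
      have "t * K \<le> t * (K + 1)" using t by simp
      also have "\<dots> < \<delta> * (K + 1)" using t K by simp
      also have "\<dots> = min \<delta>1 \<delta>2" using K by (simp add: \<delta>_def)
      finally show "t * K < \<delta>1" "t * K < \<delta>2" by auto
    qed
    have small: "norm (s *\<^sub>R v + r *\<^sub>R w) \<le> t * K" if "0 \<le> s" "s \<le> t" "0 \<le> r" "r \<le> t" for s r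
    proof -
      have "norm (s *\<^sub>R v + r *\<^sub>R w) \<le> s * norm v + r * norm w"
        using norm_triangle_ineq[of "s *\<^sub>R v" "r *\<^sub>R w"] that by simp
      also have "\<dots> \<le> t * norm v + t * norm w" using that by (intro add_mono mult_right_mono) auto
      finally show ?thesis by (simp add: K_def distrib_left)
    qed
    have inS: "x + s *\<^sub>R v + r *\<^sub>R w \<in> S" if "0 \<le> s" "s \<le> t" "0 \<le> r" "r \<le> t" for s r
      using small[OF that] tK \<delta>1(2) by (auto simp: subset_iff dist_norm norm_minus_commute add.assoc)
    define \<phi> where "\<phi> s = f (x + s *\<^sub>R v + t *\<^sub>R w) - f (x + s *\<^sub>R v + 0 *\<^sub>R w)" for s
    have D: "((\<lambda>s. f (x + s *\<^sub>R v + r *\<^sub>R w)) has_real_derivative F (x + s *\<^sub>R v + r *\<^sub>R w)) (at s)"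
      if "0 \<le> s" "s \<le> t" "0 \<le> r" "r \<le> t" for s r
    proof -
      have f: "(f has_derivative frechet_derivative f (at (x + s *\<^sub>R v + r *\<^sub>R w))) (at (x + s *\<^sub>R v + r *\<^sub>R w))"
        using diff[OF inS[OF that]] frechet_derivative_works by blast
      have "((\<lambda>s. x + s *\<^sub>R v + r *\<^sub>R w) has_derivative (\<lambda>h. h *\<^sub>R v)) (at s)"
        by (auto intro!: derivative_eq_intros)
      from has_derivative_compose[OF this f]
      show ?thesis unfolding has_field_derivative_def F_def
        by (simp add: linear_scale[OF has_derivative_linear[OF f]] mult.commute[of _ "frechet_derivative _ _ _"])
    qed
    have "\<exists>\<theta>. 0 < \<theta> \<and> \<theta> < t \<and> \<phi> t - \<phi> 0 = (t - 0) * (F (x + \<theta> *\<^sub>R v + t *\<^sub>R w) - F (x + \<theta> *\<^sub>R v + 0 *\<^sub>R w))"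
      unfolding \<phi>_def using t by (intro MVT2 DERIV_diff D) auto
    then obtain \<theta> where \<theta>: "0 < \<theta>" "\<theta> < t"
      and mvt: "\<phi> t - \<phi> 0 = t * (F (x + \<theta> *\<^sub>R v + t *\<^sub>R w) - F (x + \<theta> *\<^sub>R v + 0 *\<^sub>R w))" by auto
    have approx: "\<bar>F (x + \<theta> *\<^sub>R v + r *\<^sub>R w) - F x - A (\<theta> *\<^sub>R v + r *\<^sub>R w)\<bar> \<le> e' * (t * K)"
      if "0 \<le> r" "r \<le> t" for r
    proof -
      have n: "norm (\<theta> *\<^sub>R v + r *\<^sub>R w) \<le> t * K" using small[of \<theta> r] \<theta> that by simp
      then have "norm (F (x + \<theta> *\<^sub>R v + r *\<^sub>R w) - F x - A (\<theta> *\<^sub>R v + r *\<^sub>R w)) \<le> e' * norm (\<theta> *\<^sub>R v + r *\<^sub>R w)"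
        using \<delta>2(2)[of "x + \<theta> *\<^sub>R v + r *\<^sub>R w"] tK by (simp add: add.assoc)
      also have "\<dots> \<le> e' * (t * K)" using n e' by (intro mult_left_mono) auto
      finally show ?thesis by simp
    qed
    have "A (\<theta> *\<^sub>R v + t *\<^sub>R w) - A (\<theta> *\<^sub>R v + 0 *\<^sub>R w) = t * A w"
      using lin by (simp add: linear_add linear_scale)
    then have "\<bar>F (x + \<theta> *\<^sub>R v + t *\<^sub>R w) - F (x + \<theta> *\<^sub>R v + 0 *\<^sub>R w) - t * A w\<bar> \<le> 2 * (e' * (t * K))"
      using approx[of t] approx[of 0] t by linarith
    then have "\<bar>(\<phi> t - \<phi> 0) / t\<^sup>2 - A w\<bar> \<le> 2 * e' * K"
    proof -
      assume *: "\<bar>F (x + \<theta> *\<^sub>R v + t *\<^sub>R w) - F (x + \<theta> *\<^sub>R v + 0 *\<^sub>R w) - t * A w\<bar> \<le> 2 * (e' * (t * K))"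
      have "(\<phi> t - \<phi> 0) / t\<^sup>2 - A w =
          (F (x + \<theta> *\<^sub>R v + t *\<^sub>R w) - F (x + \<theta> *\<^sub>R v + 0 *\<^sub>R w) - t * A w) / t"
        unfolding mvt using t by (simp add: power2_eq_square diff_divide_distrib)
      then have "\<bar>(\<phi> t - \<phi> 0) / t\<^sup>2 - A w\<bar> =
          \<bar>F (x + \<theta> *\<^sub>R v + t *\<^sub>R w) - F (x + \<theta> *\<^sub>R v + 0 *\<^sub>R w) - t * A w\<bar> / t"
        using t by (simp add: abs_divide)
      also have "\<dots> \<le> 2 * (e' * (t * K)) / t" using * t by (intro divide_right_mono) auto
      finally show ?thesis using t by simp
    qed
    also have "2 * e' * K < e"
    proof -
      have "2 * e' * K = e * (K / (2 * K + 1))" 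
        using K by (simp add: e'_def divide_simps)
      also have "\<dots> < e * 1" using e K by (intro mult_strict_left_mono) (auto simp: field_simps)
      finally show ?thesis by simp
    qed
    finally show ?thesis by (simp add: \<phi>_def dist_real_def algebra_simps)
  qed
  show "eventually (\<lambda>t. dist ((f (x + t *\<^sub>R v + t *\<^sub>R w) - f (x + t *\<^sub>R v) - f (x + t *\<^sub>R w) + f x) / t\<^sup>2) (A w) < e) (at_right 0)"
    using eventually_at_right_real[OF \<delta>] by eventually_elim (use main in auto)
qed

lemma second_derivative_symmetric:
  fixes f :: "real ^ 'n \<Rightarrow> real"
  assumes S: "open S" "x \<in> S" and diff: "\<And>y. y \<in> S \<Longrightarrow> f differentiable (at y)"
    and H: "(grad f has_derivative H) (at x)"
  shows "H v \<bullet> w = H w \<bullet> v"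
proof -
  have D: "((\<lambda>y. frechet_derivative f (at y) u) has_derivative (\<lambda>h. H h \<bullet> u)) (at x)" for u
  proof (rule has_derivative_transform_within_open[OF _ S])
    show "((\<lambda>y. grad f y \<bullet> u) has_derivative (\<lambda>h. H h \<bullet> u)) (at x)"
      using H by (auto intro!: derivative_eq_intros)
  qed (simp add: frechet_derivative_eq_grad diff)
  have "H w \<bullet> v = H v \<bullet> w"
  proof (rule tendsto_unique[OF _ second_difference_limit[OF S diff D[of v]]])
    show "((\<lambda>t. (f (x + t *\<^sub>R v + t *\<^sub>R w) - f (x + t *\<^sub>R v) - f (x + t *\<^sub>R w) + f x) / t\<^sup>2) \<longlongrightarrow> H v \<bullet> w) (at_right 0)"
      using second_difference_limit[OF S diff D[of w], of v] by (simp add: algebra_simps)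
  qed simp
  then show ?thesis by simp
qed

text \<open>The second derivatives of \<open>f\<close> cancel in a commutator of vector fields.\<close>

lemma commutator:
  fixes f :: "real ^ 'n \<Rightarrow> real"
  assumes S: "open S" "x \<in> S" and diff: "\<And>y. y \<in> S \<Longrightarrow> f differentiable (at y)"
    and H: "grad f differentiable (at x)"
    and V: "(V has_derivative V') (at x)" and W: "(W has_derivative W') (at x)"
  shows "frechet_derivative (\<lambda>y. grad f y \<bullet> W y) (at x) (V x) -
      frechet_derivative (\<lambda>y. grad f y \<bullet> V y) (at x) (W x) = grad f x \<bullet> (W' (V x) - V' (W x))"
proof -
  obtain H where H: "(grad f has_derivative H) (at x)" using assms(4) by (auto simp: differentiable_def)
  have "frechet_derivative (\<lambda>y. grad f y \<bullet> U y) (at x) h = grad f x \<bullet> U' h + H h \<bullet> U x"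
    if "(U has_derivative U') (at x)" for U U' h
    using frechet_derivative_at[OF has_derivative_inner[OF H that]] by metis
  then show ?thesis
    using V W second_derivative_symmetric[OF S diff H, of "V x" "W x"]
    by (simp add: inner_diff_right)
qed

section \<open>The horizontal gradient of the gauge\<close>

text \<open>Where \<open>h\<close> vanishes but its gradient does not, the coarea formula sees a single slice.\<close>

lemma grad_eq_0_AE_on_zero_set:
  fixes h :: "real ^ 'n \<Rightarrow> real"
  assumes W: "open W" and diff: "\<And>y. y \<in> W \<Longrightarrow> h differentiable (at y)"
    and cont: "continuous_on W (grad h)"
  shows "AE x in lborel. x \<in> W \<longrightarrow> h x = 0 \<longrightarrow> grad h x = 0"
proof -
  fix j :: 'n
  define W' where "W' = {x \<in> W. grad h x \<noteq> 0}"
  have W': "open W'"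
  proof -
    have "W' = W \<inter> grad h -` (- {0})" by (auto simp: W'_def)
    then show ?thesis using continuous_open_preimage[OF cont W, of "- {0}"] by auto
  qed
  have diff': "\<And>y. y \<in> W' \<Longrightarrow> h differentiable (at y)" and cont': "continuous_on W' (grad h)"
    and nz': "\<And>y. y \<in> W' \<Longrightarrow> grad h y \<noteq> 0"
    using diff cont by (auto simp: W'_def intro: continuous_on_subset)
  define A where "A = {y \<in> W'. h y = 0}"
  have A[measurable]: "A \<in> sets borel" unfolding A_def by (rule level_set_borel[OF W' diff'])
  note [measurable] = grad_density_measurable[OF W' cont']
  have "(\<integral>\<^sup>+s. hausdorff_outer (CARD('n) - 1) (A \<inter> {y. h y = s}) \<partial>lborel) = (\<integral>\<^sup>+(s::real). 0 \<partial>lborel)"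
  proof (rule nn_integral_cong_AE)
    show "AE s in lborel. hausdorff_outer (CARD('n) - 1) (A \<inter> {y. h y = s}) = 0"
      using AE_lborel_singleton[of "0::real"]
    proof eventually_elim
      case (elim s)
      then have "A \<inter> {y. h y = s} = {}" by (auto simp: A_def)
      then show ?case by simp
    qed
  qed
  then have "face_measure j * emeasure (grad_measure W' h) A = 0"
    using coarea_sets(2)[OF W' diff' cont' nz' A, of j] by (simp add: A_def)
  then have "emeasure (grad_measure W' h) A = 0" using face_measure_pos[of j] by auto
  then have "(\<integral>\<^sup>+y. ennreal (indicator W' y * norm (grad h y)) * indicator A y \<partial>lborel) = 0"
    unfolding grad_measure_def by (subst (asm) emeasure_density) auto
  then have "AE y in lborel. ennreal (indicator W' y * norm (grad h y)) * indicator A y = 0"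
    by (subst (asm) nn_integral_0_iff_AE) auto
  then show ?thesis
    by eventually_elim (auto simp: A_def W'_def indicator_def split: if_splits)
qed

lemma (in carnot_group) left_field_derivative:
  "(m x has_derivative (\<lambda>v. frechet_derivative (m x) (at y) v)) (at y)"
  and left_field_smooth: "smooth_on UNIV (\<lambda>x. left_field m v x $ i)"
proof -
  define G where "G p = m (fst p) (snd p)" for p
  have G: "smooth_on UNIV G" using smooth_mult by (simp add: G_def[abs_def])
  have D: "(m x has_derivative (\<lambda>v. frechet_derivative G (at (x, y)) (0, v))) (at y)" for x y
  proof -
    have "(G has_derivative frechet_derivative G (at (x, y))) (at (x, y))"
      using smooth_on_differentiable[OF G] frechet_derivative_works by blast
    moreover have "((\<lambda>y. (x, y)) has_derivative (\<lambda>v. (0, v))) (at y)"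
      by (auto intro!: derivative_eq_intros)
    ultimately show ?thesis using has_derivative_compose[of "\<lambda>y. (x, y)" _ y UNIV G] by (simp add: G_def)
  qed
  then show "(m x has_derivative (\<lambda>v. frechet_derivative (m x) (at y) v)) (at y)"
    using frechet_derivative_at by (metis (no_types, lifting))
  have eq: "left_field m v x = frechet_derivative G (at (x, 0)) (0, v)" for x v
    unfolding left_field_def using frechet_derivative_at[OF D[of x 0]] by metis
  show "smooth_on UNIV (\<lambda>x. left_field m v x $ i)"
    unfolding smooth_on_def eq
  proof
    fix k
    have "Ck_on k UNIV (\<lambda>p. frechet_derivative G (at p) (0, v))"
      using smooth_on_derivative[OF G] by (simp add: smooth_on_def)
    from Ck_on_comp_affine[OF bounded_linear_vec_nth[of i] _ this, of "\<lambda>x. (x, 0)" 0]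
    show "Ck_on k UNIV (\<lambda>x. frechet_derivative G (at (x, 0)) (0, v) $ i)"
      by (simp add: bounded_linear_Pair bounded_linear_ident bounded_linear_zero)
  qed
qed

context carnot_group
begin

lemma left_field_linear: "linear (\<lambda>v. left_field m v x)"
  unfolding left_field_def using has_derivative_linear[OF left_field_derivative[of x 0]] by simp

lemma left_field_differentiable: "left_field m v differentiable (at x)"
  using smooth_on_differentiable[OF left_field_smooth]
  by (subst differentiable_componentwise_within) (auto simp: Basis_vec_def inner_axis)

lemma left_field_0: "left_field m v 0 = v"
proof -
  have "m 0 = (\<lambda>x. x)" by auto
  then show ?thesis by (simp add: left_field_def)
qed

text \<open>Left-invariance: differentiate \<open>m (m a y) h = m a (m y h)\<close> at \<open>h = 0\<close>.\<close>

lemma left_field_mult: "left_field m v (m a y) = frechet_derivative (m a) (at y) (left_field m v y)"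
proof -
  have "(m y has_derivative (\<lambda>v. left_field m v y)) (at 0)"
    unfolding left_field_def by (rule left_field_derivative)
  moreover have "(m a has_derivative (\<lambda>v. frechet_derivative (m a) (at y) v)) (at (m y 0))"
    using left_field_derivative[of a y] by simp
  ultimately have "((\<lambda>h. m a (m y h)) has_derivative (\<lambda>v. frechet_derivative (m a) (at y) (left_field m v y))) (at 0)"
    by (rule has_derivative_compose)
  then have "(m (m a y) has_derivative (\<lambda>v. frechet_derivative (m a) (at y) (left_field m v y))) (at 0)"
    by (simp add: assoc[symmetric])
  from frechet_derivative_at[OF this] show ?thesis unfolding left_field_def by metis
qed

lemma translation_smooth: "smooth_on UNIV (\<lambda>y. m a y $ i)"
  unfolding smooth_on_def
proof
  fix k
  have "Ck_on k UNIV (\<lambda>p. m (fst p) (snd p))" using smooth_mult by (simp add: smooth_on_def)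
  from Ck_on_comp_affine[OF bounded_linear_vec_nth[of i] _ this, of "\<lambda>x. (0, x)" "(a, 0)"]
  show "Ck_on k UNIV (\<lambda>y. m a y $ i)"
    by (simp add: bounded_linear_Pair bounded_linear_ident bounded_linear_zero)
qed

text \<open>A commutator of left-invariant fields is left-invariant: differentiate
  \<open>left_field_mult\<close> at the unit and apply \<open>commutator\<close> to the components of the translation.\<close>

lemma left_field_bracket:
  "left_field m (lie_bracket m v w) a =
    frechet_derivative (left_field m w) (at a) (left_field m v a) -
    frechet_derivative (left_field m v) (at a) (left_field m w a)"
proof (rule vec_eq_iff[THEN iffD2], rule allI)
  fix i
  define f where "f y = m a y $ i" for y
  have f: "smooth_on UNIV f" unfolding f_def by (rule translation_smooth)
  have D: "(left_field m u has_derivative frechet_derivative (left_field m u) (at x)) (at x)" for u x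
    using left_field_differentiable frechet_derivative_works by blast
  have comp: "frechet_derivative (m a) (at y) h $ i = grad f y \<bullet> h" for y h
  proof -
    have "(f has_derivative (\<lambda>h. frechet_derivative (m a) (at y) h $ i)) (at y)"
      unfolding f_def by (rule bounded_linear.has_derivative[OF bounded_linear_vec_nth left_field_derivative])
    from fun_cong[OF frechet_derivative_at[OF this], of h] show ?thesis
      by (simp add: frechet_derivative_eq_grad[OF smooth_on_differentiable[OF f]])
  qed
  have inv: "frechet_derivative (\<lambda>y. grad f y \<bullet> left_field m u y) (at 0) h =
      frechet_derivative (left_field m u) (at a) (left_field m h a) $ i" for u h
  proof -
    have "(m a has_derivative (\<lambda>v. left_field m v a)) (at 0)"
      unfolding left_field_def by (rule left_field_derivative)
    moreover have "(left_field m u has_derivative frechet_derivative (left_field m u) (at a)) (at (m a 0))"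
      using D[of u a] by simp
    ultimately have "((\<lambda>y. left_field m u (m a y)) has_derivative
        (\<lambda>h. frechet_derivative (left_field m u) (at a) (left_field m h a))) (at 0)"
      by (rule has_derivative_compose)
    then have "((\<lambda>y. left_field m u (m a y) $ i) has_derivative
        (\<lambda>h. frechet_derivative (left_field m u) (at a) (left_field m h a) $ i)) (at 0)"
      by (rule bounded_linear.has_derivative[OF bounded_linear_vec_nth])
    from fun_cong[OF frechet_derivative_at[OF this], of h] show ?thesis
      by (simp add: left_field_mult comp)
  qed
  have "left_field m (lie_bracket m v w) a $ i = grad f 0 \<bullet> lie_bracket m v w"
    by (simp add: left_field_def comp)
  also have "\<dots> = frechet_derivative (\<lambda>y. grad f y \<bullet> left_field m w y) (at 0) v -
      frechet_derivative (\<lambda>y. grad f y \<bullet> left_field m v y) (at 0) w"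
    using commutator[OF open_UNIV UNIV_I smooth_on_differentiable[OF f] smooth_on_grad_differentiable[OF f] D[of v 0] D[of w 0]]
    by (simp add: left_field_0 lie_bracket_def)
  finally show "left_field m (lie_bracket m v w) a $ i =
     (frechet_derivative (left_field m w) (at a) (left_field m v a) -
      frechet_derivative (left_field m v) (at a) (left_field m w a)) $ i"
    by (simp add: inv)
qed

text \<open>The derivatives of the mutually inverse translations by \<open>x\<close> and \<open>\<iota> x\<close> are inverse to each
other.\<close>

lemma left_field_surj: "\<exists>u. left_field m u x = v"
proof -
  define u where "u = frechet_derivative (m (\<iota> x)) (at x) v"
  have "(m (\<iota> x) has_derivative (\<lambda>v. frechet_derivative (m (\<iota> x)) (at x) v)) (at x)"
    by (rule left_field_derivative)
  moreover have "(m x has_derivative (\<lambda>v. left_field m v x)) (at (m (\<iota> x) x))"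
    using left_field_derivative[of x 0] by (simp add: left_field_def)
  ultimately have "((\<lambda>y. m x (m (\<iota> x) y)) has_derivative
      (\<lambda>v. left_field m (frechet_derivative (m (\<iota> x)) (at x) v) x)) (at x)"
    by (rule has_derivative_compose)
  moreover have "(\<lambda>y. m x (m (\<iota> x) y)) = (\<lambda>y. y)" by (simp add: assoc[symmetric])
  ultimately have "(\<lambda>v. left_field m (frechet_derivative (m (\<iota> x)) (at x) v) x) = (\<lambda>v. v)"
    using has_derivative_unique[OF _ has_derivative_ident] by metis
  then show ?thesis by metis
qed

text \<open>Euler's relation: the derivative of \<open>\<rho>\<close> along the dilation orbit of \<open>x\<close> is \<open>\<rho> x\<close>.\<close>

lemma grad_homogeneous_norm_nonzero:
  assumes \<rho>: "homogeneous_norm d \<rho>" and x: "x \<noteq> 0"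
  shows "grad \<rho> x \<noteq> 0"
proof
  assume g0: "grad \<rho> x = 0"
  have "(\<rho> has_derivative (\<lambda>v. grad \<rho> x \<bullet> v)) (at x)"
    using \<rho> x by (intro has_derivative_grad smooth_on_differentiable[of "- {0}"]) (auto simp: homogeneous_norm_def)
  then have "(\<rho> has_derivative (\<lambda>v. 0)) (at (dilation d 1 x))"
    by (simp add: g0 dilation_def)
  moreover have "((\<lambda>s. dilation d s x) has_derivative (\<lambda>h. \<chi> j. h * (real (d j) * 1 ^ (d j - 1)) * x $ j)) (at 1)"
    unfolding dilation_def
    by (subst has_derivative_componentwise_within)
      (auto simp: Basis_vec_def inner_axis intro!: derivative_eq_intros)
  ultimately have "((\<lambda>s. \<rho> (dilation d s x)) has_derivative (\<lambda>h. 0)) (at 1)"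
    using has_derivative_compose[of "\<lambda>s. dilation d s x" _ 1 UNIV \<rho> "\<lambda>v. 0"] by simp
  then have "((\<lambda>s. s * \<rho> x) has_derivative (\<lambda>h. 0)) (at 1)"
    by (rule has_derivative_transform_within_open[of _ _ _ _ "{0<..}"])
      (use \<rho> in \<open>auto simp: homogeneous_norm_def\<close>)
  moreover have "((\<lambda>s. s * \<rho> x) has_derivative (\<lambda>h. h * \<rho> x)) (at 1)"
    by (auto intro!: derivative_eq_intros)
  ultimately have "(\<lambda>h. 0) = (\<lambda>h. h * \<rho> x)" by (rule has_derivative_unique)
  then have "\<rho> x = 0" by (metis mult_1)
  with \<rho> x show False by (simp add: homogeneous_norm_def)
qed

text \<open>On the set where the horizontal derivatives of a smooth function \<open>f\<close> vanish, the derivatives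
  along all left-invariant fields vanish almost everywhere: a smooth function has zero gradient at
  almost every zero, so the property passes to commutators, which generate the Lie algebra.\<close>

lemma left_derivatives_vanish_AE:
  assumes S: "open S" and f: "smooth_on S f"
    and hor: "\<And>j. d j = 1 \<Longrightarrow> AE x in lborel. x \<in> S \<longrightarrow> Z x \<longrightarrow> left_deriv m j f x = 0"
  shows "AE x in lborel. x \<in> S \<longrightarrow> Z x \<longrightarrow> grad f x = 0"
proof -
  define P where "P v x = grad f x \<bullet> left_field m v x" for v x
  define N where "N = {v. AE x in lborel. x \<in> S \<longrightarrow> Z x \<longrightarrow> P v x = 0}"
  have P_smooth: "smooth_on S (P v)" for v
    unfolding smooth_on_def P_def inner_vec_def inner_real_def
  proof (intro allI Ck_on_sum[OF S] Ck_on_mult[OF S])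
    fix k and i :: 'n
    show "Ck_on k S (\<lambda>x. grad f x $ i)"
      using smooth_on_derivative[OF f] by (simp add: grad_def smooth_on_def)
    show "Ck_on k S (\<lambda>x. left_field m v x $ i)"
      using left_field_smooth Ck_on_subset by (metis smooth_on_def subset_UNIV)
  qed simp
  have sub: "subspace N"
    unfolding subspace_def
  proof (intro conjI ballI allI)
    show "0 \<in> N" using linear_0[OF left_field_linear] by (simp add: N_def P_def)
  next
    fix v w assume "v \<in> N" "w \<in> N"
    then have "AE x in lborel. x \<in> S \<longrightarrow> Z x \<longrightarrow> P v x = 0" "AE x in lborel. x \<in> S \<longrightarrow> Z x \<longrightarrow> P w x = 0"
      by (auto simp: N_def)
    then have "AE x in lborel. x \<in> S \<longrightarrow> Z x \<longrightarrow> P (v + w) x = 0"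
      by eventually_elim (auto simp: P_def linear_add[OF left_field_linear] inner_add_right)
    then show "v + w \<in> N" by (simp add: N_def)
  next
    fix c v assume "v \<in> N"
    then have "AE x in lborel. x \<in> S \<longrightarrow> Z x \<longrightarrow> P v x = 0" by (auto simp: N_def)
    then have "AE x in lborel. x \<in> S \<longrightarrow> Z x \<longrightarrow> P (c *\<^sub>R v) x = 0"
      by eventually_elim (auto simp: P_def linear_scale[OF left_field_linear])
    then show "c *\<^sub>R v \<in> N" by (simp add: N_def)
  qed
  have left_deriv_eq: "left_deriv m j f x = P (axis j 1) x" if "x \<in> S" for j x
    using frechet_derivative_eq_grad[OF smooth_on_differentiable[OF f that]]
    by (simp add: left_deriv_def P_def)
  have grad_P: "AE x in lborel. x \<in> S \<longrightarrow> Z x \<longrightarrow> grad (P v) x = 0" if "v \<in> N" for v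
  proof -
    have "AE x in lborel. x \<in> S \<longrightarrow> P v x = 0 \<longrightarrow> grad (P v) x = 0"
      using smooth_on_differentiable[OF P_smooth] smooth_on_grad_continuous[OF P_smooth]
      by (intro grad_eq_0_AE_on_zero_set[OF S]) auto
    moreover have "AE x in lborel. x \<in> S \<longrightarrow> Z x \<longrightarrow> P v x = 0" using that by (simp add: N_def)
    ultimately show ?thesis by eventually_elim auto
  qed
  have bracket: "lie_bracket m v w \<in> N" if v: "v \<in> N" and w: "w \<in> N" for v w
  proof -
    have "P (lie_bracket m v w) x =
        frechet_derivative (P w) (at x) (left_field m v x) - frechet_derivative (P v) (at x) (left_field m w x)"
      if x: "x \<in> S" for x
    proof -
      have D: "(left_field m u has_derivative frechet_derivative (left_field m u) (at x)) (at x)" for u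
        using left_field_differentiable frechet_derivative_works by blast
      show ?thesis
        using commutator[OF S x smooth_on_differentiable[OF f] smooth_on_grad_differentiable[OF f x] D[of v] D[of w]]
        by (simp add: P_def[abs_def] left_field_bracket)
    qed
    then have eq: "P (lie_bracket m v w) x = grad (P w) x \<bullet> left_field m v x - grad (P v) x \<bullet> left_field m w x"
      if "x \<in> S" for x
      using that frechet_derivative_eq_grad[OF smooth_on_differentiable[OF P_smooth that]] by simp
    from grad_P[OF v] grad_P[OF w]
    have "AE x in lborel. x \<in> S \<longrightarrow> Z x \<longrightarrow> P (lie_bracket m v w) x = 0"
      by eventually_elim (auto simp: eq)
    then show ?thesis by (simp add: N_def)
  qed
  have layer1: "layer d 1 \<subseteq> N"
    unfolding layer_def
  proof (rule span_minimal[OF _ sub], clarify)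
    fix j assume "d j = 1"
    from hor[OF this] show "axis j 1 \<in> N"
      unfolding N_def mem_Collect_eq by eventually_elim (auto simp: left_deriv_eq)
  qed
  have layers: "layer d (Suc i) \<subseteq> N" for i
  proof (induction i)
    case (Suc i)
    have "{lie_bracket m v w | v w. v \<in> layer d 1 \<and> w \<in> layer d (Suc i)} \<subseteq> N"
      using layer1 Suc bracket by blast
    then have "span {lie_bracket m v w | v w. v \<in> layer d 1 \<and> w \<in> layer d (Suc i)} \<subseteq> N"
      by (rule span_minimal[OF _ sub])
    then show ?case using stratified[of "Suc i"] by simp
  qed (use layer1 in simp)
  have axis: "axis j 1 \<in> N" for j
  proof -
    obtain i where i: "d j = Suc i" using weight_pos[of j] by (cases "d j") auto
    have "axis j 1 \<in> layer d (d j)" unfolding layer_def by (rule span_base) auto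
    then show ?thesis using layers[of i] i by auto
  qed
  then have "AE x in lborel. \<forall>j. x \<in> S \<longrightarrow> Z x \<longrightarrow> P (axis j 1) x = 0"
    by (subst AE_all_countable) (auto simp: N_def)
  then show ?thesis
  proof eventually_elim
    case (elim x)
    show ?case
    proof (intro impI)
      assume x: "x \<in> S" "Z x"
      obtain u where u: "left_field m u x = grad f x" using left_field_surj by blast
      have lin: "linear (\<lambda>v. P v x)"
        unfolding P_def by (rule linearI) (simp_all add: linear_add[OF left_field_linear]
            linear_scale[OF left_field_linear] inner_add_right)
      have "P u x = P (\<Sum>i\<in>UNIV. u $ i *\<^sub>R axis i 1) x"
        by (simp add: basis_expansion scalar_mult_eq_scaleR[symmetric])
      also have "\<dots> = 0" using elim x by (simp add: linear_sum[OF lin] linear_scale[OF lin])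
      finally show "grad f x = 0" by (simp add: P_def u)
    qed
  qed
qed

text \<open>Almost every zero of the horizontal gradient is a zero of the Euclidean gradient, which has none
outside the origin.\<close>

lemma hgrad_homogeneous_norm_nonzero_AE:
  assumes \<rho>: "homogeneous_norm d \<rho>"
  shows "AE x in lborel. x \<noteq> 0 \<longrightarrow> hgrad m d \<rho> x \<noteq> 0"
proof -
  have "AE x in lborel. x \<in> - {0} \<longrightarrow> hgrad m d \<rho> x = 0 \<longrightarrow> grad \<rho> x = 0"
  proof (rule left_derivatives_vanish_AE)
    show "smooth_on (- {0}) \<rho>" using \<rho> by (simp add: homogeneous_norm_def)
    have "left_deriv m j \<rho> x = 0" if "d j = 1" "hgrad m d \<rho> x = 0" for j x
      using arg_cong[OF that(2), of "\<lambda>v. v $ j"] that(1) by (simp add: hgrad_def)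
    then show "AE x in lborel. x \<in> - {0} \<longrightarrow> hgrad m d \<rho> x = 0 \<longrightarrow> left_deriv m j \<rho> x = 0" if "d j = 1" for j
      using that by auto
  qed auto
  then show ?thesis
    by eventually_elim (use grad_homogeneous_norm_nonzero[OF \<rho>] in auto)
qed

end

section \<open>Gauge balls\<close>

lemma homogeneous_normD:
  assumes "homogeneous_norm d \<rho>"
  shows "continuous_on UNIV \<rho>" "smooth_on (- {0}) \<rho>" "0 \<le> \<rho> x" "\<rho> x = 0 \<longleftrightarrow> x = 0"
    "0 < s \<Longrightarrow> \<rho> (dilation d s x) = s * \<rho> x"
  using assms by (auto simp: homogeneous_norm_def)

lemma continuous_dilation: "continuous_on A (\<lambda>s. dilation d s x)"
  unfolding dilation_def by (intro continuous_on_vec_lambda continuous_intros)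

text \<open>A point with \<open>\<rho> y = r\<close> is the limit of its contractions \<open>dilation d s y\<close> as \<open>s\<close> increases to \<open>1\<close>.\<close>

lemma frontier_sublevel_homogeneous_norm:
  assumes \<rho>: "homogeneous_norm d \<rho>" and r: "0 < r"
  shows "frontier {y. \<rho> y < r} = {y. \<rho> y = r}"
proof -
  note \<rho>' = homogeneous_normD[OF \<rho>]
  have op: "open {y. \<rho> y < r}" by (intro open_Collect_less \<rho>' continuous_intros)
  have cl: "closed {y. \<rho> y \<le> r}" by (intro closed_Collect_le \<rho>' continuous_intros)
  have "closure {y. \<rho> y < r} \<subseteq> {y. \<rho> y \<le> r}" by (rule closure_minimal[OF _ cl]) auto
  moreover have "y \<in> closure {y. \<rho> y < r}" if y: "\<rho> y = r" for y
  proof (rule Lim_in_closed_set[OF closed_closure])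
    have "isCont (\<lambda>s. dilation d s y) 1"
      using continuous_dilation[of UNIV d y] by (simp add: continuous_on_eq_continuous_at)
    moreover have "dilation d 1 y = y" by (simp add: dilation_def)
    ultimately show "((\<lambda>s. dilation d s y) \<longlongrightarrow> y) (at_left 1)"
      by (metis isContD filterlim_at_split)
    show "eventually (\<lambda>s. dilation d s y \<in> closure {y. \<rho> y < r}) (at_left 1)"
      using eventually_at_left_real[of 0 "1::real", OF zero_less_one]
    proof eventually_elim
      case (elim s)
      then have "\<rho> (dilation d s y) < r" using \<rho>'(5)[of s y] y r by simp
      then show ?case using closure_subset[of "{y. \<rho> y < r}"] by auto
    qed
  qed simp
  ultimately show ?thesis unfolding frontier_def interior_open[OF op] by force
qed

text \<open>The dilation orbit of a point \<open>y\<close> of norm at least \<open>e\<close> meets the sphere of radius \<open>e\<close> for a parameter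
\<open>s \<le> 1\<close>, and there \<open>\<rho>\<close> is at most \<open>\<rho> y\<close>. So the positive minimum of \<open>\<rho>\<close> on the sphere is a lower
bound for \<open>\<rho> y\<close>.\<close>

lemma homogeneous_norm_small_imp_norm_small:
  assumes \<rho>: "homogeneous_norm d \<rho>" and d: "\<And>j. 1 \<le> d j" and e: "0 < e"
  obtains \<delta> where "0 < \<delta>" "\<And>y. \<rho> y < \<delta> \<Longrightarrow> norm y < e"
proof -
  note \<rho>' = homogeneous_normD[OF \<rho>]
  have "sphere (0 :: real ^ 'n) e \<noteq> {}" using e by simp
  then obtain z where z: "z \<in> sphere 0 e" "\<And>y. y \<in> sphere 0 e \<Longrightarrow> \<rho> z \<le> \<rho> y"
    using continuous_attains_inf[OF compact_sphere, of 0 e \<rho>] continuous_on_subset[OF \<rho>'(1)] by blast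
  have "z \<noteq> 0" using z e by auto
  then have pos: "0 < \<rho> z" using \<rho>'(3)[of z] \<rho>'(4)[of z] by linarith
  have "norm y < e" if y: "\<rho> y < \<rho> z" for y
  proof (rule ccontr)
    assume "\<not> norm y < e"
    moreover have "d i \<noteq> 0" for i using d[of i] by simp
    then have "dilation d 0 y = 0" "dilation d 1 y = y"
      by (auto simp: dilation_def vec_eq_iff)
    ultimately have "\<exists>s\<ge>0. s \<le> 1 \<and> norm (dilation d s y) = e"
      using e by (intro IVT' continuous_on_norm continuous_dilation) auto
    then obtain s where s: "0 \<le> s" "s \<le> 1" "norm (dilation d s y) = e" by blast
    have "s \<noteq> 0" using s(3) e \<open>dilation d 0 y = 0\<close> by auto
    then have "\<rho> (dilation d s y) = s * \<rho> y" using \<rho>'(5) s by simp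
    also have "\<dots> \<le> 1 * \<rho> y" using s \<rho>'(3) by (intro mult_right_mono) auto
    finally have "\<rho> (dilation d s y) < \<rho> z" using y by simp
    moreover have "\<rho> z \<le> \<rho> (dilation d s y)" using s by (intro z(2)) simp
    ultimately show False by simp
  qed
  with pos show thesis by (rule that)
qed

context carnot_group
begin

lemma continuous_translation: "continuous_on UNIV (m a)"
  using left_field_derivative[of a]
  by (auto intro!: continuous_at_imp_continuous_on has_derivative_continuous)

lemma translation_measurable [measurable]: "m a \<in> borel_measurable borel"
  using continuous_translation by (rule borel_measurable_continuous_onI)

lemma gauge_ball_0: "gauge_ball m \<iota> \<rho> 0 r = {y. \<rho> y < r}"
  by (simp add: gauge_ball_def inverse_neutral)

lemma mem_gauge_ball_translate: "m a y \<in> gauge_ball m \<iota> \<rho> a r \<longleftrightarrow> \<rho> y < r"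
  by (simp add: gauge_ball_def assoc[symmetric])

lemma gauge_ball_small:
  assumes \<rho>: "homogeneous_norm d \<rho>" and e: "0 < e"
  obtains \<delta> where "0 < \<delta>" "gauge_ball m \<iota> \<rho> x\<^sub>0 \<delta> \<subseteq> cball x\<^sub>0 e"
proof -
  have "isCont (m x\<^sub>0) 0" using continuous_translation by (simp add: continuous_on_eq_continuous_at)
  then obtain \<epsilon> where \<epsilon>: "0 < \<epsilon>" "\<And>y. dist y 0 < \<epsilon> \<Longrightarrow> dist (m x\<^sub>0 y) (m x\<^sub>0 0) < e"
    using e unfolding continuous_at_eps_delta by metis
  obtain \<delta> where \<delta>: "0 < \<delta>" "\<And>y. \<rho> y < \<delta> \<Longrightarrow> norm y < \<epsilon>"
    using homogeneous_norm_small_imp_norm_small[OF \<rho> weight_pos \<epsilon>(1)] by blast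
  have "gauge_ball m \<iota> \<rho> x\<^sub>0 \<delta> \<subseteq> cball x\<^sub>0 e"
  proof
    fix y assume "y \<in> gauge_ball m \<iota> \<rho> x\<^sub>0 \<delta>"
    then have "norm (m (\<iota> x\<^sub>0) y) < \<epsilon>" by (intro \<delta>) (simp add: gauge_ball_def)
    then have "dist (m x\<^sub>0 (m (\<iota> x\<^sub>0) y)) (m x\<^sub>0 0) < e" by (intro \<epsilon>) simp
    then show "y \<in> cball x\<^sub>0 e" by (simp add: assoc[symmetric] dist_commute)
  qed
  with \<delta>(1) show thesis by (rule that)
qed

lemma AE_translate:
  assumes "AE x in lborel. P x"
  shows "AE x in lborel. P (m a x)"
proof -
  obtain N where N: "N \<in> null_sets lborel" "{x. \<not> P x} \<subseteq> N"
    using assms by (auto simp: eventually_ae_filter)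
  then have [measurable]: "N \<in> sets borel" by (auto simp: null_sets_def)
  have "emeasure lborel (m a -` N) = emeasure (distr lborel borel (m a)) N"
    by (subst emeasure_distr) auto
  also have "\<dots> = 0" using N by (simp add: haar null_sets_def)
  finally have "m a -` N \<in> null_sets lborel"
    using measurable_sets_borel[OF translation_measurable, of N a] by (auto simp: null_sets_def)
  then show ?thesis by (rule AE_I') (use N in auto)
qed

lemma nn_integral_translate:
  "f \<in> borel_measurable borel \<Longrightarrow> (\<integral>\<^sup>+x. f x \<partial>lborel) = (\<integral>\<^sup>+y. f (m a y) \<partial>lborel)"
  using nn_integral_distr[of "m a" lborel borel f] by (simp add: haar)

end

section \<open>Energy integrals as integrals of mean values\<close>

text \<open>A weak gradient is only Lebesgue measurable, so its restriction to a level set may fail to be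
measurable for the surface measure. Replacing it by a Borel function repairs this: the coarea formula
shows that the exceptional null set is negligible on almost every level set.\<close>

lemma weak_hgrad_borel_version:
  assumes K: "compact K" "K \<subseteq> \<Omega>"
  obtains G :: "real ^ 'n \<Rightarrow> real" where "G \<in> borel_measurable borel" 
    "AE x in lborel. x \<in> K \<longrightarrow> (norm (weak_hgrad m d \<Omega> f x))\<^sup>2 = G x"
proof -
  define w where "w = weak_hgrad m d \<Omega> f"
  have comp: "(\<lambda>x. indicator K x *\<^sub>R (w x $ j)) \<in> borel_measurable lebesgue" for j
  proof (cases "\<exists>g. has_weak_hgrad m d \<Omega> f g")
    case True
    then have w: "has_weak_hgrad m d \<Omega> f w"
      unfolding w_def weak_hgrad_def using someI_ex[OF True] by simp
    show ?thesis
    proof (cases "d j = 1")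
      case True
      then have "(\<lambda>x. w x $ j) absolutely_integrable_on K"
        using w K unfolding has_weak_hgrad_def locally_integrable_on_def by blast
      then show ?thesis unfolding set_integrable_def by (rule borel_measurable_integrable)
    next
      case False
      then show ?thesis using w by (simp add: has_weak_hgrad_def)
    qed
  qed (simp add: w_def weak_hgrad_def)
  have "(\<lambda>x. \<Sum>j\<in>UNIV. (indicator K x *\<^sub>R (w x $ j))\<^sup>2) \<in> borel_measurable lebesgue"
    by (intro borel_measurable_sum borel_measurable_power comp)
  then obtain G where G: "G \<in> borel_measurable lborel"
    "AE x in lborel. (\<Sum>j\<in>UNIV. (indicator K x *\<^sub>R (w x $ j))\<^sup>2) = G x"
    using completion_ex_borel_measurable_real by blast
  have "AE x in lborel. x \<in> K \<longrightarrow> (norm (w x))\<^sup>2 = G x"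
    using G(2) by eventually_elim (auto simp: norm_vec_def L2_set_def sum_nonneg)
  then show thesis using that G(1) unfolding w_def by simp
qed

lemma derivatives_of_radial_power:
  fixes \<rho> :: "real ^ 'n \<Rightarrow> real"
  assumes \<rho>: "\<rho> differentiable (at y)" "continuous_on UNIV \<rho>" "0 < \<rho> y"
    and F: "\<And>x. x \<noteq> 0 \<Longrightarrow> F x = c * \<rho> x powr a" and y: "y \<noteq> 0"
  shows "grad F y = (c * a * \<rho> y powr (a - 1)) *\<^sub>R grad \<rho> y"
    and "hgrad m d F y = (c * a * \<rho> y powr (a - 1)) *\<^sub>R hgrad m d \<rho> y"
proof -
  define b where "b = c * a * \<rho> y powr (a - 1)"
  have D: "((\<lambda>x. c * \<rho> x powr a) has_derivative (\<lambda>v. b * frechet_derivative \<rho> (at y) v)) (at y)"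
  proof -
    have "((\<lambda>t. c * t powr a) has_real_derivative b) (at (\<rho> y))"
      unfolding b_def using \<rho>(3) by (auto intro!: derivative_eq_intros)
    then have "((\<lambda>t. c * t powr a) has_derivative (\<lambda>h. b * h)) (at (\<rho> y))"
      by (simp add: has_field_derivative_def)
    moreover have "(\<rho> has_derivative frechet_derivative \<rho> (at y)) (at y)"
      using \<rho>(1) frechet_derivative_works by blast
    ultimately show ?thesis using has_derivative_compose by blast
  qed
  have "(F has_derivative (\<lambda>v. b * frechet_derivative \<rho> (at y) v)) (at y)"
    by (rule has_derivative_transform_within_open[OF D, of "- {0}"]) (use y F in auto)
  from frechet_derivative_at[OF this]
  have F': "frechet_derivative F (at y) v = b * frechet_derivative \<rho> (at y) v" for v by metis
  show "grad F y = b *\<^sub>R grad \<rho> y" "hgrad m d F y = b *\<^sub>R hgrad m d \<rho> y"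
    by (simp_all add: grad_def hgrad_def left_deriv_def F' vec_eq_iff)
qed

text \<open>With \<open>h = |w|\<^sup>2 / |grad \<rho>|\<close>, transported to the unit, and \<open>M s\<close> its integral over \<open>\<rho> = s\<close>, the
coarea formula turns the energy into a constant times the integral of \<open>c s\<^bsup>2-Q\<^esup> M s\<close>, and the mean
value at \<open>s\<close> is \<open>F s = c (Q - 2) s\<^bsup>1-Q\<^esup> M s\<close>; so the energy integrand is \<open>s F s / (Q - 2)\<close>. The
horizontal gradient of \<open>\<rho>\<close> has to be nonzero almost everywhere here: at its zeros the averaged
quotient and the kernel are both \<open>0\<close>, whatever the contribution to the energy is.\<close>

lemma (in carnot_group) energy_eq_integral_of_mean_values:
  fixes \<Gamma> :: "real ^ 'n \<Rightarrow> real ^ 'n \<Rightarrow> real" and v :: "real ^ 'n \<Rightarrow> real"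
  assumes \<rho>: "homogeneous_norm d \<rho>" and Q: "2 < Q" and c: "0 < c"
    and \<Gamma>: "\<And>x y. x \<noteq> y \<Longrightarrow> \<Gamma> x y = c * \<rho> (m (\<iota> x) y) powr (2 - Q)"
    and \<delta>: "gauge_ball m \<iota> \<rho> x\<^sub>0 \<delta> \<subseteq> K" and K: "compact K" "K \<subseteq> \<Omega>"
  defines "w \<equiv> weak_hgrad m d \<Omega> v"
  obtains F C where "F \<in> borel_measurable borel"
    "AE s in lborel. 0 < s \<longrightarrow> s < \<delta> \<longrightarrow> mean_value m \<iota> d \<rho> \<Gamma> s
       (\<lambda>y. ennreal ((norm (w (m x\<^sub>0 y)) / norm (hgrad m d \<rho> y))\<^sup>2)) 0 = F s"
    "\<And>r. 0 < r \<Longrightarrow> r < \<delta> \<Longrightarrow>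
       (\<integral>\<^sup>+\<xi> \<in> gauge_ball m \<iota> \<rho> x\<^sub>0 r. ennreal ((norm (w \<xi>))\<^sup>2 * \<Gamma> x\<^sub>0 \<xi>) \<partial>lebesgue) =
       C * (\<integral>\<^sup>+s \<in> {0<..<r}. ennreal s * F s \<partial>lborel)"
proof -
  define j :: 'n where "j = undefined"
  define W :: "(real ^ 'n) set" where "W = - {0}"
  define H :: "(real ^ 'n) measure" where "H = hausdorff_measure (CARD('n) - 1)"
  note \<rho>' = homogeneous_normD[OF \<rho>]
  have [measurable]: "\<rho> \<in> borel_measurable borel" using \<rho>'(1) by (rule borel_measurable_continuous_onI)
  have W: "open W" by (simp add: W_def open_Compl)
  have diff: "\<And>y. y \<in> W \<Longrightarrow> \<rho> differentiable (at y)" and cont: "continuous_on W (grad \<rho>)"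
    and nz: "\<And>y. y \<in> W \<Longrightarrow> grad \<rho> y \<noteq> 0"
    using \<rho>'(2) smooth_on_differentiable smooth_on_grad_continuous grad_homogeneous_norm_nonzero[OF \<rho>]
    unfolding W_def by auto
  have coarea_meas: "(\<lambda>s. \<integral>\<^sup>+y \<in> {y \<in> W. \<rho> y = s}. f y \<partial>H) \<in> borel_measurable borel"
    if "f \<in> borel_measurable borel" for f
    unfolding H_def by (rule coarea(1)[OF W diff cont nz that])
  have coarea_int: "(\<integral>\<^sup>+s. (\<integral>\<^sup>+y \<in> {y \<in> W. \<rho> y = s}. f y \<partial>H) \<partial>lborel) =
      face_measure j * (\<integral>\<^sup>+y. f y \<partial>grad_measure W \<rho>)"
    if "f \<in> borel_measurable borel" for f
    unfolding H_def by (rule coarea(2)[OF W diff cont nz that])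
  note [measurable] = grad_density_measurable[OF W cont]
  have \<rho>_pos: "0 < \<rho> y" if "y \<noteq> 0" for y using \<rho>'(3)[of y] \<rho>'(4)[of y] that by linarith
  obtain G where G[measurable]: "G \<in> borel_measurable borel"
    and G_eq: "AE x in lborel. x \<in> K \<longrightarrow> (norm (w x))\<^sup>2 = G x"
    using weak_hgrad_borel_version[OF K] unfolding w_def by blast
  \<comment> \<open>The reciprocal of the gradient norm, extended by \<open>inverse 0 = 0\<close> to the origin to make it Borel.\<close>
  define q where "q y = inverse (indicator W y * norm (grad \<rho> y))" for y
  have q_meas[measurable]: "q \<in> borel_measurable borel" unfolding q_def[abs_def] by measurable
  have q_eq: "q y = inverse (norm (grad \<rho> y))" if "y \<noteq> 0" for y using that by (simp add: q_def W_def)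
  define g where "g y = ennreal (G (m x\<^sub>0 y) * q y)" for y
  have g_meas[measurable]: "g \<in> borel_measurable borel" unfolding g_def[abs_def] by measurable
  define M where "M s = (\<integral>\<^sup>+y \<in> {y \<in> W. \<rho> y = s}. g y \<partial>H)" for s
  have M_meas[measurable]: "M \<in> borel_measurable borel" unfolding M_def[abs_def] by (rule coarea_meas[OF g_meas])
  define F where "F s = ennreal (c * (Q - 2) * s powr (1 - Q)) * M s" for s
  have F_meas: "F \<in> borel_measurable borel" unfolding F_def[abs_def] by measurable

  have mean: "AE s in lborel. 0 < s \<longrightarrow> s < \<delta> \<longrightarrow> mean_value m \<iota> d \<rho> \<Gamma> s
       (\<lambda>y. ennreal ((norm (w (m x\<^sub>0 y)) / norm (hgrad m d \<rho> y))\<^sup>2)) 0 = F s"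
  proof -
    have "AE y in lborel. (m x\<^sub>0 y \<in> K \<longrightarrow> (norm (w (m x\<^sub>0 y)))\<^sup>2 = G (m x\<^sub>0 y)) \<and> (y \<noteq> 0 \<longrightarrow> hgrad m d \<rho> y \<noteq> 0)"
      using AE_translate[OF G_eq] hgrad_homogeneous_norm_nonzero_AE[OF \<rho>] by eventually_elim auto
    then obtain N where N: "N \<in> null_sets lborel"
      and good: "\<And>y. y \<notin> N \<Longrightarrow> (m x\<^sub>0 y \<in> K \<longrightarrow> (norm (w (m x\<^sub>0 y)))\<^sup>2 = G (m x\<^sub>0 y)) \<and> (y \<noteq> 0 \<longrightarrow> hgrad m d \<rho> y \<noteq> 0)"
      by (auto simp: eventually_ae_filter subset_iff)
    have N_meas[measurable]: "N \<in> sets borel" using N by (auto simp: null_sets_def)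
    have "(\<integral>\<^sup>+y. indicator N y \<partial>grad_measure W \<rho>) = 0"
    proof -
      have "AE y in lborel. y \<notin> N" using N by (rule AE_not_in)
      then have "AE y in grad_measure W \<rho>. indicator N y = (0 :: ennreal)"
        unfolding grad_measure_def by (subst AE_density) auto
      moreover have "(\<lambda>y. indicator N y :: ennreal) \<in> borel_measurable (grad_measure W \<rho>)"
        by (simp add: grad_measure_def)
      ultimately show ?thesis by (subst nn_integral_0_iff_AE) auto
    qed
    then have "(\<integral>\<^sup>+s. (\<integral>\<^sup>+y \<in> {y \<in> W. \<rho> y = s}. indicator N y \<partial>H) \<partial>lborel) = 0"
      using coarea_int[of "indicator N"] by simp
    then have "AE s in lborel. (\<integral>\<^sup>+y \<in> {y \<in> W. \<rho> y = s}. indicator N y \<partial>H) = 0"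
      using coarea_meas[of "indicator N"] by (subst (asm) nn_integral_0_iff_AE) auto
    then show ?thesis
    proof eventually_elim
      case (elim s)
      show ?case
      proof (intro impI)
        assume s: "0 < s" "s < \<delta>"
        have sets_H[measurable_cong]: "sets H = sets borel" by (simp add: H_def)
        have [measurable]: "{y \<in> W. \<rho> y = s} \<in> sets borel" by (rule level_set_borel[OF W diff])
        have AE_N: "AE y in H. indicator N y * indicator {y \<in> W. \<rho> y = s} y = (0 :: ennreal)"
          using elim by (subst (asm) nn_integral_0_iff_AE) auto
        have level: "{y \<in> W. \<rho> y = s} = {y. \<rho> y = s}" using s \<rho>'(4)[of 0] by (auto simp: W_def)
        have "mean_value m \<iota> d \<rho> \<Gamma> s (\<lambda>y. ennreal ((norm (w (m x\<^sub>0 y)) / norm (hgrad m d \<rho> y))\<^sup>2)) 0 =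
          (\<integral>\<^sup>+y \<in> {y \<in> W. \<rho> y = s}. ennreal ((norm (w (m x\<^sub>0 y)) / norm (hgrad m d \<rho> y))\<^sup>2) * ennreal (kernel m d \<Gamma> y) \<partial>H)"
          unfolding mean_value_def gauge_ball_0 frontier_sublevel_homogeneous_norm[OF \<rho> s(1)] level H_def
          by (simp add: inverse_neutral)
        also have "\<dots> = (\<integral>\<^sup>+y. ennreal (c * (Q - 2) * s powr (1 - Q)) * (g y * indicator {y \<in> W. \<rho> y = s} y) \<partial>H)"
        proof (rule nn_integral_cong_AE)
          show "AE y in H. ennreal ((norm (w (m x\<^sub>0 y)) / norm (hgrad m d \<rho> y))\<^sup>2) * ennreal (kernel m d \<Gamma> y) *
              indicator {y \<in> W. \<rho> y = s} y = ennreal (c * (Q - 2) * s powr (1 - Q)) * (g y * indicator {y \<in> W. \<rho> y = s} y)"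
            using AE_N
          proof eventually_elim
            case (elim y)
            show ?case
            proof (cases "y \<in> {y \<in> W. \<rho> y = s}")
              case True
              then have y: "y \<noteq> 0" "\<rho> y = s" by (auto simp: W_def)
              have "y \<notin> N" using elim True by (auto simp: indicator_def split: if_splits)
              moreover have "m x\<^sub>0 y \<in> K"
                using \<delta> mem_gauge_ball_translate[of x\<^sub>0 y \<rho> \<delta>] y s by auto
              ultimately have Gy: "(norm (w (m x\<^sub>0 y)))\<^sup>2 = G (m x\<^sub>0 y)" and hy: "hgrad m d \<rho> y \<noteq> 0"
                using good y by auto
              have gy: "grad \<rho> y \<noteq> 0" using nz[of y] y by (simp add: W_def)
              define b where "b = c * (Q - 2) * s powr (1 - Q)"
              have b: "0 < b" using c Q s by (simp add: b_def)
              have "\<Gamma> 0 x = c * \<rho> x powr (2 - Q)" if "x \<noteq> 0" for x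
                using \<Gamma>[of 0 x] that by (simp add: inverse_neutral)
              note der = derivatives_of_radial_power[of \<rho> y "\<Gamma> 0" c "2 - Q", OF _ \<rho>'(1) \<rho>_pos[OF y(1)] this y(1)]
              have "c * (2 - Q) * \<rho> y powr (2 - Q - 1) = - b" by (simp add: b_def y algebra_simps)
              then have "grad (\<Gamma> 0) y = - b *\<^sub>R grad \<rho> y" "hgrad m d (\<Gamma> 0) y = - b *\<^sub>R hgrad m d \<rho> y"
                using der diff[of y] y by (auto simp: W_def)
              then have "kernel m d \<Gamma> y = b * ((norm (hgrad m d \<rho> y))\<^sup>2 / norm (grad \<rho> y))"
                using b gy by (simp add: kernel_def power_mult_distrib power2_eq_square)
              then have "(norm (w (m x\<^sub>0 y)) / norm (hgrad m d \<rho> y))\<^sup>2 * kernel m d \<Gamma> y = b * (G (m x\<^sub>0 y) * q y)"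
                using hy by (simp add: power_divide Gy q_eq[OF y(1)] field_simps)
              moreover have "0 \<le> kernel m d \<Gamma> y" by (simp add: kernel_def)
              ultimately have "ennreal ((norm (w (m x\<^sub>0 y)) / norm (hgrad m d \<rho> y))\<^sup>2) * ennreal (kernel m d \<Gamma> y) =
                  ennreal b * g y"
                using b by (simp add: ennreal_mult'[symmetric] ennreal_mult''[symmetric] g_def)
              then show ?thesis using True by (simp add: b_def)
            qed simp
          qed
        qed
        also have "\<dots> = F s" unfolding F_def M_def by (rule nn_integral_cmult) simp
        finally show "mean_value m \<iota> d \<rho> \<Gamma> s
          (\<lambda>y. ennreal ((norm (w (m x\<^sub>0 y)) / norm (hgrad m d \<rho> y))\<^sup>2)) 0 = F s" .
      qed
    qed
  qed

  obtain t where t: "face_measure j = ennreal t" "0 < t"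
    using face_measure_pos[of j] face_measure_finite[of j] by (cases "face_measure j") auto
  define C where "C = ennreal (1 / t) * ennreal (1 / (Q - 2))"
  have energy: "(\<integral>\<^sup>+\<xi> \<in> gauge_ball m \<iota> \<rho> x\<^sub>0 r. ennreal ((norm (w \<xi>))\<^sup>2 * \<Gamma> x\<^sub>0 \<xi>) \<partial>lebesgue) =
       C * (\<integral>\<^sup>+s \<in> {0<..<r}. ennreal s * F s \<partial>lborel)" (is "?I = _") if r: "0 < r" "r < \<delta>" for r
  proof -
    have gb[measurable]: "gauge_ball m \<iota> \<rho> x\<^sub>0 r \<in> sets borel"
      unfolding gauge_ball_def by measurable
    define p where "p y = c * \<rho> y powr (2 - Q)" for y
    have p_meas[measurable]: "p \<in> borel_measurable borel" unfolding p_def[abs_def] by measurable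
    have p_nonneg: "0 \<le> p y" for y using c by (simp add: p_def)
    define f where "f y = g y * (ennreal (p y) * indicator {y. \<rho> y < r} y)" for y
    have f_meas[measurable]: "f \<in> borel_measurable borel" unfolding f_def[abs_def] by measurable
    have "?I = (\<integral>\<^sup>+\<xi> \<in> gauge_ball m \<iota> \<rho> x\<^sub>0 r. ennreal ((norm (w \<xi>))\<^sup>2 * \<Gamma> x\<^sub>0 \<xi>) \<partial>lborel)"
      by (simp add: nn_integral_completion)
    also have "\<dots> = (\<integral>\<^sup>+\<xi> \<in> gauge_ball m \<iota> \<rho> x\<^sub>0 r. ennreal (G \<xi> * p (m (\<iota> x\<^sub>0) \<xi>)) \<partial>lborel)"
    proof (rule nn_integral_cong_AE)
      have sub: "gauge_ball m \<iota> \<rho> x\<^sub>0 r \<subseteq> K" using \<delta> r by (auto simp: gauge_ball_def)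
      show "AE \<xi> in lborel. ennreal ((norm (w \<xi>))\<^sup>2 * \<Gamma> x\<^sub>0 \<xi>) * indicator (gauge_ball m \<iota> \<rho> x\<^sub>0 r) \<xi> =
          ennreal (G \<xi> * p (m (\<iota> x\<^sub>0) \<xi>)) * indicator (gauge_ball m \<iota> \<rho> x\<^sub>0 r) \<xi>"
        using G_eq AE_lborel_singleton[of x\<^sub>0]
        by eventually_elim (use sub \<Gamma>[of x\<^sub>0] in \<open>auto simp: indicator_def p_def\<close>)
    qed
    also have "\<dots> = (\<integral>\<^sup>+y. ennreal (G (m x\<^sub>0 y) * p y) * indicator {y. \<rho> y < r} y \<partial>lborel)"
      by (subst nn_integral_translate[where a = x\<^sub>0])
        (auto simp: assoc[symmetric] mem_gauge_ball_translate indicator_def intro!: nn_integral_cong)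
    also have "\<dots> = (\<integral>\<^sup>+y. ennreal (indicator W y * norm (grad \<rho> y)) * f y \<partial>lborel)"
    proof (rule nn_integral_cong_AE)
      show "AE y in lborel. ennreal (G (m x\<^sub>0 y) * p y) * indicator {y. \<rho> y < r} y =
          ennreal (indicator W y * norm (grad \<rho> y)) * f y"
        using AE_lborel_singleton[of 0]
      proof eventually_elim
        case (elim y)
        then have G_y: "norm (grad \<rho> y) * (G (m x\<^sub>0 y) * q y) = G (m x\<^sub>0 y)"
          using nz[of y] by (simp add: q_eq W_def)
        have "ennreal (norm (grad \<rho> y)) * g y = ennreal (norm (grad \<rho> y) * (G (m x\<^sub>0 y) * q y))"
          unfolding g_def by (simp add: ennreal_mult')
        then have "ennreal (norm (grad \<rho> y)) * g y = ennreal (G (m x\<^sub>0 y))" by (simp only: G_y)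
        then have "ennreal (norm (grad \<rho> y)) * f y = ennreal (G (m x\<^sub>0 y)) * (ennreal (p y) * indicator {y. \<rho> y < r} y)"
          unfolding f_def by (simp add: mult.assoc[symmetric])
        then show ?case using elim p_nonneg by (simp add: W_def ennreal_mult'' mult.assoc)
      qed
    qed
    also have "\<dots> = (\<integral>\<^sup>+y. f y \<partial>grad_measure W \<rho>)"
      unfolding grad_measure_def by (subst nn_integral_density) auto
    finally have I: "?I = (\<integral>\<^sup>+y. f y \<partial>grad_measure W \<rho>)" .
    have "ennreal t * ?I = (\<integral>\<^sup>+s. (\<integral>\<^sup>+y \<in> {y \<in> W. \<rho> y = s}. f y \<partial>H) \<partial>lborel)"
      using coarea_int[OF f_meas] by (simp add: I t)
    also have "\<dots> = (\<integral>\<^sup>+s. ennreal (1 / (Q - 2)) * (ennreal s * F s * indicator {0<..<r} s) \<partial>lborel)"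
    proof (rule nn_integral_cong)
      fix s :: real
      have [measurable]: "{y \<in> W. \<rho> y = s} \<in> sets H"
        using level_set_borel[OF W diff] by (simp add: H_def)
      have [measurable]: "g \<in> borel_measurable H" by (simp add: H_def)
      show "(\<integral>\<^sup>+y \<in> {y \<in> W. \<rho> y = s}. f y \<partial>H) = ennreal (1 / (Q - 2)) * (ennreal s * F s * indicator {0<..<r} s)"
      proof (cases "0 < s \<and> s < r")
        case True
        have "(\<integral>\<^sup>+y \<in> {y \<in> W. \<rho> y = s}. f y \<partial>H) =
            (\<integral>\<^sup>+y. ennreal (c * s powr (2 - Q)) * (g y * indicator {y \<in> W. \<rho> y = s} y) \<partial>H)"
          using True by (intro nn_integral_cong) (auto simp: f_def p_def indicator_def mult.commute)
        also have "\<dots> = ennreal (c * s powr (2 - Q)) * M s" unfolding M_def by (rule nn_integral_cmult) simp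
        also have "c * s powr (2 - Q) = 1 / (Q - 2) * (s * (c * (Q - 2) * s powr (1 - Q)))"
        proof -
          have "s powr (2 - Q) = s powr (1 + (1 - Q))" by simp
          also have "\<dots> = s * s powr (1 - Q)" using True by (simp only: powr_add) simp
          finally show ?thesis using Q by simp
        qed
        also have "ennreal \<dots> * M s = ennreal (1 / (Q - 2)) * (ennreal s * F s)"
        proof -
          have "ennreal (k * (s * b)) * M s = ennreal k * (ennreal s * (ennreal b * M s))"
            if "0 \<le> k" "0 \<le> b" for k b
            using that True by (simp add: ennreal_mult mult.assoc)
          moreover have "0 \<le> 1 / (Q - 2)" "0 \<le> c * (Q - 2) * s powr (1 - Q)" using Q c by auto
          ultimately show ?thesis unfolding F_def by blast
        qed
        finally show ?thesis using True by simp
      next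
        case False
        have "(\<integral>\<^sup>+y \<in> {y \<in> W. \<rho> y = s}. f y \<partial>H) = (\<integral>\<^sup>+y. 0 \<partial>H)"
          using False \<rho>_pos by (intro nn_integral_cong) (auto simp: f_def indicator_def W_def)
        then show ?thesis using False by simp
      qed
    qed
    also have "\<dots> = ennreal (1 / (Q - 2)) * (\<integral>\<^sup>+s \<in> {0<..<r}. ennreal s * F s \<partial>lborel)"
      using F_meas by (intro nn_integral_cmult) simp
    finally have "ennreal t * ?I = ennreal (1 / (Q - 2)) * (\<integral>\<^sup>+s \<in> {0<..<r}. ennreal s * F s \<partial>lborel)" .
    then have "ennreal (1 / t) * (ennreal t * ?I) = C * (\<integral>\<^sup>+s \<in> {0<..<r}. ennreal s * F s \<partial>lborel)"
      by (simp add: C_def mult.assoc)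
    moreover have "ennreal (1 / t) * (ennreal t * ?I) = ?I"
      using t by (simp add: mult.assoc[symmetric] ennreal_mult[symmetric])
    ultimately show ?thesis by simp
  qed
  show thesis by (rule that[OF F_meas mean energy])
qed

section \<open>Monotonicity\<close>

lemma mono_ae_near_0_cong_AE:
  assumes "mono_ae_near_0 f" and "0 < \<delta>" and "AE s in lborel. 0 < s \<longrightarrow> s < \<delta> \<longrightarrow> f s = g s"
  shows "mono_ae_near_0 g"
proof -
  obtain \<delta>' N where f: "0 < \<delta>'" "N \<in> null_sets lebesgue" "mono_on ({0<..<\<delta>'} - N) f"
    using assms(1) unfolding mono_ae_near_0_def by blast
  obtain N' where N': "N' \<in> null_sets lborel" "{s. \<not> (0 < s \<longrightarrow> s < \<delta> \<longrightarrow> f s = g s)} \<subseteq> N'"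
    using assms(3) by (auto simp: eventually_ae_filter)
  have "N \<union> N' \<in> null_sets lebesgue"
    using f(2) N'(1) by (intro null_sets.Un) (auto simp: null_sets_completionI)
  moreover have "mono_on ({0<..<min \<delta> \<delta>'} - (N \<union> N')) g"
  proof (rule mono_onI)
    fix r s assume rs: "r \<in> {0<..<min \<delta> \<delta>'} - (N \<union> N')" "s \<in> {0<..<min \<delta> \<delta>'} - (N \<union> N')" "r \<le> s"
    have "0 < s" using rs by auto
    have "f x = g x" if "0 < x" "x < \<delta>" "x \<notin> N'" for x using that N'(2) by blast
    then have "f r = g r" "f s = g s" using rs \<open>0 < s\<close> by auto
    moreover have "f r \<le> f s" using rs by (intro mono_onD[OF f(3)]) auto
    ultimately show "g r \<le> g s" by simp
  qed
  ultimately show ?thesis unfolding mono_ae_near_0_def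
    using assms(2) f(1) by (intro exI[of _ "min \<delta> \<delta>'"]) auto
qed

text \<open>After the substitution \<open>s = r t\<close> the weighted average becomes the integral of
  \<open>t F (r t)\<close> over \<open>t \<in> (0, 1)\<close>.\<close>

lemma weighted_average_mono:
  assumes F[measurable]: "F \<in> borel_measurable borel" and mono: "mono_ae_near_0 F"
  shows "\<exists>\<delta>>0. mono_on {0<..<\<delta>} (\<lambda>r. ennreal (1 / r\<^sup>2) * (\<integral>\<^sup>+s \<in> {0<..<r}. ennreal s * F s \<partial>lborel))"
proof -
  obtain \<delta> N where \<delta>: "0 < \<delta>" and N: "N \<in> null_sets lebesgue" and F_mono: "mono_on ({0<..<\<delta>} - N) F"
    using mono unfolding mono_ae_near_0_def by blast
  obtain N' where N': "N' \<in> null_sets lborel" "N \<subseteq> N'"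
    using N by (metis null_sets_completion_iff2)
  have [measurable]: "N' \<in> sets borel" using N' by (auto simp: null_sets_def)
  have subst: "ennreal (1 / r\<^sup>2) * (\<integral>\<^sup>+s \<in> {0<..<r}. ennreal s * F s \<partial>lborel) =
      (\<integral>\<^sup>+t \<in> {0<..<1}. ennreal t * F (r * t) \<partial>lborel)" if r: "0 < r" for r
  proof -
    have "(\<integral>\<^sup>+s \<in> {0<..<r}. ennreal s * F s \<partial>lborel) =
        ennreal r * (\<integral>\<^sup>+t. ennreal (r * t) * F (r * t) * indicator {0<..<r} (r * t) \<partial>lborel)"
      using nn_integral_real_affine[of "\<lambda>s. ennreal s * F s * indicator {0<..<r} s" r 0] r by simp
    also have "(\<integral>\<^sup>+t. ennreal (r * t) * F (r * t) * indicator {0<..<r} (r * t) \<partial>lborel) =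
        (\<integral>\<^sup>+t. ennreal r * (ennreal t * F (r * t) * indicator {0<..<1} t) \<partial>lborel)"
      using r by (intro nn_integral_cong) (auto simp: indicator_def ennreal_mult mult.assoc zero_less_mult_iff)
    also have "\<dots> = ennreal r * (\<integral>\<^sup>+t \<in> {0<..<1}. ennreal t * F (r * t) \<partial>lborel)"
      by (rule nn_integral_cmult) simp
    finally have "(\<integral>\<^sup>+s \<in> {0<..<r}. ennreal s * F s \<partial>lborel) =
        ennreal (r * r) * (\<integral>\<^sup>+t \<in> {0<..<1}. ennreal t * F (r * t) \<partial>lborel)"
      using r by (simp add: ennreal_mult mult.assoc)
    moreover have "ennreal (1 / r\<^sup>2) * ennreal (r * r) = 1"
      using r by (simp add: ennreal_mult[symmetric] power2_eq_square)
    ultimately show ?thesis by (simp add: mult.assoc[symmetric])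
  qed
  have "mono_on {0<..<\<delta>} (\<lambda>r. ennreal (1 / r\<^sup>2) * (\<integral>\<^sup>+s \<in> {0<..<r}. ennreal s * F s \<partial>lborel))"
  proof (rule mono_onI)
    fix r r' assume r: "r \<in> {0<..<\<delta>}" "r' \<in> {0<..<\<delta>}" "r \<le> r'"
    have AE: "AE t in lborel. 0 + a * t \<notin> N'" if "0 < a" for a :: real
      using that AE_not_in[OF N'(1)] by (intro AE_borel_affine) auto
    have AE_r: "AE t in lborel. r * t \<notin> N'" "AE t in lborel. r' * t \<notin> N'"
      using AE[of r] AE[of r'] r by auto
    have "(\<integral>\<^sup>+t \<in> {0<..<1}. ennreal t * F (r * t) \<partial>lborel) \<le> (\<integral>\<^sup>+t \<in> {0<..<1}. ennreal t * F (r' * t) \<partial>lborel)"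
    proof (rule nn_integral_mono_AE)
      show "AE t in lborel. ennreal t * F (r * t) * indicator {0<..<1} t \<le> ennreal t * F (r' * t) * indicator {0<..<1} t"
        using AE_r
      proof eventually_elim
        case (elim t)
        show ?case
        proof (cases "t \<in> {0<..<1}")
          case True
          have "0 < r" "r < \<delta>" "0 < r'" "r' < \<delta>" using r by auto
          moreover from this have "r * t \<le> r" "r' * t \<le> r'"
            using True by (auto intro: mult_left_le)
          ultimately have "r * t < \<delta>" "r' * t < \<delta>" by linarith+
          then have "F (r * t) \<le> F (r' * t)"
            using True r elim N'(2) by (intro mono_onD[OF F_mono]) (auto intro: mult_right_mono)
          then show ?thesis by (intro mult_right_mono mult_left_mono) auto
        qed simp
      qed
    qed
    then show "ennreal (1 / r\<^sup>2) * (\<integral>\<^sup>+s \<in> {0<..<r}. ennreal s * F s \<partial>lborel) \<le>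
        ennreal (1 / r'\<^sup>2) * (\<integral>\<^sup>+s \<in> {0<..<r'}. ennreal s * F s \<partial>lborel)"
      using r by (simp add: subst)
  qed
  with \<delta> show ?thesis by blast
qed

theorem theorem1p1:
  fixes m :: "real ^ 'n \<Rightarrow> real ^ 'n \<Rightarrow> real ^ 'n"
    and \<iota> :: "real ^ 'n \<Rightarrow> real ^ 'n"
    and d :: "'n \<Rightarrow> nat"
    and \<rho> :: "real ^ 'n \<Rightarrow> real"
    and \<Gamma> :: "real ^ 'n \<Rightarrow> real ^ 'n \<Rightarrow> real"
    and c :: real
    and \<Omega> :: "(real ^ 'n) set"
    and u :: "real ^ 'n \<Rightarrow> real"
    and g :: "real ^ 'n \<Rightarrow> real ^ 'n"
    and x\<^sub>0 :: "real ^ 'n"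
  assumes "carnot_group m \<iota> d"
    and "3 \<le> homogeneous_dim d"
    and "homogeneous_norm d \<rho>"
    and "0 < c"
    and "fundamental_solution m d \<Gamma>"
    and "\<And>x y. x \<noteq> y \<Longrightarrow> \<Gamma> x y = c * \<rho> (m (\<iota> x) y) powr (2 - real (homogeneous_dim d))"
    and "open \<Omega>"
    and "continuous_on \<Omega> u"
    and "has_weak_hgrad m d \<Omega> u g"
    and "locally_integrable_on \<Omega> (\<lambda>x. (norm (g x))\<^sup>2)"
    and "x\<^sub>0 \<in> frontier {x \<in> \<Omega>. 0 < u x} \<inter> \<Omega>"
    and "mono_ae_near_0 (\<lambda>r. mean_value m \<iota> d \<rho> \<Gamma> r
           (\<lambda>y. ennreal ((norm (weak_hgrad m d \<Omega> (\<lambda>x. max (u x) 0) (m x\<^sub>0 y))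
                          / norm (hgrad m d \<rho> y))\<^sup>2)) 0)"
    and "mono_ae_near_0 (\<lambda>r. mean_value m \<iota> d \<rho> \<Gamma> r
           (\<lambda>y. ennreal ((norm (weak_hgrad m d \<Omega> (\<lambda>x. max (- u x) 0) (m x\<^sub>0 y))
                          / norm (hgrad m d \<rho> y))\<^sup>2)) 0)"
  shows "\<exists>\<delta>>0. (\<forall>r\<in>{0<..<\<delta>}. closure (gauge_ball m \<iota> \<rho> x\<^sub>0 r) \<subseteq> \<Omega>) \<and>
           mono_on {0<..<\<delta>} (J m \<iota> d \<rho> \<Gamma> \<Omega> u x\<^sub>0)"
proof -
  interpret carnot_group m \<iota> d by fact
  have Q: "2 < real (homogeneous_dim d)" using assms(2) by linarith
  have "x\<^sub>0 \<in> \<Omega>" using assms(11) by blast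
  then obtain e where e: "0 < e" "cball x\<^sub>0 e \<subseteq> \<Omega>" using \<open>open \<Omega>\<close> open_contains_cball by blast
  obtain \<delta> where \<delta>: "0 < \<delta>" and ball: "gauge_ball m \<iota> \<rho> x\<^sub>0 \<delta> \<subseteq> cball x\<^sub>0 e"
    using gauge_ball_small[OF assms(3) e(1)] by blast
  define I where "I v r = (\<integral>\<^sup>+\<xi> \<in> gauge_ball m \<iota> \<rho> x\<^sub>0 r.
      ennreal ((norm (weak_hgrad m d \<Omega> v \<xi>))\<^sup>2 * \<Gamma> x\<^sub>0 \<xi>) \<partial>lebesgue)" for v r
  have I_mono: "\<exists>\<epsilon>>0. mono_on {0<..<\<epsilon>} (\<lambda>r. ennreal (1 / r\<^sup>2) * I v r)"
    if mono: "mono_ae_near_0 (\<lambda>r. mean_value m \<iota> d \<rho> \<Gamma> r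
        (\<lambda>y. ennreal ((norm (weak_hgrad m d \<Omega> v (m x\<^sub>0 y)) / norm (hgrad m d \<rho> y))\<^sup>2)) 0)" for v
  proof -
    obtain F C where F: "F \<in> borel_measurable borel"
      and mean: "AE s in lborel. 0 < s \<longrightarrow> s < \<delta> \<longrightarrow> mean_value m \<iota> d \<rho> \<Gamma> s
        (\<lambda>y. ennreal ((norm (weak_hgrad m d \<Omega> v (m x\<^sub>0 y)) / norm (hgrad m d \<rho> y))\<^sup>2)) 0 = F s"
      and energy: "\<And>r. 0 < r \<Longrightarrow> r < \<delta> \<Longrightarrow> I v r = C * (\<integral>\<^sup>+s \<in> {0<..<r}. ennreal s * F s \<partial>lborel)"
      unfolding I_def
      using energy_eq_integral_of_mean_values[OF assms(3) Q assms(4) assms(6) ball compact_cball e(2), of v]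
      by blast
    obtain \<epsilon> where \<epsilon>: "0 < \<epsilon>"
      and avg: "mono_on {0<..<\<epsilon>} (\<lambda>r. ennreal (1 / r\<^sup>2) * (\<integral>\<^sup>+s \<in> {0<..<r}. ennreal s * F s \<partial>lborel))"
      using weighted_average_mono[OF F mono_ae_near_0_cong_AE[OF mono \<delta> mean]] by blast
    have "mono_on {0<..<min \<epsilon> \<delta>} (\<lambda>r. ennreal (1 / r\<^sup>2) * I v r)"
    proof (rule mono_onI)
      fix r r' assume r: "r \<in> {0<..<min \<epsilon> \<delta>}" "r' \<in> {0<..<min \<epsilon> \<delta>}" "r \<le> r'"
      have "C * (ennreal (1 / r\<^sup>2) * (\<integral>\<^sup>+s \<in> {0<..<r}. ennreal s * F s \<partial>lborel)) \<le>
          C * (ennreal (1 / r'\<^sup>2) * (\<integral>\<^sup>+s \<in> {0<..<r'}. ennreal s * F s \<partial>lborel))"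
        using r by (intro mult_left_mono mono_onD[OF avg]) auto
      then show "ennreal (1 / r\<^sup>2) * I v r \<le> ennreal (1 / r'\<^sup>2) * I v r'"
        using r by (simp add: energy mult.left_commute)
    qed
    then show ?thesis using \<epsilon> \<delta> by (intro exI[of _ "min \<epsilon> \<delta>"]) auto
  qed
  obtain \<epsilon>1 where \<epsilon>1: "0 < \<epsilon>1" "mono_on {0<..<\<epsilon>1} (\<lambda>r. ennreal (1 / r\<^sup>2) * I (\<lambda>x. max (u x) 0) r)"
    using I_mono[OF assms(12)] by blast
  obtain \<epsilon>2 where \<epsilon>2: "0 < \<epsilon>2" "mono_on {0<..<\<epsilon>2} (\<lambda>r. ennreal (1 / r\<^sup>2) * I (\<lambda>x. max (- u x) 0) r)"
    using I_mono[OF assms(13)] by blast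
  define \<epsilon> where "\<epsilon> = min \<delta> (min \<epsilon>1 \<epsilon>2)"
  have J: "J m \<iota> d \<rho> \<Gamma> \<Omega> u x\<^sub>0 r = (ennreal (1 / r\<^sup>2) * I (\<lambda>x. max (u x) 0) r) *
      (ennreal (1 / r\<^sup>2) * I (\<lambda>x. max (- u x) 0) r)" for r
  proof -
    have "ennreal (1 / r ^ 4) = ennreal (1 / r\<^sup>2) * ennreal (1 / r\<^sup>2)"
      by (simp add: ennreal_mult[symmetric] power_add[symmetric])
    then show ?thesis by (simp add: J_def I_def ac_simps)
  qed
  show ?thesis
  proof (intro exI[of _ \<epsilon>] conjI ballI)
    show "0 < \<epsilon>" using \<delta> \<epsilon>1 \<epsilon>2 by (simp add: \<epsilon>_def)
    fix r assume "r \<in> {0<..<\<epsilon>}"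
    then have "gauge_ball m \<iota> \<rho> x\<^sub>0 r \<subseteq> gauge_ball m \<iota> \<rho> x\<^sub>0 \<delta>" by (auto simp: gauge_ball_def \<epsilon>_def)
    then have "closure (gauge_ball m \<iota> \<rho> x\<^sub>0 r) \<subseteq> cball x\<^sub>0 e"
      using ball by (intro closure_minimal) auto
    then show "closure (gauge_ball m \<iota> \<rho> x\<^sub>0 r) \<subseteq> \<Omega>" using e(2) by simp
  next
    show "mono_on {0<..<\<epsilon>} (J m \<iota> d \<rho> \<Gamma> \<Omega> u x\<^sub>0)"
    proof (rule mono_onI)
      fix r r' assume r: "r \<in> {0<..<\<epsilon>}" "r' \<in> {0<..<\<epsilon>}" "r \<le> r'"
      then show "J m \<iota> d \<rho> \<Gamma> \<Omega> u x\<^sub>0 r \<le> J m \<iota> d \<rho> \<Gamma> \<Omega> u x\<^sub>0 r'"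
        unfolding J
        by (intro mult_mono mono_onD[OF \<epsilon>1(2)] mono_onD[OF \<epsilon>2(2)]) (auto simp: \<epsilon>_def)
    qed
  qed
qed

end
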